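(* Let $(M,g)$ be a connected $C^2$ Riemannian manifold of dimension $n$, possibly with boundary, that is weakly asymptotically flat in the sense that a subset of $M$ is diffeomorphic to $\mathbb R^n\setminus\bar B_1(0)$, and in these coordinates $x^1,\ldots,x^n$, $$g_{ij}=\delta_{ij}+O_2(|x|^{-\beta})$$ for some $\beta>0$. Assume that $(M,g)$ is equipped with Killing fields $X_1,\ldots,X_n$ (defined on all of $M$) that are asymptotic to the coordinate translation directions in the sense that $$X_i=\frac{\partial}{\partial x^i}+O_2(|x|^{-\beta}),\qquad i=1,\ldots,n.$$ Then $X_1,\ldots,X_n$ form a covariant constant global orthonormal frame on $M$, and in particular $g$ must be flat.
   Context: $u=O_2(|x|^{-\beta})$ means that there is a constant $C>0$ such that $\sum_{|I|=0}^{2}\big||x|^{\beta+|I|}\partial^I u(x)\big|\le C$ on $\mathbb R^n\setminus\bar B_1(0)$, applied to coordinate components in the case of tensors and vector fields. No completeness or curvature assumption is made on $(M,g)$. "Covariant constant" means $\nabla X_i=0$ for the Levi-Civita connection of $g$. *)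

theory Defs
  imports "HOL-Analysis.Analysis"
begin

section \<open>Partial derivatives on open subsets of space or half-space\<close>

text \<open>
  Derivatives are taken relative to the set \<open>S\<close>. The sets that occur below are relatively open in
  the whole space or in a closed half-space, where this derivative is unique: it is the usual one
  at interior points and the one-sided one (the continuous extension, for \<open>C\<^sup>1\<close> functions)
  at boundary points.
\<close>

definition partial :: "(real^'n) set \<Rightarrow> 'n \<Rightarrow> (real^'n \<Rightarrow> real) \<Rightarrow> real^'n \<Rightarrow> real" where
  "partial S i f x = frechet_derivative f (at x within S) (axis i 1)"

primrec Ck_on :: "nat \<Rightarrow> (real^'n) set \<Rightarrow> (real^'n \<Rightarrow> real) \<Rightarrow> bool" where
  "Ck_on 0 S f \<longleftrightarrow> continuous_on S f"
| "Ck_on (Suc m) S f \<longleftrightarrow>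
     (\<forall>x\<in>S. f differentiable (at x within S)) \<and> (\<forall>i. Ck_on m S (partial S i f))"

text \<open>
  In the second-order term the sum runs over ordered pairs of indices, so mixed derivatives are
  counted twice compared with a sum over multi-indices; this only changes the constant \<open>C\<close>.
\<close>

definition O2 :: "real \<Rightarrow> (real^'n \<Rightarrow> real) \<Rightarrow> bool" where
  "O2 \<beta> u \<longleftrightarrow>
     (let S = - cball 0 1 in
      Ck_on 2 S u \<and>
      (\<exists>C>0. \<forall>x\<in>S.
         \<bar>norm x powr \<beta> * u x\<bar>
         + (\<Sum>i\<in>UNIV. \<bar>norm x powr (\<beta> + 1) * partial S i u x\<bar>)
         + (\<Sum>i\<in>UNIV. \<Sum>j\<in>UNIV. \<bar>norm x powr (\<beta> + 2) * partial S i (partial S j u) x\<bar>)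
         \<le> C))"


section \<open>Manifolds with boundary\<close>

text \<open>A chart \<open>(U, \<phi>)\<close> is a coordinate map \<open>\<phi>\<close> on the domain \<open>U\<close>; \<open>\<phi>\<close> is irrelevant outside \<open>U\<close>.\<close>

type_synonym ('a, 'n) chart = "'a set \<times> ('a \<Rightarrow> real^'n)"

definition coord_image :: "('a, 'n::finite) chart \<Rightarrow> (real^'n) set" where
  "coord_image c = snd c ` fst c"

text \<open>The empty boundary is allowed: a chart has values in space or in a closed half-space.\<close>

definition is_chart :: "'a topology \<Rightarrow> ('a, 'n::finite) chart \<Rightarrow> bool" where
  "is_chart M c \<longleftrightarrow>
     openin M (fst c) \<and>
     (open (coord_image c) \<or>
      (\<exists>k. openin (top_of_set {x. 0 \<le> x $ k}) (coord_image c))) \<and>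
     homeomorphic_map (subtopology M (fst c)) (top_of_set (coord_image c)) (snd c)"

definition overlap :: "('a, 'n::finite) chart \<Rightarrow> ('a, 'n::finite) chart \<Rightarrow> (real^'n) set" where
  "overlap c d = snd c ` (fst c \<inter> fst d)"

definition transition :: "('a, 'n::finite) chart \<Rightarrow> ('a, 'n::finite) chart \<Rightarrow> real^'n \<Rightarrow> real^'n" where
  "transition c d = snd d \<circ> inv_into (fst c) (snd c)"

definition jacobian :: "('a, 'n::finite) chart \<Rightarrow> ('a, 'n::finite) chart \<Rightarrow> real^'n \<Rightarrow> real^'n^'n" where
  "jacobian c d x = (\<chi> k i. partial (overlap c d) i (\<lambda>y. transition c d y $ k) x)"

text \<open>
  Transition maps are \<open>C\<^sup>3\<close>, the least regularity for which it is meaningful, independently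
  of the chart, that a metric is \<open>C\<^sup>2\<close>. The atlas need not be maximal (but may be), and
  smooth atlases are included.
\<close>

definition manifold_with_boundary :: "'a topology \<Rightarrow> ('a, 'n::finite) chart set \<Rightarrow> bool" where
  "manifold_with_boundary M A \<longleftrightarrow>
     Hausdorff_space M \<and> second_countable M \<and>
     (\<forall>c\<in>A. is_chart M c) \<and>
     (\<Union>c\<in>A. fst c) = topspace M \<and>
     (\<forall>c\<in>A. \<forall>d\<in>A. \<forall>k. Ck_on 3 (overlap c d) (\<lambda>x. transition c d x $ k))"


section \<open>Riemannian metrics and vector fields\<close>

text \<open>
  Tensor fields are given classically by their components: for every chart \<open>c\<close> of the atlas, a
  function of the coordinates \<open>x \<in> coord_image c\<close>, subject to the transformation law.
\<close>

type_synonym ('a, 'n) vector_field = "('a, 'n) chart \<Rightarrow> real^'n \<Rightarrow> real^'n"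
type_synonym ('a, 'n) metric = "('a, 'n) chart \<Rightarrow> real^'n \<Rightarrow> real^'n^'n"

definition C2_riemannian_metric :: "('a, 'n::finite) chart set \<Rightarrow> ('a, 'n::finite) metric \<Rightarrow> bool" where
  "C2_riemannian_metric A g \<longleftrightarrow>
     (\<forall>c\<in>A.
        (\<forall>i j. Ck_on 2 (coord_image c) (\<lambda>x. g c x $ i $ j)) \<and>
        (\<forall>x\<in>coord_image c.
           (\<forall>i j. g c x $ i $ j = g c x $ j $ i) \<and>
           (\<forall>v. v \<noteq> 0 \<longrightarrow> 0 < v \<bullet> (g c x *v v)))) \<and>
     (\<forall>c\<in>A. \<forall>d\<in>A. \<forall>x\<in>overlap c d. \<forall>i j.
        g c x $ i $ j =
          (\<Sum>k\<in>UNIV. \<Sum>l\<in>UNIV.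
             jacobian c d x $ k $ i * jacobian c d x $ l $ j * g d (transition c d x) $ k $ l))"

definition C1_vector_field :: "('a, 'n::finite) chart set \<Rightarrow> ('a, 'n::finite) vector_field \<Rightarrow> bool" where
  "C1_vector_field A X \<longleftrightarrow>
     (\<forall>c\<in>A. \<forall>k. Ck_on 1 (coord_image c) (\<lambda>x. X c x $ k)) \<and>
     (\<forall>c\<in>A. \<forall>d\<in>A. \<forall>x\<in>overlap c d. X d (transition c d x) = jacobian c d x *v X c x)"

text \<open>The components of the Lie derivative of \<open>g\<close> along \<open>X\<close>.\<close>

definition lie_metric ::
  "('a, 'n::finite) metric \<Rightarrow> ('a, 'n::finite) vector_field \<Rightarrow> ('a, 'n::finite) chart \<Rightarrow> 'n \<Rightarrow> 'n \<Rightarrow> real^'n \<Rightarrow> real" where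
  "lie_metric g X c i j x =
     (let S = coord_image c in
      \<Sum>k\<in>UNIV. X c x $ k * partial S k (\<lambda>y. g c y $ i $ j) x
              + g c x $ k $ j * partial S i (\<lambda>y. X c y $ k) x
              + g c x $ i $ k * partial S j (\<lambda>y. X c y $ k) x)"

definition killing_field ::
  "('a, 'n::finite) chart set \<Rightarrow> ('a, 'n::finite) metric \<Rightarrow> ('a, 'n::finite) vector_field \<Rightarrow> bool" where
  "killing_field A g X \<longleftrightarrow>
     C1_vector_field A X \<and>
     (\<forall>c\<in>A. \<forall>x\<in>coord_image c. \<forall>i j. lie_metric g X c i j x = 0)"


section \<open>Levi-Civita connection and curvature\<close>

text \<open>\<open>christoffel g c k i j\<close> has upper index \<open>k\<close>.\<close>

definition christoffel ::
  "('a, 'n::finite) metric \<Rightarrow> ('a, 'n::finite) chart \<Rightarrow> 'n \<Rightarrow> 'n \<Rightarrow> 'n \<Rightarrow> real^'n \<Rightarrow> real" where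
  "christoffel g c k i j x =
     (let S = coord_image c in
      (\<Sum>l\<in>UNIV. matrix_inv (g c x) $ k $ l *
         (partial S i (\<lambda>y. g c y $ j $ l) x + partial S j (\<lambda>y. g c y $ i $ l) x
          - partial S l (\<lambda>y. g c y $ i $ j) x)) / 2)"

text \<open>The components \<open>\<nabla>\<^sub>i X\<^sup>k\<close>.\<close>

definition cov_deriv ::
  "('a, 'n::finite) metric \<Rightarrow> ('a, 'n::finite) vector_field \<Rightarrow> ('a, 'n::finite) chart \<Rightarrow> 'n \<Rightarrow> 'n \<Rightarrow> real^'n \<Rightarrow> real" where
  "cov_deriv g X c i k x =
     partial (coord_image c) i (\<lambda>y. X c y $ k) x
     + (\<Sum>j\<in>UNIV. christoffel g c k i j x * X c x $ j)"

definition covariant_constant ::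
  "('a, 'n::finite) chart set \<Rightarrow> ('a, 'n::finite) metric \<Rightarrow> ('a, 'n::finite) vector_field \<Rightarrow> bool" where
  "covariant_constant A g X \<longleftrightarrow>
     (\<forall>c\<in>A. \<forall>x\<in>coord_image c. \<forall>i k. cov_deriv g X c i k x = 0)"

text \<open>
  \<open>riemann g c l k i j\<close> is the \<open>l\<close>-th component of \<open>R(\<partial>\<^sub>i, \<partial>\<^sub>j)\<partial>\<^sub>k\<close>, where
  \<open>R(\<partial>\<^sub>i, \<partial>\<^sub>j) = \<nabla>\<^sub>i\<nabla>\<^sub>j - \<nabla>\<^sub>j\<nabla>\<^sub>i\<close>.
\<close>

definition riemann ::
  "('a, 'n::finite) metric \<Rightarrow> ('a, 'n::finite) chart \<Rightarrow> 'n \<Rightarrow> 'n \<Rightarrow> 'n \<Rightarrow> 'n \<Rightarrow> real^'n \<Rightarrow> real" where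
  "riemann g c l k i j x =
     (let S = coord_image c in
      partial S i (christoffel g c l j k) x - partial S j (christoffel g c l i k) x
      + (\<Sum>m\<in>UNIV. christoffel g c l i m x * christoffel g c m j k x
                 - christoffel g c l j m x * christoffel g c m i k x))"

definition flat_metric :: "('a, 'n::finite) chart set \<Rightarrow> ('a, 'n::finite) metric \<Rightarrow> bool" where
  "flat_metric A g \<longleftrightarrow>
     (\<forall>c\<in>A. \<forall>x\<in>coord_image c. \<forall>l k i j. riemann g c l k i j x = 0)"

definition global_orthonormal_frame ::
  "('a, 'n::finite) chart set \<Rightarrow> ('a, 'n::finite) metric \<Rightarrow> ('n \<Rightarrow> ('a, 'n::finite) vector_field) \<Rightarrow> bool" where
  "global_orthonormal_frame A g X \<longleftrightarrow>
     (\<forall>c\<in>A. \<forall>x\<in>coord_image c.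
        (\<forall>i j. X i c x \<bullet> (g c x *v X j c x) = (if i = j then 1 else 0)) \<and>
        span (range (\<lambda>i. X i c x)) = UNIV)"


section \<open>Asymptotics in an exterior chart\<close>

text \<open>
  The exterior chart is a chart of the atlas whose image is the complement of the closed unit ball;
  no compactness of the complement of its domain is required.
\<close>

definition asymptotically_flat_chart ::
  "('a, 'n::finite) chart set \<Rightarrow> ('a, 'n::finite) metric \<Rightarrow> ('a, 'n::finite) chart \<Rightarrow> real \<Rightarrow> bool" where
  "asymptotically_flat_chart A g e \<beta> \<longleftrightarrow>
     e \<in> A \<and> coord_image e = - cball 0 1 \<and> 0 < \<beta> \<and>
     (\<forall>i j. O2 \<beta> (\<lambda>x. g e x $ i $ j - (if i = j then 1 else 0)))"

definition asymptotic_to_translation ::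
  "('a, 'n::finite) vector_field \<Rightarrow> ('a, 'n::finite) chart \<Rightarrow> real \<Rightarrow> 'n \<Rightarrow> bool" where
  "asymptotic_to_translation X e \<beta> i \<longleftrightarrow>
     (\<forall>k. O2 \<beta> (\<lambda>x. X e x $ k - axis i 1 $ k))"

end

theory Submission
  imports Defs "HOL-Real_Asymp.Real_Asymp"
begin

text \<open>
  A \<open>C\<^sup>1\<close> Killing field \<open>Y\<close> of a \<open>C\<^sup>2\<close> metric satisfies a first-order equation along every coordinate
  line: the derivative of \<open>g(Y, a)\<close> in the constant direction \<open>a\<close> is bounded by
  \<open>C |a|\<^sup>2 |\<Gamma>| |Y|\<close>. Since the lines through a point determine \<open>Y\<close> there, integrating this along
  segments gives unique continuation, and integrating it along rays shows that \<open>Y\<close> vanishes near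
  infinity if it tends to zero there; no second derivatives of \<open>Y\<close> are needed.

  The brackets \<open>[X\<^sub>i, X\<^sub>j]\<close> are merely continuous, but they still satisfy the line equation. They
  tend to zero at infinity, so they vanish on all of \<open>M\<close>. Hence the functions \<open>g(X\<^sub>i, X\<^sub>j)\<close> have
  derivative zero along every \<open>X\<^sub>k\<close> and keep their limits \<open>\<delta>\<^sub>i\<^sub>j\<close>. By Koszul's argument a
  commuting frame of Killing fields is parallel, and a metric with a parallel frame is flat.
\<close>

section \<open>Calculus on chart domains\<close>

text \<open>Along a constant direction \<open>a\<close> the derivative of \<open>g(Y, a)\<close> is
  \<open>g(\<nabla>\<^sub>a Y, a) + g(Y, \<Gamma>(a, a))\<close>, and Killing's equation removes the
  first term; hence straight segments can replace geodesics and only \<open>\<Gamma>\<close> enters.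
  For a bracket of C1 fields the formal computation involves their second derivatives. It survives
  on a single line because Killing's equation expresses the derivative of \<open>g(X, a)\<close> in
  direction \<open>a\<close> without derivatives of \<open>X\<close>, so that this function can be
  differentiated once more and the order of differentiation exchanged. At infinity
  \<open>\<Gamma>\<close> is of order \<open>norm x powr (- \<beta> - 1)\<close>; integration along
  a ray whose direction has length comparable to \<open>norm x\<close>, followed by division by that
  length, yields the small factor \<open>norm x powr (- \<beta>)\<close>. Boundary points are
  handled by using the equation only in the interior of compact convex pieces of a chart image, with
  continuity carrying the conclusion to the edge. Constancy of
  \<open>g(X\<^sub>i, X\<^sub>j)\<close> requires the fields to span, which away from the end is
  known only where orthonormality already is; both are propagated together.\<close>

abbreviation fderiv ::
  "'a::euclidean_space set \<Rightarrow> ('a \<Rightarrow> 'b::real_normed_vector) \<Rightarrow> 'a \<Rightarrow> 'a \<Rightarrow> 'b" where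
  "fderiv S f x \<equiv> frechet_derivative f (at x within S)"

text \<open>The shape that \<open>is_chart\<close> prescribes for a coordinate image. It passes to
  relatively open subsets, in particular to overlaps, and suffices for derivatives within the set to
  be unique.\<close>

definition chart_domain :: "(real^'n) set \<Rightarrow> bool" where
  "chart_domain S \<longleftrightarrow> open S \<or> (\<exists>k. openin (top_of_set {x. 0 \<le> x $ k}) S)"

lemma chart_domain_openin:
  assumes "chart_domain S" "openin (top_of_set S) T"
  shows "chart_domain T"
  using assms(1) unfolding chart_domain_def
proof (elim disjE exE)
  assume "open S"
  then show "open T \<or> (\<exists>k. openin (top_of_set {x. 0 \<le> x $ k}) T)"
    using assms(2) by (simp add: openin_open_eq)
next
  fix k assume "openin (top_of_set {x. 0 \<le> x $ k}) S"
  then show "open T \<or> (\<exists>k. openin (top_of_set {x. 0 \<le> x $ k}) T)"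
    using openin_trans[OF assms(2)] by blast
qed

lemma chart_domain_cases:
  assumes "chart_domain S"
  obtains "open S" | k V where "open V" "S = {x. 0 \<le> x $ k} \<inter> V"
  using assms unfolding chart_domain_def openin_open by blast

text \<open>A closed ball works in the open case, a closed ball cut by the half-space otherwise.
  Convexity keeps segments inside \<open>S\<close>, compactness provides uniform constants, and
  \<open>S \<inter> ball x r \<subseteq> K\<close> makes \<open>K\<close> a relative neighbourhood
  of \<open>x\<close>.\<close>

lemma chart_domain_nbhd:
  fixes S :: "(real^'n) set"
  assumes "chart_domain S" "x \<in> S" "0 < e"
  obtains K r where "compact K" "convex K" "K \<subseteq> S" "0 < r" "r \<le> e" "S \<inter> ball x r \<subseteq> K" "K \<subseteq> cball x e"
  using assms(1)
proof (cases rule: chart_domain_cases)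
  case 1
  then obtain d where d: "d > 0" "cball x d \<subseteq> S"
    using assms(2) open_contains_cball by blast
  show ?thesis
  proof (rule that[of "cball x (min d e)" "min d e"])
    show "cball x (min d e) \<subseteq> S"
      using d by (meson min.cobounded1 order_trans subset_cball)
  qed (use d \<open>0 < e\<close> in auto)
next
  case (2 k V)
  then obtain d where d: "d > 0" "cball x d \<subseteq> V"
    using assms(2) open_contains_cball by blast
  have H: "closed {x::real^'n. 0 \<le> x $ k}" "convex {x::real^'n. 0 \<le> x $ k}"
    by (auto intro!: closed_Collect_le continuous_intros convexI)
  show ?thesis
  proof (rule that[of "cball x (min d e) \<inter> {x. 0 \<le> x $ k}" "min d e"])
    show "compact (cball x (min d e) \<inter> {x. 0 \<le> x $ k})"
      using H by (intro compact_Int_closed) auto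
    show "convex (cball x (min d e) \<inter> {x. 0 \<le> x $ k})"
      using H by (intro convex_Int) auto
    show "cball x (min d e) \<inter> {x. 0 \<le> x $ k} \<subseteq> S"
      using d 2 by auto
  qed (use d \<open>0 < e\<close> 2 in auto)
qed

text \<open>This is the hypothesis under which derivatives within \<open>S\<close> are unique. A
  positive step along a basis vector lowers no coordinate, so it cannot leave the
  half-space.\<close>

lemma chart_domain_axis:
  fixes x :: "real^'n"
  assumes "chart_domain S" "x \<in> S" "i \<in> Basis" "0 < e"
  shows "\<exists>d. 0 < \<bar>d\<bar> \<and> \<bar>d\<bar> < e \<and> x + d *\<^sub>R i \<in> S"
proof -
  obtain V where V: "open V" "x \<in> V" and S: "S = V \<or> (\<exists>k. S = {x. 0 \<le> x $ k} \<inter> V)"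
    using assms(1,2) by (cases rule: chart_domain_cases) auto
  obtain r where r: "r > 0" "ball x r \<subseteq> V"
    using V openE by blast
  define d where "d = min r e / 2"
  have d: "0 < d" "d < e" "d < r"
    using r assms(4) by (auto simp: d_def)
  obtain l where l: "i = axis l 1"
    using assms(3) by (auto simp: Basis_vec_def)
  have "x + d *\<^sub>R i \<in> V"
    using r d assms(3) by (auto simp: dist_norm subset_iff)
  moreover have "0 \<le> (x + d *\<^sub>R i) $ k" if "0 \<le> x $ k" for k
    using that d by (simp add: l axis_def)
  ultimately have "x + d *\<^sub>R i \<in> S"
    using S assms(2) by auto
  with d show ?thesis
    by (intro exI[of _ d]) auto
qed

text \<open>A boundary point moves into the interior under a small step along the inward normal
  \<open>axis k 1\<close>.\<close>

lemma chart_domain_subset_closure_interior: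
  fixes S :: "(real^'n) set"
  assumes "chart_domain S"
  shows "S \<subseteq> closure (interior S)"
  using assms
proof (cases rule: chart_domain_cases)
  case 1
  then show ?thesis by (simp add: interior_open closure_subset)
next
  case (2 k V)
  have int: "{x. 0 < x $ k} \<inter> V \<subseteq> interior S"
    using 2 by (intro interior_maximal) (auto intro!: open_Int open_Collect_less continuous_intros)
  show ?thesis
  proof
    fix x assume x: "x \<in> S"
    show "x \<in> closure (interior S)"
      unfolding closure_approachable
    proof (intro allI impI)
      fix e :: real assume "e > 0"
      obtain r where r: "r > 0" "ball x r \<subseteq> V"
        using 2 x openE by blast
      define d where "d = min r e / 2"
      have d: "0 < d" "d < e" "d < r"
        using r \<open>e > 0\<close> by (auto simp: d_def)
      have "x + d *\<^sub>R axis k 1 \<in> V"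
        using r d by (auto simp: dist_norm subset_iff)
      moreover have "0 < (x + d *\<^sub>R axis k 1) $ k"
        using d x 2 by (auto simp: axis_def)
      ultimately have "x + d *\<^sub>R axis k 1 \<in> interior S"
        using int by blast
      moreover have "dist (x + d *\<^sub>R axis k 1) x < e"
        using d by (simp add: dist_norm)
      ultimately show "\<exists>y\<in>interior S. dist y x < e"
        by blast
    qed
  qed
qed

text \<open>Reduces identities between derivatives to interior points, where two-sided derivatives
  and the results for open sets are available.\<close>

lemma eq_on_chart_domain:
  fixes f h :: "real^'n \<Rightarrow> 'b::t2_space"
  assumes S: "chart_domain S" and "continuous_on S f" "continuous_on S h"
    and eq: "\<And>x. x \<in> interior S \<Longrightarrow> f x = h x" and "x \<in> S"
  shows "f x = h x"
proof -
  obtain u where u: "\<And>n. u n \<in> interior S" "u \<longlonglongrightarrow> x"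
    using subsetD[OF chart_domain_subset_closure_interior[OF S] \<open>x \<in> S\<close>]
    unfolding closure_sequential by blast
  have uS: "eventually (\<lambda>n. u n \<in> S) sequentially"
    using u(1) interior_subset by (intro always_eventually) blast
  have "(\<lambda>n. f (u n)) \<longlonglongrightarrow> f x" "(\<lambda>n. h (u n)) \<longlonglongrightarrow> h x"
    using continuous_on_tendsto_compose[OF _ u(2) \<open>x \<in> S\<close> uS] assms(2,3) by blast+
  then show ?thesis
    using eq[OF u(1)] LIMSEQ_unique by fastforce
qed

lemma fderiv_eqI:
  fixes f :: "real^'n \<Rightarrow> 'b::real_normed_vector"
  assumes "chart_domain S" "x \<in> S" "(f has_derivative f') (at x within S)"
  shows "fderiv S f x = f'"
proof (rule frechet_derivative_unique_within[OF _ assms(3)])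
  show "(f has_derivative fderiv S f x) (at x within S)"
    using assms(3) differentiableI frechet_derivative_works by blast
qed (rule chart_domain_axis[OF assms(1,2)])

lemma at_within_openin:
  assumes "openin (top_of_set S) T" "x \<in> T"
  shows "at x within T = at x within S"
proof -
  obtain V where "open V" "T = S \<inter> V"
    using assms(1) by (auto simp: openin_open)
  then show ?thesis
    using assms(2) at_within_nhd[of x V T S] by auto
qed

text \<open>Continuity of the derivative is required for each fixed direction \<open>v\<close>. By
  linearity in the finitely many axis directions this is continuity of the derivative as a map, and
  no space of operators has to be introduced.\<close>

definition C1_on :: "(real^'n) set \<Rightarrow> (real^'n \<Rightarrow> 'b::real_normed_vector) \<Rightarrow> bool" where
  "C1_on S f \<longleftrightarrow> (\<forall>x\<in>S. f differentiable (at x within S)) \<and> (\<forall>v. continuous_on S (\<lambda>x. fderiv S f x v))"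

lemma C1_onD:
  assumes "C1_on S f"
  shows "x \<in> S \<Longrightarrow> (f has_derivative fderiv S f x) (at x within S)"
    and "continuous_on S (\<lambda>x. fderiv S f x v)"
    and "x \<in> S \<Longrightarrow> linear (fderiv S f x)"
    and "continuous_on S f"
proof -
  show 1: "(f has_derivative fderiv S f x) (at x within S)" if "x \<in> S" for x
    by (rule iffD1[OF frechet_derivative_works]) (use assms that in \<open>simp add: C1_on_def\<close>)
  show "continuous_on S (\<lambda>x. fderiv S f x v)"
    using assms by (simp add: C1_on_def)
  show "linear (fderiv S f x)" if "x \<in> S"
    using 1[OF that] by (rule has_derivative_linear)
  show "continuous_on S f"
    by (rule has_derivative_continuous_on[OF 1])
qed

lemma C1_onI:
  assumes S: "chart_domain S"
    and d: "\<And>x. x \<in> S \<Longrightarrow> (f has_derivative f' x) (at x within S)"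
    and c: "\<And>v. continuous_on S (\<lambda>x. f' x v)"
  shows "C1_on S f"
proof -
  have "fderiv S f x = f' x" if "x \<in> S" for x
    using fderiv_eqI[OF S that d[OF that]] .
  then show ?thesis
    using c d unfolding C1_on_def by (auto simp: differentiable_def cong: continuous_on_cong)
qed

lemma linear_axis_expansion:
  fixes F :: "real^'n \<Rightarrow> 'b::real_vector"
  assumes "linear F"
  shows "F v = (\<Sum>i\<in>UNIV. v $ i *\<^sub>R F (axis i 1))"
proof -
  have "F (\<Sum>i\<in>UNIV. v $ i *\<^sub>R axis i 1) = (\<Sum>i\<in>UNIV. v $ i *\<^sub>R F (axis i 1))"
    using assms by (simp add: linear_sum linear_scale)
  then show ?thesis
    using basis_expansion[of v] by (simp add: scalar_mult_eq_scaleR)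
qed

lemma continuous_on_fderiv_apply:
  assumes "C1_on S f" "continuous_on S v"
  shows "continuous_on S (\<lambda>x. fderiv S f x (v x))"
proof -
  have "continuous_on S (\<lambda>x. \<Sum>i\<in>UNIV. v x $ i *\<^sub>R fderiv S f x (axis i 1))"
    by (rule continuous_on_sum, rule continuous_on_scaleR[OF continuous_on_component[OF assms(2)] C1_onD(2)[OF assms(1)]])
  then show ?thesis
    by (rule continuous_on_eq) (rule linear_axis_expansion[OF C1_onD(3)[OF assms(1)], symmetric])
qed

lemma Ck_on_1:
  assumes "Ck_on 1 S f"
  shows "C1_on S f"
proof -
  have d: "f differentiable (at x within S)" if "x \<in> S" for x
    using assms that by simp
  have "continuous_on S (\<lambda>x. \<Sum>i\<in>UNIV. v $ i *\<^sub>R fderiv S f x (axis i 1))" for v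
    using assms by (intro continuous_intros) (simp add: partial_def)
  then have "continuous_on S (\<lambda>x. fderiv S f x v)" for v
    by (rule continuous_on_eq)
       (rule linear_axis_expansion[OF linear_frechet_derivative[OF d], symmetric])
  with d show ?thesis
    by (simp add: C1_on_def)
qed

lemma C1_on_add:
  assumes "chart_domain S" "C1_on S f" "C1_on S h"
  shows "C1_on S (\<lambda>x. f x + h x)"
proof (rule C1_onI[OF assms(1), where f' = "\<lambda>x v. fderiv S f x v + fderiv S h x v"])
qed (auto intro!: derivative_eq_intros continuous_intros C1_onD(1,2,4)[OF assms(2)] C1_onD(1,2,4)[OF assms(3)])

lemma C1_on_diff:
  assumes "chart_domain S" "C1_on S f" "C1_on S h"
  shows "C1_on S (\<lambda>x. f x - h x)"
proof (rule C1_onI[OF assms(1), where f' = "\<lambda>x v. fderiv S f x v - fderiv S h x v"])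
qed (auto intro!: derivative_eq_intros continuous_intros C1_onD(1,2,4)[OF assms(2)] C1_onD(1,2,4)[OF assms(3)])

lemma C1_on_mult:
  fixes f h :: "real^'n \<Rightarrow> real"
  assumes "chart_domain S" "C1_on S f" "C1_on S h"
  shows "C1_on S (\<lambda>x. f x * h x)"
proof (rule C1_onI[OF assms(1), where f' = "\<lambda>x v. f x * fderiv S h x v + fderiv S f x v * h x"])
qed (auto intro!: derivative_eq_intros continuous_intros C1_onD(1,2,4)[OF assms(2)] C1_onD(1,2,4)[OF assms(3)] simp: mult.commute)

lemma C1_on_scaleR:
  assumes "chart_domain S" "C1_on S f"
  shows "C1_on S (\<lambda>x. c *\<^sub>R f x)"
proof (rule C1_onI[OF assms(1), where f' = "\<lambda>x v. c *\<^sub>R fderiv S f x v"])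
qed (auto intro!: derivative_eq_intros continuous_intros C1_onD(1,2,4)[OF assms(2)])

lemma C1_on_sum:
  assumes "chart_domain S" "\<And>i. i \<in> I \<Longrightarrow> C1_on S (f i)"
  shows "C1_on S (\<lambda>x. \<Sum>i\<in>I. f i x)"
proof (rule C1_onI[OF assms(1), where f' = "\<lambda>x v. \<Sum>i\<in>I. fderiv S (f i) x v"])
qed (auto intro!: derivative_eq_intros continuous_intros C1_onD(1,2,4)[OF assms(2)])

lemma C1_on_vec:
  assumes "chart_domain S" "\<And>k. C1_on S (\<lambda>x. f x $ k)"
  shows "C1_on S (f :: real^'n \<Rightarrow> ('b::euclidean_space)^'m)"
proof (rule C1_onI[OF assms(1)])
  show "(f has_derivative (\<lambda>v. \<chi> k. fderiv S (\<lambda>x. f x $ k) x v)) (at x within S)" if "x \<in> S" for x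
    using C1_onD(1)[OF assms(2) that]
    by (subst has_derivative_componentwise_within)
       (auto simp: Basis_vec_def inner_axis intro!: has_derivative_inner_left)
  show "continuous_on S (\<lambda>x. \<chi> k. fderiv S (\<lambda>x. f x $ k) x v)" for v
    by (intro continuous_intros C1_onD(2) assms(2))
qed

lemma fderiv_component:
  fixes f :: "real^'n \<Rightarrow> ('b::real_normed_vector)^'m"
  assumes "chart_domain S" "x \<in> S" "(f has_derivative f') (at x within S)"
  shows "fderiv S (\<lambda>y. f y $ k) x v = f' v $ k"
  by (rule fun_cong[OF fderiv_eqI[OF assms(1,2)]])
     (rule bounded_linear.has_derivative[OF bounded_linear_vec_nth assms(3)])

lemma C1_on_component:
  fixes f :: "real^'n \<Rightarrow> ('b::real_normed_vector)^'m"
  assumes "chart_domain S" "C1_on S f"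
  shows "C1_on S (\<lambda>x. f x $ k)"
  by (rule C1_onI[OF assms(1) bounded_linear.has_derivative[OF bounded_linear_vec_nth C1_onD(1)[OF assms(2)]]])
     (auto intro!: continuous_intros C1_onD(2)[OF assms(2)])

text \<open>\<open>frechet_derivative\<close> is a choice among all derivatives of a function, so
  the point is that \<open>f\<close> and \<open>h\<close> admit exactly the same derivatives within
  \<open>S\<close>.\<close>

lemma C1_on_cong:
  assumes "C1_on S f" "\<And>x. x \<in> S \<Longrightarrow> f x = h x"
  shows "C1_on S h"
proof -
  have *: "(h has_derivative f') (at x within S) \<longleftrightarrow> (f has_derivative f') (at x within S)" if "x \<in> S" for x f'
    using that assms(2) has_derivative_transform[of x S h f f'] has_derivative_transform[of x S f h f']
    by metis
  have "fderiv S h x = fderiv S f x" if "x \<in> S" for x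
    unfolding frechet_derivative_def using *[OF that] by simp
  then show ?thesis
    using assms(1) * unfolding C1_on_def differentiable_def
    by (auto cong: continuous_on_cong)
qed

text \<open>The Hessian at \<open>v\<close>, \<open>w\<close> is encoded as
  \<open>fderiv S (\<lambda>y. fderiv S f y v) x w\<close>, the derivative of a directional
  derivative with fixed direction.\<close>

definition C2_on :: "(real^'n) set \<Rightarrow> (real^'n \<Rightarrow> 'b::real_normed_vector) \<Rightarrow> bool" where
  "C2_on S f \<longleftrightarrow> C1_on S f \<and> (\<forall>v. C1_on S (\<lambda>x. fderiv S f x v))"

lemma C2_onD:
  assumes "C2_on S f"
  shows "C1_on S f" "C1_on S (\<lambda>x. fderiv S f x v)"
  using assms by (auto simp: C2_on_def)

lemma C2_onI_axis:
  fixes f :: "real^'n \<Rightarrow> 'b::real_normed_vector"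
  assumes S: "chart_domain S" and "C1_on S f" "\<And>i. C1_on S (\<lambda>x. fderiv S f x (axis i 1))"
  shows "C2_on S f"
  unfolding C2_on_def
proof (intro conjI allI)
  fix v :: "real^'n"
  have "C1_on S (\<lambda>x. \<Sum>i\<in>UNIV. v $ i *\<^sub>R fderiv S f x (axis i 1))"
    by (intro C1_on_sum C1_on_scaleR S assms)
  then show "C1_on S (\<lambda>x. fderiv S f x v)"
    by (rule C1_on_cong) (rule linear_axis_expansion[OF C1_onD(3)[OF assms(2)], symmetric])
qed (rule assms)

lemma Ck_on_2:
  assumes S: "chart_domain S" and "Ck_on (Suc (Suc m)) S f"
  shows "C2_on S f"
proof (rule C2_onI_axis[OF S])
  have le: "Ck_on (Suc m) S f \<Longrightarrow> Ck_on m S f" for m f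
  proof (induction m arbitrary: f)
    case 0
    then show ?case
      by (auto intro: differentiable_imp_continuous_on simp: differentiable_on_def)
  qed auto
  have mono: "Ck_on (Suc m) S f \<Longrightarrow> Ck_on 1 S f" for m f
    by (induction m) (simp_all add: le del: Ck_on.simps)
  show "C1_on S f"
    by (rule Ck_on_1, rule mono) (rule assms(2))
  show "C1_on S (\<lambda>x. fderiv S f x (axis i 1))" for i
    using Ck_on_1[OF mono, of m "partial S i f"] assms(2) by (simp add: partial_def[abs_def])
qed

lemma C2_on_vec:
  fixes f :: "real^'n \<Rightarrow> ('b::euclidean_space)^'m"
  assumes S: "chart_domain S" and f: "\<And>k. C2_on S (\<lambda>x. f x $ k)"
  shows "C2_on S f"
proof -
  have 1: "C1_on S f"
    by (intro C1_on_vec S C2_onD(1) f)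
  moreover have "C1_on S (\<lambda>x. fderiv S f x v)" for v
  proof (rule C1_on_vec[OF S])
    show "C1_on S (\<lambda>x. fderiv S f x v $ k)" for k
      using C2_onD(2)[OF f] by (rule C1_on_cong) (rule fderiv_component[OF S _ C1_onD(1)[OF 1]])
  qed
  ultimately show ?thesis
    by (simp add: C2_on_def)
qed

section \<open>One-forms with controlled derivatives along lines\<close>

lemma norm_axis: "norm (axis i c :: real^'n) = \<bar>c\<bar>"
proof -
  have "(axis i c :: real^'n) = c *\<^sub>R axis i 1"
    by (simp add: vec_eq_iff axis_def)
  then show ?thesis
    by simp
qed

lemma bounded_bilinear_matrix_vector_mult:
  "bounded_bilinear ((*v) :: real^'n^'m \<Rightarrow> real^'n \<Rightarrow> real^'m)"
proof -
  have "bilinear ((*v) :: real^'n^'m \<Rightarrow> real^'n \<Rightarrow> real^'m)"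
    unfolding bilinear_def
    by (auto intro!: linearI simp: matrix_vector_mult_add_rdistrib matrix_vector_right_distrib
        matrix_vector_mult_scaleR scaleR_matrix_vector_assoc)
  then show ?thesis
    by (simp add: bilinear_conv_bounded_bilinear)
qed

lemmas has_derivative_matrix_vector_mult [derivative_intros] =
  bounded_bilinear.FDERIV [OF bounded_bilinear_matrix_vector_mult]

lemmas continuous_on_matrix_vector_mult =
  bounded_bilinear.continuous_on [OF bounded_bilinear_matrix_vector_mult]

text \<open>
  Only \<open>h\<close> is assumed to be differentiable, not \<open>f'\<close>: this is what makes brackets of \<open>C\<^sup>1\<close> Killing
  fields accessible.
\<close>

lemma mixed_directional_derivative:
  fixes f :: "'a::real_normed_vector \<Rightarrow> real"
  assumes "open U" "x \<in> U"
    and f: "\<And>y. y \<in> U \<Longrightarrow> (f has_derivative f' y) (at y)"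
    and h: "\<And>y. y \<in> U \<Longrightarrow> ((\<lambda>z. f' z a) has_derivative h' y) (at y)"
    and cont: "continuous_on U (\<lambda>y. h' y w)"
  shows "((\<lambda>t. f' (x + t *\<^sub>R a) w) has_real_derivative h' x w) (at 0)"
proof -
  let ?c = "h' x w"
  have *: "\<exists>d>0. \<forall>t. \<bar>t\<bar> < d \<longrightarrow> \<bar>f' (x + t *\<^sub>R a) w - f' x w - t * ?c\<bar> \<le> e * \<bar>t\<bar>"
    if "e > 0" for e
  proof -
    have "isCont (\<lambda>y. h' y w) x"
      using cont assms(1,2) continuous_on_eq_continuous_at by blast
    then obtain d0 where d0: "d0 > 0" "\<And>y. dist y x < d0 \<Longrightarrow> \<bar>h' y w - ?c\<bar> < e"
      using \<open>e > 0\<close> unfolding continuous_at_eps_delta dist_real_def by (metis dist_commute)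
    obtain d1 where d1: "d1 > 0" "ball x d1 \<subseteq> U"
      using assms(1,2) openE by blast
    define r where "r = min d0 d1"
    have r: "r > 0" "\<And>y. dist y x < r \<Longrightarrow> y \<in> U \<and> \<bar>h' y w - ?c\<bar> \<le> e"
      using d0 d1 by (auto simp: r_def dist_commute less_imp_le subset_iff)
    \<comment> \<open>Keeps the whole parallelogram of points
      \<open>x + \<tau> *\<^sub>R a + \<sigma> *\<^sub>R w\<close>, with both parameters below
      \<open>d\<close> in absolute value, within \<open>r / 2\<close> of \<open>x\<close>. The
      summand 1 excludes a zero denominator.\<close>
    define d where "d = r / (2 * (norm a + norm w + 1))"
    have nz: "norm a + norm w + 1 > 0"
      by (smt (verit) norm_ge_zero)
    have d: "d > 0"
      using r nz by (simp add: d_def)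
    have near: "dist (x + \<tau> *\<^sub>R a + \<sigma> *\<^sub>R w) x < r" if "\<bar>\<tau>\<bar> < d" "\<bar>\<sigma>\<bar> < d" for \<tau> \<sigma>
    proof -
      have "dist (x + \<tau> *\<^sub>R a + \<sigma> *\<^sub>R w) x = norm (\<tau> *\<^sub>R a + \<sigma> *\<^sub>R w)"
        by (simp add: dist_norm add.assoc)
      also have "\<dots> \<le> norm (\<tau> *\<^sub>R a) + norm (\<sigma> *\<^sub>R w)"
        by (rule norm_triangle_ineq)
      also have "\<dots> \<le> d * norm a + d * norm w"
        using that by (auto intro!: add_mono mult_right_mono)
      also have "\<dots> \<le> d * (norm a + norm w + 1)"
        using d by (simp add: algebra_simps)
      also have "\<dots> = r / 2"
        using nz by (simp add: d_def field_simps)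
      also have "\<dots> < r"
        using r by simp
      finally show ?thesis .
    qed
    have "\<bar>f' (x + t *\<^sub>R a) w - f' x w - t * ?c\<bar> \<le> e * \<bar>t\<bar>" if t: "\<bar>t\<bar> < d" for t
    proof -
      \<comment> \<open>\<open>\<Phi> s t - \<Phi> s 0\<close> is the mixed second difference. The
        mean value bound is applied to it in \<open>\<tau>\<close>, and in \<open>h_diff\<close> to
        the resulting derivative in direction \<open>a\<close>; thus only \<open>f\<close> and
        \<open>\<lambda>z. f' z a\<close> are ever differentiated.\<close>
      define \<Phi> where "\<Phi> s \<tau> = f (x + \<tau> *\<^sub>R a + s *\<^sub>R w) - f (x + \<tau> *\<^sub>R a)" for s \<tau>
      have h_diff: "\<bar>f' (x + \<tau> *\<^sub>R a + s *\<^sub>R w) a - f' (x + \<tau> *\<^sub>R a) a - s * ?c\<bar> \<le> e * \<bar>s\<bar>"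
        if "\<bar>\<tau>\<bar> < d" "\<bar>s\<bar> < d" for \<tau> s
      proof -
        have "norm ((\<lambda>\<sigma>. f' (x + \<tau> *\<^sub>R a + \<sigma> *\<^sub>R w) a - \<sigma> * ?c) s
              - (\<lambda>\<sigma>. f' (x + \<tau> *\<^sub>R a + \<sigma> *\<^sub>R w) a - \<sigma> * ?c) 0) \<le> e * norm (s - 0)"
        proof (rule field_differentiable_bound[where S = "{-d<..<d}"])
          fix z assume z: "z \<in> {-d<..<d}"
          then have U: "x + \<tau> *\<^sub>R a + z *\<^sub>R w \<in> U" and e: "\<bar>h' (x + \<tau> *\<^sub>R a + z *\<^sub>R w) w - ?c\<bar> \<le> e"
            using r near[of \<tau> z] that by auto
          have "((\<lambda>\<sigma>. f' (x + \<tau> *\<^sub>R a + \<sigma> *\<^sub>R w) a) has_derivative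
                 (\<lambda>s. h' (x + \<tau> *\<^sub>R a + z *\<^sub>R w) (s *\<^sub>R w))) (at z)"
            by (rule has_derivative_compose[where f="\<lambda>\<sigma>. x + \<tau> *\<^sub>R a + \<sigma> *\<^sub>R w", OF _ h[OF U]])
               (auto intro!: derivative_eq_intros)
          moreover have "h' (x + \<tau> *\<^sub>R a + z *\<^sub>R w) (s *\<^sub>R w) = h' (x + \<tau> *\<^sub>R a + z *\<^sub>R w) w * s" for s
            using has_derivative_linear[OF h[OF U]] by (simp add: linear_scale)
          ultimately have "((\<lambda>\<sigma>. f' (x + \<tau> *\<^sub>R a + \<sigma> *\<^sub>R w) a) has_real_derivative
                 h' (x + \<tau> *\<^sub>R a + z *\<^sub>R w) w) (at z)"
            by (simp add: has_field_derivative_def)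
          then show "((\<lambda>\<sigma>. f' (x + \<tau> *\<^sub>R a + \<sigma> *\<^sub>R w) a - \<sigma> * ?c) has_real_derivative
              h' (x + \<tau> *\<^sub>R a + z *\<^sub>R w) w - ?c) (at z within {-d<..<d})"
            by (auto intro!: derivative_eq_intros intro: has_field_derivative_at_within)
          show "norm (h' (x + \<tau> *\<^sub>R a + z *\<^sub>R w) w - ?c) \<le> e"
            using e by simp
        qed (use that d in auto)
        then show ?thesis
          by simp
      qed
      have \<Phi>_diff: "\<bar>\<Phi> s t - \<Phi> s 0 - t * (s * ?c)\<bar> \<le> (e * \<bar>s\<bar>) * \<bar>t\<bar>" if "\<bar>s\<bar> < d" for s
      proof -
        have "norm ((\<lambda>\<tau>. \<Phi> s \<tau> - \<tau> * (s * ?c)) t - (\<lambda>\<tau>. \<Phi> s \<tau> - \<tau> * (s * ?c)) 0) \<le> (e * \<bar>s\<bar>) * norm (t - 0)"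
        proof (rule field_differentiable_bound[where S = "{-d<..<d}"])
          fix z assume z: "z \<in> {-d<..<d}"
          then have U: "x + z *\<^sub>R a + s *\<^sub>R w \<in> U" "x + z *\<^sub>R a \<in> U"
            using r near[of z s] near[of z 0] that d by auto
          have l: "(g has_derivative g') (at y) \<Longrightarrow> g' (s *\<^sub>R a) = g' a * s" for g g' y s
            by (drule has_derivative_linear) (simp add: linear_scale)
          have 1: "((\<lambda>\<tau>. f (x + \<tau> *\<^sub>R a + s *\<^sub>R w)) has_derivative
                 (\<lambda>\<sigma>. f' (x + z *\<^sub>R a + s *\<^sub>R w) (\<sigma> *\<^sub>R a))) (at z)"
            by (rule has_derivative_compose[where f="\<lambda>\<tau>. x + \<tau> *\<^sub>R a + s *\<^sub>R w", OF _ f[OF U(1)]])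
               (auto intro!: derivative_eq_intros)
          have 2: "((\<lambda>\<tau>. f (x + \<tau> *\<^sub>R a)) has_derivative
                 (\<lambda>\<sigma>. f' (x + z *\<^sub>R a) (\<sigma> *\<^sub>R a))) (at z)"
            by (rule has_derivative_compose[where f="\<lambda>\<tau>. x + \<tau> *\<^sub>R a", OF _ f[OF U(2)]])
               (auto intro!: derivative_eq_intros)
          have "((\<lambda>\<tau>. f (x + \<tau> *\<^sub>R a + s *\<^sub>R w)) has_real_derivative f' (x + z *\<^sub>R a + s *\<^sub>R w) a) (at z)"
            "((\<lambda>\<tau>. f (x + \<tau> *\<^sub>R a)) has_real_derivative f' (x + z *\<^sub>R a) a) (at z)"
            using 1 2 l[OF f[OF U(1)]] l[OF f[OF U(2)]] by (simp_all add: has_field_derivative_def)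
          then show "((\<lambda>\<tau>. \<Phi> s \<tau> - \<tau> * (s * ?c)) has_real_derivative
              f' (x + z *\<^sub>R a + s *\<^sub>R w) a - f' (x + z *\<^sub>R a) a - s * ?c) (at z within {-d<..<d})"
            unfolding \<Phi>_def
            by (auto intro!: derivative_eq_intros intro: has_field_derivative_at_within)
          show "norm (f' (x + z *\<^sub>R a + s *\<^sub>R w) a - f' (x + z *\<^sub>R a) a - s * ?c) \<le> e * \<bar>s\<bar>"
            using h_diff[of z s] z that by (auto simp: abs_less_iff)
        qed (use t d in auto)
        then show ?thesis
          by (simp add: algebra_simps)
      qed
      \<comment> \<open>Dividing the second difference by \<open>s\<close> and letting
        \<open>s\<close> tend to 0 turns it into a difference of values of \<open>f'\<close> at
        \<open>w\<close>; the bound by \<open>e\<close> times the size of \<open>t\<close> is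
        uniform in \<open>s\<close> and survives the limit.\<close>
      have lim: "((\<lambda>s. (f (y + s *\<^sub>R w) - f y) / s) \<longlongrightarrow> f' y w) (at 0)" if "y \<in> U" for y
      proof -
        have f0: "(f has_derivative f' y) (at (y + 0 *\<^sub>R w))"
          using f[OF that] by simp
        have "((\<lambda>s. f (y + s *\<^sub>R w)) has_derivative (\<lambda>s. f' y (s *\<^sub>R w))) (at 0)"
          by (rule has_derivative_compose[where f="\<lambda>s. y + s *\<^sub>R w", OF _ f0])
             (auto intro!: derivative_eq_intros)
        moreover have "f' y (s *\<^sub>R w) = f' y w * s" for s
          using has_derivative_linear[OF f[OF that]] by (simp add: linear_scale)
        ultimately have "((\<lambda>s. f (y + s *\<^sub>R w)) has_real_derivative f' y w) (at 0)"
          by (simp add: has_field_derivative_def)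
        then show ?thesis
          by (simp add: has_field_derivative_iff)
      qed
      have "x + t *\<^sub>R a \<in> U" "x \<in> U"
        using r near[of t 0] t d assms(2) by auto
      then have "((\<lambda>s. (f (x + t *\<^sub>R a + s *\<^sub>R w) - f (x + t *\<^sub>R a)) / s - (f (x + s *\<^sub>R w) - f x) / s - t * ?c)
          \<longlongrightarrow> f' (x + t *\<^sub>R a) w - f' x w - t * ?c) (at 0)"
        by (intro tendsto_intros lim)
      then have "((\<lambda>s. \<bar>(f (x + t *\<^sub>R a + s *\<^sub>R w) - f (x + t *\<^sub>R a)) / s - (f (x + s *\<^sub>R w) - f x) / s - t * ?c\<bar>)
          \<longlongrightarrow> \<bar>f' (x + t *\<^sub>R a) w - f' x w - t * ?c\<bar>) (at 0)"
        by (rule tendsto_rabs)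
      moreover have "\<forall>\<^sub>F s in at 0. \<bar>(f (x + t *\<^sub>R a + s *\<^sub>R w) - f (x + t *\<^sub>R a)) / s - (f (x + s *\<^sub>R w) - f x) / s - t * ?c\<bar> \<le> e * \<bar>t\<bar>"
        unfolding eventually_at
      proof (intro exI[of _ d] conjI ballI impI d)
        fix s :: real assume s: "s \<noteq> 0 \<and> dist s 0 < d"
        then have "\<bar>\<Phi> s t - \<Phi> s 0 - t * (s * ?c)\<bar> \<le> (e * \<bar>t\<bar>) * \<bar>s\<bar>"
          using \<Phi>_diff[of s] by (simp add: mult_ac)
        moreover have "(f (x + t *\<^sub>R a + s *\<^sub>R w) - f (x + t *\<^sub>R a)) / s - (f (x + s *\<^sub>R w) - f x) / s - t * ?c
            = (\<Phi> s t - \<Phi> s 0 - t * (s * ?c)) / s"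
          using s by (simp add: \<Phi>_def field_simps)
        ultimately show "\<bar>(f (x + t *\<^sub>R a + s *\<^sub>R w) - f (x + t *\<^sub>R a)) / s - (f (x + s *\<^sub>R w) - f x) / s - t * ?c\<bar> \<le> e * \<bar>t\<bar>"
          using s by (simp add: abs_divide divide_le_eq)
      qed
      ultimately show ?thesis
        by (rule tendsto_upperbound) simp
    qed
    with d show ?thesis
      by blast
  qed
  show ?thesis
    unfolding has_field_derivative_def has_derivative_at_alt
  proof (intro conjI allI impI)
    show "bounded_linear ((*) ?c)"
      by (rule bounded_linear_mult_right)
    fix e :: real assume "e > 0"
    from *[OF this] show "\<exists>d>0. \<forall>y. norm (y - 0) < d \<longrightarrow>
        norm (f' (x + y *\<^sub>R a) w - f' (x + 0 *\<^sub>R a) w - ?c * (y - 0)) \<le> e * norm (y - 0)"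
      by (simp add: mult.commute)
  qed
qed

text \<open>
  A one-form \<open>y\<close> need only be differentiated along a line in the direction of that line. The
  weight \<open>exp (- \<kappa> |x - q|)\<close> turns the integral over the segment from \<open>x\<close> to \<open>q + v\<close>
  into a contraction once \<open>\<kappa>\<close> is large.
\<close>

lemma line_equation_unique_continuation:
  fixes y :: "real^'n \<Rightarrow> real^'n"
  assumes K: "compact K" "convex K"
    and y: "continuous_on K y"
    and line: "\<And>x a. x \<in> interior K \<Longrightarrow> \<exists>D. ((\<lambda>t. y (x + t *\<^sub>R a) \<bullet> a) has_real_derivative D) (at 0)
                 \<and> \<bar>D\<bar> \<le> C * (norm a)\<^sup>2 * norm (y x)"
    and q: "0 < \<rho>" "cball q \<rho> \<subseteq> K" "\<And>x. x \<in> cball q \<rho> \<Longrightarrow> y x = 0"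
    and "x \<in> K"
  shows "y x = 0"
proof -
  define C0 where "C0 = max C 0"
  obtain B where B: "B > 0" "\<And>x z. x \<in> K \<Longrightarrow> z \<in> K \<Longrightarrow> norm (z - x) \<le> B"
  proof -
    have "bounded K" using K compact_imp_bounded by blast
    then obtain b where "\<forall>x\<in>K. norm x \<le> b" by (auto simp: bounded_iff)
    then have "norm (z - x) \<le> 2 * \<bar>b\<bar> + 1" if "x \<in> K" "z \<in> K" for x z
      using norm_triangle_ineq4[of z x] that by (smt (verit))
    then show ?thesis using that[of "2 * \<bar>b\<bar> + 1"] by auto
  qed
  \<comment> \<open>Chosen so that the factor \<open>8 * C0 * B\<^sup>2 * real CARD('n) /
    \<rho>\<^sup>2 / \<kappa>\<close> arising in \<open>half\<close> is at most
    \<open>1 / 2\<close>; the summand 1 keeps \<open>\<kappa>\<close> positive when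
    \<open>C0 = 0\<close>.\<close>
  define \<kappa> where "\<kappa> = 16 * (C0 * B\<^sup>2 + 1) * real CARD('n) / \<rho>\<^sup>2"
  have \<kappa>: "\<kappa> > 0"
    using q by (auto simp: \<kappa>_def C0_def intro!: mult_pos_pos divide_pos_pos add_nonneg_pos)
  define W where "W x = exp (- \<kappa> * norm (x - q)) * norm (y x)" for x
  have "continuous_on K W"
    unfolding W_def by (intro continuous_intros y)
  moreover have "K \<noteq> {}" using \<open>x \<in> K\<close> by auto
  ultimately obtain m where m: "m \<in> K" "\<And>x. x \<in> K \<Longrightarrow> W x \<le> W m"
    using continuous_attains_sup[OF K(1)] by metis
  define N where "N = W m"
  have N0: "N \<ge> 0" by (simp add: N_def W_def)
  have yN: "norm (y x) \<le> N * exp (\<kappa> * norm (x - q))" if "x \<in> K" for x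
  proof -
    have "W x \<le> N" using m that by (simp add: N_def)
    then have "exp (- \<kappa> * norm (x - q)) * norm (y x) * exp (\<kappa> * norm (x - q)) \<le> N * exp (\<kappa> * norm (x - q))"
      unfolding W_def by (intro mult_right_mono) auto
    then show ?thesis by (simp add: exp_minus field_simps)
  qed
  \<comment> \<open>\<open>y\<close> vanishes at the far end \<open>q + v\<close>, so the line
    equation integrated over the segment bounds \<open>y x \<bullet> (q + v - x)\<close>. The point
    \<open>x\<close> is interior so that the whole segment lies in the interior of
    \<open>K\<close>.\<close>
  have seg: "\<bar>y x \<bullet> (q + v - x)\<bar> \<le> C0 * B\<^sup>2 * N * exp (\<kappa> * norm (x - q)) * (2 / (\<kappa> * \<rho>))"
    if x: "x \<in> interior K" and v: "norm v \<le> \<rho> / 2" and out: "norm (x - q) \<ge> \<rho>" for x v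
  proof -
    define a where "a = q + v - x"
    define P where "P t = x + t *\<^sub>R a" for t
    have q2: "q + v \<in> interior K"
    proof -
      have "q + v \<in> ball q \<rho>" using v q by (simp add: dist_norm)
      also have "\<dots> \<subseteq> interior K"
        using q(2) ball_subset_cball by (intro interior_maximal) auto
      finally show ?thesis .
    qed
    have PK: "P t \<in> interior K" if "t \<in> {0..1}" for t
    proof -
      have "(1 - t) *\<^sub>R x + t *\<^sub>R (q + v) \<in> interior K"
        using that convex_interior[OF K(2)] x q2 by (intro convexD_alt) auto
      then show ?thesis by (simp add: P_def a_def algebra_simps)
    qed
    have aB: "norm a \<le> B"
      using B(2)[of x "q + v"] x q2 interior_subset[of K] by (auto simp: a_def)
    have "\<forall>t\<in>{0..1}. \<exists>D. ((\<lambda>t. y (P t) \<bullet> a) has_real_derivative D) (at t) \<and> \<bar>D\<bar> \<le> C * (norm a)\<^sup>2 * norm (y (P t))"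
    proof
      fix t :: real assume "t \<in> {0..1}"
      from line[OF PK[OF this], of a] obtain D where
        D: "((\<lambda>s. y (P t + s *\<^sub>R a) \<bullet> a) has_real_derivative D) (at 0)" "\<bar>D\<bar> \<le> C * (norm a)\<^sup>2 * norm (y (P t))"
        by blast
      have "((\<lambda>s. y (P (t + s)) \<bullet> a) has_real_derivative D) (at 0)"
        using D(1) by (simp add: P_def algebra_simps)
      then have "((\<lambda>s. y (P s) \<bullet> a) has_real_derivative D) (at t)"
        using DERIV_at_within_shift[of "\<lambda>s. y (P s) \<bullet> a" D t 0 UNIV] by (simp add: add.commute)
      with D(2) show "\<exists>D. ((\<lambda>t. y (P t) \<bullet> a) has_real_derivative D) (at t) \<and> \<bar>D\<bar> \<le> C * (norm a)\<^sup>2 * norm (y (P t))"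
        by blast
    qed
    then obtain D where D: "\<And>t. t \<in> {0..1} \<Longrightarrow> ((\<lambda>t. y (P t) \<bullet> a) has_real_derivative D t) (at t)"
      "\<And>t. t \<in> {0..1} \<Longrightarrow> \<bar>D t\<bar> \<le> C * (norm a)\<^sup>2 * norm (y (P t))"
      by metis
    define E where "E = C0 * B\<^sup>2 * N * exp (\<kappa> * norm (x - q))"
    have E0: "E \<ge> 0" using N0 by (simp add: E_def C0_def)
    \<comment> \<open>An antiderivative of the bound in \<open>D_le\<close>. Since
      \<open>\<psi> 1 \<le> 0\<close>, the total change over the segment is at most
      \<open>- \<psi> 0\<close>, which contains the gain \<open>1 / \<kappa>\<close>.\<close>
    define \<psi> where "\<psi> t = - E * (2 / (\<kappa> * \<rho>)) * exp (- (\<kappa> * \<rho> / 2) * t)" for t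
    have D_le: "\<bar>D t\<bar> \<le> E * exp (- (\<kappa> * \<rho> / 2) * t)" if t: "t \<in> {0..1}" for t
    proof -
      have "P t - q = (1 - t) *\<^sub>R (x - q) + t *\<^sub>R v"
        by (simp add: P_def a_def algebra_simps)
      then have "norm (P t - q) \<le> norm ((1 - t) *\<^sub>R (x - q)) + norm (t *\<^sub>R v)"
        by (metis norm_triangle_ineq)
      also have "\<dots> \<le> (1 - t) * norm (x - q) + t * (\<rho> / 2)"
        using t mult_left_mono[OF v, of t] by simp
      \<comment> \<open>Here \<open>norm (x - q) \<ge> \<rho>\<close> enters: at parameter
        \<open>t\<close> the distance to \<open>q\<close> has dropped by at least
        \<open>\<rho> / 2 * t\<close>, which the weight turns into exponential decay.\<close>
      also have "\<dots> \<le> norm (x - q) - \<rho> / 2 * t"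
        using mult_left_mono[OF out, of t] t by (simp add: algebra_simps)
      finally have "\<kappa> * norm (P t - q) \<le> \<kappa> * (norm (x - q) - \<rho> / 2 * t)"
        using \<kappa> by (intro mult_left_mono) auto
      also have "\<dots> = \<kappa> * norm (x - q) + (- (\<kappa> * \<rho> / 2) * t)"
        by (simp add: algebra_simps)
      finally have "exp (\<kappa> * norm (P t - q)) \<le> exp (\<kappa> * norm (x - q)) * exp (- (\<kappa> * \<rho> / 2) * t)"
        unfolding exp_add [symmetric] by simp
      then have "N * exp (\<kappa> * norm (P t - q)) \<le> N * (exp (\<kappa> * norm (x - q)) * exp (- (\<kappa> * \<rho> / 2) * t))"
        using N0 mult_left_mono by blast
      with yN[of "P t"] PK[OF t] interior_subset[of K]
      have yP: "norm (y (P t)) \<le> N * exp (\<kappa> * norm (x - q)) * exp (- (\<kappa> * \<rho> / 2) * t)"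
        by (auto simp: mult.assoc)
      have "\<bar>D t\<bar> \<le> C * (norm a)\<^sup>2 * norm (y (P t))" by (rule D(2)[OF t])
      also have "\<dots> \<le> C0 * B\<^sup>2 * norm (y (P t))"
        using aB by (intro mult_right_mono mult_mono power_mono) (auto simp: C0_def)
      also have "\<dots> \<le> C0 * B\<^sup>2 * (N * exp (\<kappa> * norm (x - q)) * exp (- (\<kappa> * \<rho> / 2) * t))"
        by (intro mult_left_mono yP) (auto simp: C0_def)
      finally show ?thesis by (simp add: E_def mult.assoc)
    qed
    have "norm ((\<lambda>t. y (P t) \<bullet> a) 1 - (\<lambda>t. y (P t) \<bullet> a) 0) \<le> \<psi> 1 - \<psi> 0"
    proof (rule differentiable_bound_general)
      show "continuous_on {0..1} (\<lambda>t. y (P t) \<bullet> a)"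
        by (rule DERIV_continuous_on) (use D(1) has_field_derivative_at_within in blast)
      show "continuous_on {0..1} \<psi>"
        unfolding \<psi>_def by (intro continuous_intros)
      fix t :: real assume t: "0 < t" "t < 1"
      show "((\<lambda>t. y (P t) \<bullet> a) has_vector_derivative D t) (at t)"
        using D(1)[of t] t by (simp add: has_real_derivative_iff_has_vector_derivative)
      have "(\<psi> has_real_derivative E * exp (- (\<kappa> * \<rho> / 2) * t)) (at t)"
        unfolding \<psi>_def using \<kappa> q by (auto intro!: derivative_eq_intros simp: field_simps)
      then show "(\<psi> has_vector_derivative E * exp (- (\<kappa> * \<rho> / 2) * t)) (at t)"
        by (simp add: has_real_derivative_iff_has_vector_derivative)
      show "norm (D t) \<le> E * exp (- (\<kappa> * \<rho> / 2) * t)"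
        using D_le[of t] t by simp
    qed simp
    moreover have "y (P 1) = 0"
      using q v by (simp add: P_def a_def dist_norm)
    moreover have "\<psi> 1 \<le> 0"
      using E0 \<kappa> q by (simp add: \<psi>_def mult_nonneg_nonneg)
    ultimately have "\<bar>y x \<bullet> a\<bar> \<le> - \<psi> 0"
      by (simp add: P_def)
    then show ?thesis
      by (simp add: \<psi>_def E_def a_def)
  qed
  have half: "norm (y x) \<le> N / 2 * exp (\<kappa> * norm (x - q))" if x: "x \<in> interior K" for x
  proof (cases "norm (x - q) \<ge> \<rho>")
    case False
    then have "y x = 0" using q by (simp add: dist_norm norm_minus_commute)
    then show ?thesis using N0 by simp
  next
    case True
    let ?E = "C0 * B\<^sup>2 * N * exp (\<kappa> * norm (x - q)) * (2 / (\<kappa> * \<rho>))"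
    \<comment> \<open>The endpoints \<open>q + axis i (\<rho> / 2)\<close> and \<open>q\<close> both
      lie in the ball where \<open>y\<close> vanishes; the difference of the two estimates isolates
      one component of \<open>y x\<close>.\<close>
    have comp: "\<bar>y x $ i\<bar> \<le> 4 / \<rho> * ?E" for i
    proof -
      have "y x \<bullet> (q + axis i (\<rho> / 2) - x) - y x \<bullet> (q + 0 - x) = \<rho> / 2 * y x $ i"
        by (simp add: inner_axis algebra_simps)
      moreover have "\<bar>y x \<bullet> (q + axis i (\<rho> / 2) - x)\<bar> \<le> ?E" "\<bar>y x \<bullet> (q + 0 - x)\<bar> \<le> ?E"
        using seg[OF x _ True, of "axis i (\<rho> / 2)"] seg[OF x _ True, of 0] q by (auto simp: norm_axis)
      ultimately have "\<bar>\<rho> / 2 * y x $ i\<bar> \<le> 2 * ?E" by linarith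
      then have "\<rho> / 2 * \<bar>y x $ i\<bar> \<le> 2 * ?E"
        using q by (simp add: abs_mult)
      moreover have "b \<le> 4 / \<rho> * c" if "\<rho> / 2 * b \<le> 2 * c" for b c :: real
        using that q by (simp add: field_simps)
      ultimately show ?thesis by blast
    qed
    have "norm (y x) \<le> (\<Sum>i\<in>UNIV. \<bar>y x $ i\<bar>)"
      by (rule norm_le_l1_cart)
    also have "\<dots> \<le> of_nat CARD('n) * (4 / \<rho> * ?E)"
      using comp by (intro sum_bounded_above) auto
    also have "\<dots> = (8 * C0 * B\<^sup>2 * real CARD('n) / \<rho>\<^sup>2 / \<kappa>) * (N * exp (\<kappa> * norm (x - q)))"
      by (simp add: power2_eq_square field_simps)
    also have "\<dots> \<le> (1 / 2) * (N * exp (\<kappa> * norm (x - q)))"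
    proof (intro mult_right_mono)
      have "8 * C0 * B\<^sup>2 * real CARD('n) / \<rho>\<^sup>2 \<le> 1 / 2 * \<kappa>"
        unfolding \<kappa>_def using q by (simp add: field_simps)
      then show "8 * C0 * B\<^sup>2 * real CARD('n) / \<rho>\<^sup>2 / \<kappa> \<le> 1 / 2"
        using \<kappa> pos_divide_le_eq by blast
    qed (use N0 in auto)
    finally show ?thesis by simp
  qed
  have half_W: "W x \<le> N / 2" if "x \<in> interior K" for x
  proof -
    have "exp (- \<kappa> * norm (x - q)) * norm (y x) \<le> exp (- \<kappa> * norm (x - q)) * (N / 2 * exp (\<kappa> * norm (x - q)))"
      using half[OF that] by (intro mult_left_mono) auto
    also have "\<dots> = N / 2" by (simp add: exp_minus)
    finally show ?thesis by (simp add: W_def)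
  qed
  have int: "interior K \<noteq> {}"
    using q by (metis ball_subset_cball centre_in_ball empty_iff interior_maximal open_ball subset_trans subsetD)
  have cl: "closure (interior K) = K"
    using convex_closure_interior[OF K(2) int] K(1) by (simp add: compact_imp_closed)
  \<comment> \<open>The maximum of \<open>W\<close> may be attained on the boundary of
    \<open>K\<close>. As \<open>K\<close> is the closure of its interior, the interior estimate
    persists there, and \<open>N \<le> N / 2\<close> forces the nonnegative \<open>N\<close> to
    vanish.\<close>
  have "W m \<le> N / 2"
    by (rule continuous_le_on_closure[of "interior K" W]) (use \<open>continuous_on K W\<close> cl m half_W in auto)
  then have "N = 0" using N0 by (simp add: N_def)
  then show ?thesis using yN[OF \<open>x \<in> K\<close>] by simp
qed

text \<open>
  The rays used at \<open>x\<close> have the directions \<open>x\<close> and \<open>x + |x|/2 e\<^sub>i\<close>: they escape to infinity at a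
  linear rate, and together they determine \<open>y x\<close>.
\<close>

lemma line_equation_decay:
  fixes y :: "real^'n \<Rightarrow> real^'n"
  assumes "\<beta> > 0" "R0 > 0"
    and line: "\<And>x a. norm x > R0 \<Longrightarrow> \<exists>D. ((\<lambda>t. y (x + t *\<^sub>R a) \<bullet> a) has_real_derivative D) (at 0)
                 \<and> \<bar>D\<bar> \<le> C * (norm a)\<^sup>2 * norm x powr (- \<beta> - 1) * norm (y x)"
    and decay: "(y \<longlongrightarrow> 0) at_infinity"
  obtains R where "R \<ge> R0" "\<And>x. norm x > R \<Longrightarrow> y x = 0"
proof -
  define C0 where "C0 = max C 0"
  have "\<forall>\<^sub>F x in at_infinity. norm (y x) < 1"
    using decay by (simp add: tendsto_iff)
  then obtain R1 where R1: "\<And>x. norm x \<ge> R1 \<Longrightarrow> norm (y x) < 1"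
    by (auto simp: eventually_at_infinity)
  \<comment> \<open>Summing \<open>comp\<close> over the components gives
    \<open>(M - 1) / r powr \<beta> * (N / 2)\<close>. Beyond \<open>R\<close> one has
    \<open>M \<le> r powr \<beta>\<close>, so this is at most \<open>N / 2\<close>.\<close>
  define M where "M = 36 * real CARD('n) * C0 / \<beta> + 1"
  have "M \<ge> 1" using assms(1) by (simp add: M_def C0_def)
  define R where "R = max R0 (max R1 (M powr (1 / \<beta>)))"
  have R: "R \<ge> R0" "R \<ge> R1" "R > 0" using assms by (auto simp: R_def)
  have RM: "M \<le> r powr \<beta>" if "r > R" for r
  proof -
    have "M = (M powr (1 / \<beta>)) powr \<beta>"
      using \<open>M \<ge> 1\<close> assms(1) by (simp add: powr_powr)
    also have "\<dots> \<le> r powr \<beta>"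
      using that assms(1) by (intro powr_mono2) (auto simp: R_def)
    finally show ?thesis .
  qed
  \<comment> \<open>Every bound \<open>N\<close> valid beyond \<open>R\<close> improves to
    \<open>N / 2\<close> on the same region: the rays from \<open>x\<close> never come closer to the
    origin than \<open>x\<close> itself, so \<open>N\<close> applies all along them.\<close>
  have half: "norm (y x) \<le> N / 2"
    if N: "\<And>x. norm x > R \<Longrightarrow> norm (y x) \<le> N" and x: "norm x > R" for N x
  proof -
    define r where "r = norm x"
    have r: "r > R" "r > 0" using x R by (auto simp: r_def)
    have N0: "N \<ge> 0" using N[OF x] norm_ge_zero[of "y x"] by linarith
    define E where "E = C0 * (3 / 2 * r)\<^sup>2 * r powr (- \<beta> - 1) * N"
    have E0: "E \<ge> 0" using N0 by (simp add: E_def C0_def)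
    have ray: "\<bar>y x \<bullet> (x + v)\<bar> \<le> E * (2 / \<beta>)" if v: "norm v \<le> r / 2" for v
    proof -
      define a where "a = x + v"
      define P where "P t = x + t *\<^sub>R a" for t
      have na: "norm a \<le> 3 / 2 * r"
        using norm_triangle_ineq[of x v] v by (simp add: a_def r_def)
      have nP: "norm (P t) \<ge> r * (1 + t / 2)" if "t \<ge> 0" for t
      proof -
        have "P t = (1 + t) *\<^sub>R x - (- t) *\<^sub>R v"
          by (simp add: P_def a_def algebra_simps)
        then have "norm (P t) \<ge> norm ((1 + t) *\<^sub>R x) - norm ((- t) *\<^sub>R v)"
          by (metis norm_triangle_ineq2)
        moreover have "norm ((- t) *\<^sub>R v) \<le> t * (r / 2)"
          using that mult_left_mono[OF v, of t] by simp
        moreover have "norm ((1 + t) *\<^sub>R x) = (1 + t) * r"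
          using that by (simp add: r_def del: scaleR_left_distrib)
        ultimately show ?thesis
          by (simp add: algebra_simps)
      qed
      have r_le: "r \<le> norm (P t)" if "t \<ge> 0" for t
      proof -
        have "r * 1 \<le> r * (1 + t / 2)"
          using r that by (intro mult_left_mono) auto
        with nP[OF that] show ?thesis
          by linarith
      qed
      have "\<forall>t\<in>{0..}. \<exists>D. ((\<lambda>t. y (P t) \<bullet> a) has_real_derivative D) (at t)
          \<and> \<bar>D\<bar> \<le> C * (norm a)\<^sup>2 * norm (P t) powr (- \<beta> - 1) * norm (y (P t))"
      proof
        fix t :: real assume "t \<in> {0..}"
        then have "norm (P t) > R0" using r_le[of t] r R by auto
        from line[OF this, of a] obtain D where
          D: "((\<lambda>s. y (P t + s *\<^sub>R a) \<bullet> a) has_real_derivative D) (at 0)"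
             "\<bar>D\<bar> \<le> C * (norm a)\<^sup>2 * norm (P t) powr (- \<beta> - 1) * norm (y (P t))"
          by blast
        have "((\<lambda>s. y (P (t + s)) \<bullet> a) has_real_derivative D) (at 0)"
          using D(1) by (simp add: P_def algebra_simps)
        then have "((\<lambda>s. y (P s) \<bullet> a) has_real_derivative D) (at t)"
          using DERIV_at_within_shift[of "\<lambda>s. y (P s) \<bullet> a" D t 0 UNIV] by (simp add: add.commute)
        with D(2) show "\<exists>D. ((\<lambda>t. y (P t) \<bullet> a) has_real_derivative D) (at t)
          \<and> \<bar>D\<bar> \<le> C * (norm a)\<^sup>2 * norm (P t) powr (- \<beta> - 1) * norm (y (P t))"
          by blast
      qed
      then obtain D where D: "\<And>t. t \<in> {0..} \<Longrightarrow> ((\<lambda>t. y (P t) \<bullet> a) has_real_derivative D t) (at t)"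
        "\<And>t. t \<in> {0..} \<Longrightarrow> \<bar>D t\<bar> \<le> C * (norm a)\<^sup>2 * norm (P t) powr (- \<beta> - 1) * norm (y (P t))"
        by metis
      \<comment> \<open>An antiderivative of the bound in \<open>D_le\<close> that stays
        nonpositive, so the resulting estimate \<open>- \<psi> 0\<close> does not depend on the end
        parameter \<open>T\<close>.\<close>
      define \<psi> where "\<psi> t = - E * (2 / \<beta>) * (1 + t / 2) powr (- \<beta>)" for t
      have D_le: "\<bar>D t\<bar> \<le> E * (1 + t / 2) powr (- \<beta> - 1)" if t: "t \<ge> 0" for t
      proof -
        have "\<bar>D t\<bar> \<le> C * (norm a)\<^sup>2 * norm (P t) powr (- \<beta> - 1) * norm (y (P t))"
          using D(2) t by simp
        also have "\<dots> \<le> C0 * (3 / 2 * r)\<^sup>2 * (r * (1 + t / 2)) powr (- \<beta> - 1) * N"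
          using na nP[OF t] r t N[of "P t"] r_le[OF t] assms(1)
          by (intro mult_mono power_mono powr_mono2') (auto simp: C0_def)
        also have "\<dots> = E * (1 + t / 2) powr (- \<beta> - 1)"
          using r t by (simp add: E_def powr_mult)
        finally show ?thesis .
      qed
      have bound: "\<bar>y (P T) \<bullet> a - y x \<bullet> a\<bar> \<le> E * (2 / \<beta>)" if "T > 0" for T
      proof -
        have "norm ((\<lambda>t. y (P t) \<bullet> a) T - (\<lambda>t. y (P t) \<bullet> a) 0) \<le> \<psi> T - \<psi> 0"
        proof (rule differentiable_bound_general[OF that])
          show "continuous_on {0..T} (\<lambda>t. y (P t) \<bullet> a)"
          proof (rule DERIV_continuous_on)
            show "((\<lambda>t. y (P t) \<bullet> a) has_real_derivative D t) (at t within {0..T})"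
              if "t \<in> {0..T}" for t
              using D(1)[of t] that by (auto intro: has_field_derivative_at_within)
          qed
          show "continuous_on {0..T} \<psi>"
            unfolding \<psi>_def by (intro continuous_intros) auto
          fix t :: real assume t: "0 < t" "t < T"
          show "((\<lambda>t. y (P t) \<bullet> a) has_vector_derivative D t) (at t)"
            using D(1)[of t] t by (simp add: has_real_derivative_iff_has_vector_derivative)
          have "(\<psi> has_real_derivative E * (1 + t / 2) powr (- \<beta> - 1)) (at t)"
            unfolding \<psi>_def using assms(1) t by (auto intro!: derivative_eq_intros)
          then show "(\<psi> has_vector_derivative E * (1 + t / 2) powr (- \<beta> - 1)) (at t)"
            by (simp add: has_real_derivative_iff_has_vector_derivative)
          show "norm (D t) \<le> E * (1 + t / 2) powr (- \<beta> - 1)"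
            using D_le[of t] t by simp
        qed
        moreover have "\<psi> T \<le> 0" using E0 assms(1) by (simp add: \<psi>_def)
        ultimately show ?thesis by (simp add: \<psi>_def P_def)
      qed
      have "filterlim P at_infinity at_top"
      proof (rule filterlim_norm_at_top_imp_at_infinity)
        have "filterlim (\<lambda>t. r * (1 + t / 2)) at_top at_top"
          using r by real_asymp
        then show "filterlim (\<lambda>t. norm (P t)) at_top at_top"
        proof (rule filterlim_at_top_mono)
          show "\<forall>\<^sub>F t in at_top. r * (1 + t / 2) \<le> norm (P t)"
            using eventually_ge_at_top[of 0] by eventually_elim (rule nP)
        qed
      qed
      then have "((\<lambda>t. y (P t)) \<longlongrightarrow> 0) at_top"
        using decay filterlim_compose by blast
      then have "((\<lambda>t. \<bar>y (P t) \<bullet> a - y x \<bullet> a\<bar>) \<longlongrightarrow> \<bar>0 \<bullet> a - y x \<bullet> a\<bar>) at_top"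
        by (intro tendsto_intros)
      moreover have "\<forall>\<^sub>F t in at_top. \<bar>y (P t) \<bullet> a - y x \<bullet> a\<bar> \<le> E * (2 / \<beta>)"
        using eventually_gt_at_top[of 0] by eventually_elim (rule bound)
      ultimately have "\<bar>0 \<bullet> a - y x \<bullet> a\<bar> \<le> E * (2 / \<beta>)"
        by (rule tendsto_upperbound) simp
      then show ?thesis by (simp add: a_def)
    qed
    \<comment> \<open>\<open>E\<close> carries \<open>r\<^sup>2\<close> from the squared length of
      \<open>a\<close> and \<open>r powr (- \<beta> - 1)\<close> from the line equation; division by
      the displacement \<open>r / 2\<close> leaves \<open>r powr (- \<beta>)\<close>. The constant
      18 is \<open>8 * (3 / 2)\<^sup>2\<close>.\<close>
    have comp: "\<bar>y x $ i\<bar> \<le> 18 * C0 / \<beta> * r powr (- \<beta>) * N" for i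
    proof -
      have "y x \<bullet> (x + axis i (r / 2)) - y x \<bullet> (x + 0) = r / 2 * y x $ i"
        by (simp add: inner_axis algebra_simps)
      moreover have "\<bar>y x \<bullet> (x + axis i (r / 2))\<bar> \<le> E * (2 / \<beta>)" "\<bar>y x \<bullet> (x + 0)\<bar> \<le> E * (2 / \<beta>)"
        using ray[of "axis i (r / 2)"] ray[of 0] r by (auto simp: norm_axis)
      ultimately have "\<bar>r / 2 * y x $ i\<bar> \<le> 2 * (E * (2 / \<beta>))" by linarith
      then have "r / 2 * \<bar>y x $ i\<bar> \<le> 2 * (E * (2 / \<beta>))"
        using r by (simp add: abs_mult)
      then have "\<bar>y x $ i\<bar> * r \<le> 8 * E / \<beta>"
        by (simp add: mult_ac)
      then have "\<bar>y x $ i\<bar> \<le> 8 * E / \<beta> / r"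
        using r(2) by (simp only: pos_le_divide_eq)
      also have "\<dots> = 18 * C0 / \<beta> * (r\<^sup>2 * r powr (- \<beta> - 1) / r) * N"
        by (simp add: E_def power2_eq_square)
      also have "r\<^sup>2 * r powr (- \<beta> - 1) / r = r powr (- \<beta>)"
        using r by (simp add: power2_eq_square powr_diff)
      finally show ?thesis .
    qed
    have "norm (y x) \<le> (\<Sum>i\<in>UNIV. \<bar>y x $ i\<bar>)"
      by (rule norm_le_l1_cart)
    also have "\<dots> \<le> of_nat CARD('n) * (18 * C0 / \<beta> * r powr (- \<beta>) * N)"
      using comp by (intro sum_bounded_above) auto
    also have "\<dots> = (M - 1) / r powr \<beta> * (N / 2)"
      by (simp add: M_def powr_minus divide_simps)
    also have "\<dots> \<le> 1 * (N / 2)"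
    proof (intro mult_right_mono)
      show "(M - 1) / r powr \<beta> \<le> 1"
        using RM[OF r(1)] r by (simp add: divide_le_eq_1)
    qed (use N0 in auto)
    finally show ?thesis by simp
  qed
  \<comment> \<open>Iterated halving on a fixed region, starting from the bound 1 that the decay
    provides.\<close>
  have "norm (y x) \<le> (1 / 2) ^ m" if "norm x > R" for m x
    using that
  proof (induction m arbitrary: x)
    case 0
    then show ?case using R1[of x] R by simp
  next
    case (Suc m)
    then show ?case using half[of "(1 / 2) ^ m" x] by simp
  qed
  then have "y x = 0" if "norm x > R" for x
    using that LIMSEQ_le_const[of "\<lambda>m. (1 / 2 :: real) ^ m" 0 "norm (y x)"]
    by (simp add: LIMSEQ_power_zero)
  with R(1) that show thesis by blast
qed

section \<open>Brackets of Killing fields\<close>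

text \<open>A product rule for \<open>L y (Z y)\<close> in which \<open>L\<close> is differentiable
  only at each fixed argument: expanding \<open>Z y\<close> in an orthonormal basis reduces it to
  finitely many scalar products.\<close>

lemma has_derivative_linear_family_within:
  fixes L :: "'a::real_normed_vector \<Rightarrow> 'b::euclidean_space \<Rightarrow> 'c::real_normed_vector"
  assumes "x \<in> T"
    and lin: "\<And>y. y \<in> T \<Longrightarrow> linear (L y)"
    and L: "\<And>v. ((\<lambda>y. L y v) has_derivative L' v) (at x within T)"
    and Z: "(Z has_derivative Z') (at x within T)"
  shows "((\<lambda>y. L y (Z y)) has_derivative (\<lambda>w. (\<Sum>i\<in>Basis. (Z x \<bullet> i) *\<^sub>R L' i w) + L x (Z' w))) (at x within T)"
proof -
  have expand: "(\<Sum>i\<in>Basis. (v \<bullet> i) *\<^sub>R L y i) = L y v" if "y \<in> T" for y v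
  proof -
    have "L y (\<Sum>i\<in>Basis. (v \<bullet> i) *\<^sub>R i) = (\<Sum>i\<in>Basis. (v \<bullet> i) *\<^sub>R L y i)"
      using lin[OF that] by (simp add: linear_sum linear_scale)
    then show ?thesis by (simp add: euclidean_representation)
  qed
  have "((\<lambda>y. \<Sum>i\<in>Basis. (Z y \<bullet> i) *\<^sub>R L y i) has_derivative
      (\<lambda>w. \<Sum>i\<in>Basis. (Z x \<bullet> i) *\<^sub>R L' i w + (Z' w \<bullet> i) *\<^sub>R L x i)) (at x within T)"
    by (auto intro!: derivative_eq_intros L Z)
  then have "((\<lambda>y. L y (Z y)) has_derivative
      (\<lambda>w. \<Sum>i\<in>Basis. (Z x \<bullet> i) *\<^sub>R L' i w + (Z' w \<bullet> i) *\<^sub>R L x i)) (at x within T)"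
    by (rule has_derivative_transform[OF assms(1), rotated]) (simp add: expand)
  then show ?thesis
    using expand[OF assms(1)] by (simp add: sum.distrib)
qed

lemma has_derivative_linear_family:
  fixes L :: "'a::real_normed_vector \<Rightarrow> 'b::euclidean_space \<Rightarrow> 'c::real_normed_vector"
  assumes "open T" "x \<in> T"
    and lin: "\<And>y. y \<in> T \<Longrightarrow> linear (L y)"
    and L: "\<And>v. ((\<lambda>y. L y v) has_derivative L' v) (at x)"
    and Z: "(Z has_derivative Z') (at x)"
  shows "((\<lambda>y. L y (Z y)) has_derivative (\<lambda>w. (\<Sum>i\<in>Basis. (Z x \<bullet> i) *\<^sub>R L' i w) + L x (Z' w))) (at x)"
  unfolding at_within_open[OF assms(2,1), symmetric]
  by (rule has_derivative_linear_family_within[OF assms(2) lin])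
     (simp_all add: L Z at_within_open[OF assms(2,1)])

text \<open>
  \<open>X\<close> and \<open>Z\<close> are only \<open>C\<^sup>1\<close>, so their bracket need not be differentiable; its component along
  \<open>a\<close> nevertheless has the derivative in the direction \<open>a\<close> that Killing's equation prescribes.
\<close>

lemma killing_bracket_line_equation:
  fixes g :: "real^'n \<Rightarrow> real^'n^'n" and X Z :: "real^'n \<Rightarrow> real^'n"
  assumes "open U" "x \<in> U"
    and g1: "\<And>y. y \<in> U \<Longrightarrow> (g has_derivative g' y) (at y)"
    and g2: "\<And>y v. y \<in> U \<Longrightarrow> ((\<lambda>z. g' z v) has_derivative g'' y v) (at y)"
    and g2_cont: "\<And>v w. continuous_on U (\<lambda>y. g'' y v w)"
    and g2_sym: "\<And>y v w. y \<in> U \<Longrightarrow> g'' y v w = g'' y w v"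
    and g_sym: "\<And>y v w. y \<in> U \<Longrightarrow> v \<bullet> (g y *v w) = w \<bullet> (g y *v v)"
    and X1: "\<And>y. y \<in> U \<Longrightarrow> (X has_derivative X' y) (at y)"
    and X1_cont: "\<And>w. continuous_on U (\<lambda>y. X' y w)"
    and Z1: "\<And>y. y \<in> U \<Longrightarrow> (Z has_derivative Z' y) (at y)"
    and Z1_cont: "\<And>w. continuous_on U (\<lambda>y. Z' y w)"
    and X_kill: "\<And>y v w. y \<in> U \<Longrightarrow>
       v \<bullet> (g' y (X y) *v w) + X' y v \<bullet> (g y *v w) + v \<bullet> (g y *v X' y w) = 0"
    and Z_kill: "\<And>y v w. y \<in> U \<Longrightarrow>
       v \<bullet> (g' y (Z y) *v w) + Z' y v \<bullet> (g y *v w) + v \<bullet> (g y *v Z' y w) = 0"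
  defines "Y \<equiv> \<lambda>y. Z' y (X y) - X' y (Z y)"
  shows "((\<lambda>t. (g (x + t *\<^sub>R a) *v Y (x + t *\<^sub>R a)) \<bullet> a) has_real_derivative
           a \<bullet> (g' x a *v Y x) - (a \<bullet> (g' x (Y x) *v a)) / 2) (at 0)"
proof -
  define \<gamma> where "\<gamma> t = x + t *\<^sub>R a" for t
  define T where "T = \<gamma> -` U"
  have \<gamma>0: "\<gamma> 0 = x"
    by (simp add: \<gamma>_def)
  have T: "open T" "0 \<in> T"
    using assms(1,2) unfolding T_def \<gamma>_def
    by (auto intro!: open_vimage continuous_intros)
  have \<gamma>_deriv: "(\<gamma> has_derivative (\<lambda>t. t *\<^sub>R a)) (at 0)"
    unfolding \<gamma>_def by (auto intro!: derivative_eq_intros)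
  have along: "((\<lambda>t. F (\<gamma> t)) has_derivative (\<lambda>t. t *\<^sub>R F' a)) (at 0)"
    if "(F has_derivative F') (at x)" for F :: "real^'n \<Rightarrow> 'b::real_normed_vector" and F'
  proof -
    have "(F has_derivative F') (at (\<gamma> 0))"
      using that by (simp add: \<gamma>0)
    from has_derivative_compose[OF \<gamma>_deriv this] show ?thesis
      using has_derivative_linear[OF that] by (simp add: linear_scale)
  qed
  have real_derivI: "(f has_real_derivative c) (at 0)" if "(f has_derivative (\<lambda>t. t * c)) (at 0)" for f c
    using that by (simp add: has_field_derivative_def mult_commute_abs)
  have g'_lin: "linear (g' y)" if "y \<in> U" for y
    using g1[OF that] by (rule has_derivative_linear)
  have g''_lin: "linear (g'' y v)" if "y \<in> U" for y v
    using g2[OF that] by (rule has_derivative_linear)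
  have g''_sum: "(\<Sum>i\<in>Basis. (v \<bullet> i) *\<^sub>R g'' y i w) = g'' y v w" if "y \<in> U" for y v w
  proof -
    have "(\<Sum>i\<in>Basis. (v \<bullet> i) *\<^sub>R g'' y w i) = g'' y w (\<Sum>i\<in>Basis. (v \<bullet> i) *\<^sub>R i)"
      using g''_lin[OF that] by (simp add: linear_sum linear_scale)
    then show ?thesis
      by (simp add: g2_sym[OF that, of _ w] euclidean_representation)
  qed
  have g'_along: "((\<lambda>y. g' y (W y)) has_derivative (\<lambda>w. g'' y (W y) w + g' y (W' w))) (at y)"
    if "y \<in> U" "(W has_derivative W') (at y)" for W W' y
    using has_derivative_linear_family[OF \<open>open U\<close> that(1) g'_lin g2[OF that(1)] that(2)]
    by (simp add: g''_sum that(1))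
  \<comment> \<open>For \<open>\<zeta> = g(V, a)\<close> the expression is the derivative of
    \<open>\<zeta>\<close> along \<open>W\<close>, and it is differentiated along \<open>a\<close>.
    At a fixed vector \<open>w\<close>, the derivative of \<open>\<zeta>'\<close> comes from
    \<open>mixed_directional_derivative\<close>, with \<open>\<lambda>y. \<zeta>' y a\<close> as the
    function that can be differentiated again.\<close>
  have half: "((\<lambda>t. a \<bullet> (g' (\<gamma> t) (W (\<gamma> t)) *v V (\<gamma> t)) + a \<bullet> (g (\<gamma> t) *v V' (\<gamma> t) (W (\<gamma> t))))
      has_real_derivative
        a \<bullet> (g' x (W' x a) *v V x) + a \<bullet> (g x *v V' x (W' x a))
        + a \<bullet> (g'' x a (W x) *v V x) + a \<bullet> (g' x a *v V' x (W x))
        - (a \<bullet> (g'' x (V x) (W x) *v a) + a \<bullet> (g' x (V' x (W x)) *v a)) / 2) (at 0)"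
    if V1: "\<And>y. y \<in> U \<Longrightarrow> (V has_derivative V' y) (at y)"
      and V1_cont: "\<And>w. continuous_on U (\<lambda>y. V' y w)"
      and V_kill: "\<And>y v w. y \<in> U \<Longrightarrow>
         v \<bullet> (g' y (V y) *v w) + V' y v \<bullet> (g y *v w) + v \<bullet> (g y *v V' y w) = 0"
      and W1: "\<And>y. y \<in> U \<Longrightarrow> (W has_derivative W' y) (at y)"
    for V W V' W'
  proof -
    define \<zeta>' where "\<zeta>' y w = a \<bullet> (g' y w *v V y) + a \<bullet> (g y *v V' y w)" for y w
    define h' where "h' y w = a \<bullet> (g'' y a w *v V y) + a \<bullet> (g' y a *v V' y w)
      - (a \<bullet> (g'' y (V y) w *v a) + a \<bullet> (g' y (V' y w) *v a)) / 2" for y w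
    have \<zeta>1: "((\<lambda>y. a \<bullet> (g y *v V y)) has_derivative \<zeta>' y) (at y)" if "y \<in> U" for y
      unfolding \<zeta>'_def
      by (auto intro!: derivative_eq_intros g1 V1 that simp: inner_add_right)
    \<comment> \<open>Killing's equation at the pair \<open>a\<close>, \<open>a\<close> replaces
      \<open>g(V' a, a)\<close> by minus half of the term with \<open>g' y (V y)\<close>. No
      derivative of \<open>V\<close> is left, so the result is differentiable.\<close>
    have \<zeta>'_a: "\<zeta>' y a = a \<bullet> (g' y a *v V y) - (a \<bullet> (g' y (V y) *v a)) / 2" if "y \<in> U" for y
      using V_kill[OF that, of a a] g_sym[OF that, of "V' y a" a] by (simp add: \<zeta>'_def)
    have h1: "((\<lambda>y. \<zeta>' y a) has_derivative h' y) (at y)" if "y \<in> U" for y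
    proof (rule has_derivative_transform_within_open[OF _ \<open>open U\<close> that])
      show "((\<lambda>y. a \<bullet> (g' y a *v V y) - (a \<bullet> (g' y (V y) *v a)) / 2) has_derivative h' y) (at y)"
        unfolding h'_def
        by (auto intro!: derivative_eq_intros g2 V1 that g'_along
            simp: inner_add_right matrix_vector_mult_add_rdistrib)
    qed (simp add: \<zeta>'_a)
    have V_cont: "continuous_on U V"
      using V1 by (meson continuous_at_imp_continuous_on has_derivative_continuous)
    have g'_cont: "continuous_on U (\<lambda>y. g' y v)" for v
      using g2 by (meson continuous_at_imp_continuous_on has_derivative_continuous)
    have h'_cont: "continuous_on U (\<lambda>y. h' y w)" for w
    proof -
      have "continuous_on U (\<lambda>y. \<Sum>i\<in>Basis. (V y \<bullet> i) *\<^sub>R g'' y i w)"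
        by (intro continuous_intros V_cont g2_cont)
      then have 1: "continuous_on U (\<lambda>y. g'' y (V y) w)"
        by (rule continuous_on_eq) (simp add: g''_sum)
      have "continuous_on U (\<lambda>y. \<Sum>i\<in>Basis. (V' y w \<bullet> i) *\<^sub>R g' y i)"
        by (intro continuous_intros V1_cont g'_cont)
      then have 2: "continuous_on U (\<lambda>y. g' y (V' y w))"
      proof (rule continuous_on_eq)
        fix y assume "y \<in> U"
        then show "(\<Sum>i\<in>Basis. (V' y w \<bullet> i) *\<^sub>R g' y i) = g' y (V' y w)"
          using g'_lin[of y] linear_sum[of "g' y" "\<lambda>i. (V' y w \<bullet> i) *\<^sub>R i" Basis]
          by (simp add: linear_scale euclidean_representation)
      qed
      show ?thesis
        unfolding h'_def
        by (intro continuous_intros continuous_on_matrix_vector_mult 1 2 V_cont V1_cont g'_cont g2_cont)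
           auto
    qed
    have mixed: "((\<lambda>t. \<zeta>' (\<gamma> t) w) has_derivative (\<lambda>t. t * h' x w)) (at 0)" for w
      using mixed_directional_derivative[OF assms(1,2) \<zeta>1 h1 h'_cont]
      by (simp add: \<gamma>_def has_field_derivative_def mult_commute_abs)
    have "((\<lambda>t. \<zeta>' (\<gamma> t) (W (\<gamma> t))) has_derivative
        (\<lambda>t. (\<Sum>i\<in>Basis. (W (\<gamma> 0) \<bullet> i) *\<^sub>R (t * h' x i)) + \<zeta>' (\<gamma> 0) (t *\<^sub>R W' x a))) (at 0)"
    proof (rule has_derivative_linear_family[OF T _ mixed along[OF W1[OF \<open>x \<in> U\<close>]]])
      show "linear (\<zeta>' (\<gamma> t))" if "t \<in> T" for t
        using has_derivative_linear[OF \<zeta>1] that by (simp add: T_def)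
    qed
    moreover have "(\<Sum>i\<in>Basis. (W (\<gamma> 0) \<bullet> i) *\<^sub>R (t * h' x i)) = t * h' x (W x)" for t
    proof -
      have "linear (h' x)"
        using h1[OF \<open>x \<in> U\<close>] by (rule has_derivative_linear)
      then have "h' x (\<Sum>i\<in>Basis. (W x \<bullet> i) *\<^sub>R i) = (\<Sum>i\<in>Basis. (W x \<bullet> i) *\<^sub>R h' x i)"
        by (simp add: linear_sum linear_scale)
      then show ?thesis
        by (simp add: \<gamma>0 euclidean_representation sum_distrib_left mult_ac)
    qed
    moreover have "\<zeta>' (\<gamma> 0) (t *\<^sub>R W' x a) = t * \<zeta>' x (W' x a)" for t
      using has_derivative_linear[OF \<zeta>1[OF \<open>x \<in> U\<close>]] by (simp add: \<gamma>0 linear_scale)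
    ultimately have "((\<lambda>t. \<zeta>' (\<gamma> t) (W (\<gamma> t))) has_real_derivative h' x (W x) + \<zeta>' x (W' x a)) (at 0)"
      by (intro real_derivI) (simp add: distrib_left)
    then show ?thesis
      by (simp add: h'_def \<zeta>'_def algebra_simps)
  qed
  have cross: "((\<lambda>t. a \<bullet> (g' (\<gamma> t) (W (\<gamma> t)) *v V (\<gamma> t))) has_real_derivative
       a \<bullet> (g'' x (W x) a *v V x) + a \<bullet> (g' x (W' a) *v V x) + a \<bullet> (g' x (W x) *v V' a)) (at 0)"
    if "(W has_derivative W') (at x)" "(V has_derivative V') (at x)" for W W' V V'
  proof -
    have "((\<lambda>y. a \<bullet> (g' y (W y) *v V y)) has_derivative
        (\<lambda>w. a \<bullet> (g'' x (W x) w *v V x) + a \<bullet> (g' x (W' w) *v V x) + a \<bullet> (g' x (W x) *v V' w))) (at x)"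
      by (auto intro!: derivative_eq_intros g'_along that \<open>x \<in> U\<close>
          simp: inner_add_right matrix_vector_mult_add_rdistrib)
    from along[OF this] show ?thesis
      by (intro real_derivI) simp
  qed
  note deriv = DERIV_diff[OF DERIV_diff[OF half[OF Z1 Z1_cont Z_kill X1] half[OF X1 X1_cont X_kill Z1]]
      DERIV_diff[OF cross[OF X1[OF \<open>x \<in> U\<close>] Z1[OF \<open>x \<in> U\<close>]] cross[OF Z1[OF \<open>x \<in> U\<close>] X1[OF \<open>x \<in> U\<close>]]]]
  have g'_diff: "g' x (u - v) = g' x u - g' x v" for u v
    using g'_lin[OF \<open>x \<in> U\<close>] by (rule linear_diff)
  \<comment> \<open>\<open>g(Y, a)\<close> is the derivative of \<open>g(Z, a)\<close> along
    \<open>X\<close> minus that of \<open>g(X, a)\<close> along \<open>Z\<close>, corrected by the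
    terms in which the metric was differentiated. The former are covered by \<open>half\<close>, the
    corrections by \<open>cross\<close>.\<close>
  have bracket_eq: "(g y *v Y y) \<bullet> a =
      (a \<bullet> (g' y (X y) *v Z y) + a \<bullet> (g y *v Z' y (X y)))
      - (a \<bullet> (g' y (Z y) *v X y) + a \<bullet> (g y *v X' y (Z y)))
      - (a \<bullet> (g' y (X y) *v Z y) - a \<bullet> (g' y (Z y) *v X y))" for y
    by (simp add: Y_def matrix_vector_mult_diff_distrib inner_diff_right inner_commute)
  show ?thesis
    unfolding \<gamma>_def[symmetric] bracket_eq
  proof (rule DERIV_cong[OF deriv])
    show "a \<bullet> (g' x (X' x a) *v Z x) + a \<bullet> (g x *v Z' x (X' x a)) +
        a \<bullet> (g'' x a (X x) *v Z x) + a \<bullet> (g' x a *v Z' x (X x)) -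
        (a \<bullet> (g'' x (Z x) (X x) *v a) + a \<bullet> (g' x (Z' x (X x)) *v a)) / 2 -
        (a \<bullet> (g' x (Z' x a) *v X x) + a \<bullet> (g x *v X' x (Z' x a)) +
         a \<bullet> (g'' x a (Z x) *v X x) + a \<bullet> (g' x a *v X' x (Z x)) -
         (a \<bullet> (g'' x (X x) (Z x) *v a) + a \<bullet> (g' x (X' x (Z x)) *v a)) / 2) -
        (a \<bullet> (g'' x (X x) a *v Z x) + a \<bullet> (g' x (X' x a) *v Z x) + a \<bullet> (g' x (X x) *v Z' x a) -
         (a \<bullet> (g'' x (Z x) a *v X x) + a \<bullet> (g' x (Z' x a) *v X x) + a \<bullet> (g' x (Z x) *v X' x a))) =
        a \<bullet> (g' x a *v Y x) - a \<bullet> (g' x (Y x) *v a) / 2"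
    proof -
      have "a \<bullet> (g' x a *v Y x) = a \<bullet> (g' x a *v Z' x (X x)) - a \<bullet> (g' x a *v X' x (Z x))"
        "a \<bullet> (g' x (Y x) *v a) = a \<bullet> (g' x (Z' x (X x)) *v a) - a \<bullet> (g' x (X' x (Z x)) *v a)"
        by (simp_all add: Y_def g'_diff matrix_vector_mult_diff_distrib matrix_vector_mult_diff_rdistrib
            inner_diff_right)
      note Y_expand = this
      have g2_eqs: "g'' x a (X x) = g'' x (X x) a" "g'' x a (Z x) = g'' x (Z x) a"
        "g'' x (Z x) (X x) = g'' x (X x) (Z x)"
        using g2_sym[OF \<open>x \<in> U\<close>] by auto
      \<comment> \<open>Killing's equation for \<open>X\<close> at \<open>a\<close>,
        \<open>Z' x a\<close> and for \<open>Z\<close> at \<open>a\<close>, \<open>X' x a\<close>;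
        the common term \<open>g(X' a, Z' a)\<close> cancels by symmetry of the metric.\<close>
      have "a \<bullet> (g x *v Z' x (X' x a)) - a \<bullet> (g x *v X' x (Z' x a))
          = a \<bullet> (g' x (X x) *v Z' x a) - a \<bullet> (g' x (Z x) *v X' x a)"
        using X_kill[OF \<open>x \<in> U\<close>, of a "Z' x a"] Z_kill[OF \<open>x \<in> U\<close>, of a "X' x a"]
          g_sym[OF \<open>x \<in> U\<close>, of "Z' x a" "X' x a"]
        by linarith
      then show ?thesis
        unfolding Y_expand g2_eqs diff_divide_distrib add_divide_distrib by linarith
    qed
  qed
qed

text \<open>The norm of a matrix as a vector of rows is the Frobenius norm, so Cauchy-Schwarz
  applies row by row.\<close>

lemma norm_matrix_vector_mult_le:
  fixes A :: "real^'n^'m"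
  shows "norm (A *v w) \<le> norm A * norm w"
proof -
  have "norm (A *v w) = L2_set (\<lambda>i. norm ((A *v w) $ i)) UNIV"
    by (simp add: norm_vec_def)
  also have "\<dots> \<le> L2_set (\<lambda>i. norm (A $ i) * norm w) UNIV"
    by (intro L2_set_mono) (auto simp: matrix_vector_mul_component Cauchy_Schwarz_ineq2)
  also have "\<dots> = norm A * norm w"
    by (simp add: norm_vec_def[of A] L2_set_left_distrib)
  finally show ?thesis .
qed

lemma norm_linear_le_axis:
  fixes F :: "real^'n \<Rightarrow> 'b::real_normed_vector"
  assumes "linear F"
  shows "norm (F v) \<le> (\<Sum>i\<in>UNIV. norm (F (axis i 1))) * norm v"
proof -
  have "norm (F v) \<le> (\<Sum>i\<in>UNIV. norm (v $ i *\<^sub>R F (axis i 1)))"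
    unfolding linear_axis_expansion[OF assms, of v] by (rule norm_sum)
  also have "\<dots> \<le> (\<Sum>i\<in>UNIV. norm (F (axis i 1)) * norm v)"
    by (intro sum_mono) (simp add: component_le_norm_cart mult_left_mono mult.commute[of _ "norm v"] mult_right_mono)
  finally show ?thesis
    by (simp add: sum_distrib_right)
qed

lemma fderiv_compose_linear:
  assumes "chart_domain S" "x \<in> S" "(f has_derivative f') (at x within S)" "bounded_linear h"
  shows "fderiv S (\<lambda>y. h (f y)) x = (\<lambda>v. h (f' v))"
  by (rule fderiv_eqI[OF assms(1,2) bounded_linear.has_derivative[OF assms(4,3)]])

lemma C1_on_compose_linear:
  assumes "chart_domain S" "C1_on S f" "bounded_linear h"
  shows "C1_on S (\<lambda>y. h (f y))"
proof (rule C1_onI[OF assms(1), where f' = "\<lambda>x v. h (fderiv S f x v)"])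
  show "((\<lambda>y. h (f y)) has_derivative (\<lambda>v. h (fderiv S f x v))) (at x within S)" if "x \<in> S" for x
    by (rule bounded_linear.has_derivative[OF assms(3) C1_onD(1)[OF assms(2) that]])
  show "continuous_on S (\<lambda>x. h (fderiv S f x v))" for v
    by (rule bounded_linear.continuous_on[OF assms(3) C1_onD(2)[OF assms(2)]])
qed

lemma C2_on_compose_linear:
  assumes "chart_domain S" "C2_on S f" "bounded_linear h"
  shows "C2_on S (\<lambda>y. h (f y))"
  unfolding C2_on_def
proof (intro conjI allI)
  show "C1_on S (\<lambda>y. h (f y))"
    by (rule C1_on_compose_linear[OF assms(1) C2_onD(1)[OF assms(2)] assms(3)])
  show "C1_on S (\<lambda>x. fderiv S (\<lambda>y. h (f y)) x v)" for v
    by (rule C1_on_cong[OF C1_on_compose_linear[OF assms(1) C2_onD(2)[OF assms(2), of v] assms(3)]])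
       (simp add: fderiv_compose_linear[OF assms(1) _ C1_onD(1)[OF C2_onD(1)[OF assms(2)]] assms(3)])
qed

lemma C1_on_has_derivative_interior:
  assumes "C1_on S f" "x \<in> interior S"
  shows "(f has_derivative fderiv S f x) (at x)"
  using C1_onD(1)[OF assms(1), of x] assms(2) interior_subset[of S] at_within_interior[OF assms(2)]
  by auto

text \<open>Schwarz's theorem up to the boundary. In the interior the derivative along
  \<open>v\<close> of the \<open>w\<close>-derivative is computed twice, by
  \<open>mixed_directional_derivative\<close> and by the chain rule; continuity covers boundary
  points.\<close>

lemma second_fderiv_symmetric_real:
  fixes f :: "real^'n \<Rightarrow> real"
  assumes S: "chart_domain S" and f: "C2_on S f" and "x \<in> S"
  shows "fderiv S (\<lambda>y. fderiv S f y v) x w = fderiv S (\<lambda>y. fderiv S f y w) x v"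
proof (rule eq_on_chart_domain[OF S _ _ _ \<open>x \<in> S\<close>])
  show "continuous_on S (\<lambda>x. fderiv S (\<lambda>y. fderiv S f y v) x w)"
    "continuous_on S (\<lambda>x. fderiv S (\<lambda>y. fderiv S f y w) x v)"
    by (rule C1_onD(2)[OF C2_onD(2)[OF f]])+
  fix x assume x: "x \<in> interior S"
  have "((\<lambda>t. fderiv S f (x + t *\<^sub>R v) w) has_real_derivative fderiv S (\<lambda>y. fderiv S f y v) x w) (at 0)"
  proof (rule mixed_directional_derivative[OF open_interior x])
    show "(f has_derivative fderiv S f y) (at y)" if "y \<in> interior S" for y
      by (rule C1_on_has_derivative_interior[OF C2_onD(1)[OF f] that])
    show "((\<lambda>z. fderiv S f z v) has_derivative fderiv S (\<lambda>y. fderiv S f y v) y) (at y)" if "y \<in> interior S" for y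
      by (rule C1_on_has_derivative_interior[OF C2_onD(2)[OF f] that])
    show "continuous_on (interior S) (\<lambda>y. fderiv S (\<lambda>y. fderiv S f y v) y w)"
      using C1_onD(2)[OF C2_onD(2)[OF f]] interior_subset by (rule continuous_on_subset)
  qed
  moreover have "((\<lambda>t. fderiv S f (x + t *\<^sub>R v) w) has_real_derivative fderiv S (\<lambda>y. fderiv S f y w) x v) (at 0)"
  proof -
    have d: "((\<lambda>z. fderiv S f z w) has_derivative fderiv S (\<lambda>y. fderiv S f y w) x) (at (x + 0 *\<^sub>R v))"
      using C1_on_has_derivative_interior[OF C2_onD(2)[OF f] x] by simp
    have "((\<lambda>t. fderiv S f (x + t *\<^sub>R v) w) has_derivative
        (\<lambda>t. fderiv S (\<lambda>y. fderiv S f y w) x (t *\<^sub>R v))) (at 0)"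
      by (rule has_derivative_compose[where f = "\<lambda>t. x + t *\<^sub>R v", OF _ d])
         (auto intro!: derivative_eq_intros)
    moreover have "fderiv S (\<lambda>y. fderiv S f y w) x (t *\<^sub>R v) = fderiv S (\<lambda>y. fderiv S f y w) x v * t" for t
      using has_derivative_linear[OF d] by (simp add: linear_scale)
    ultimately show ?thesis
      by (simp add: has_field_derivative_def)
  qed
  ultimately show "fderiv S (\<lambda>y. fderiv S f y v) x w = fderiv S (\<lambda>y. fderiv S f y w) x v"
    by (rule DERIV_unique)
qed

lemma second_fderiv_symmetric:
  fixes f :: "real^'n \<Rightarrow> 'b::euclidean_space"
  assumes S: "chart_domain S" and f: "C2_on S f" and "x \<in> S"
  shows "fderiv S (\<lambda>y. fderiv S f y v) x w = fderiv S (\<lambda>y. fderiv S f y w) x v"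
proof (rule euclidean_eqI)
  fix b :: 'b
  assume "b \<in> Basis"
  have lin: "bounded_linear (\<lambda>z. z \<bullet> b)"
    by (rule bounded_linear_inner_left)
  have *: "fderiv S (\<lambda>y. fderiv S f y v) x w \<bullet> b = fderiv S (\<lambda>y. fderiv S (\<lambda>z. f z \<bullet> b) y v) x w" for v w
  proof -
    have "((\<lambda>y. fderiv S (\<lambda>z. f z \<bullet> b) y v) has_derivative (\<lambda>w. fderiv S (\<lambda>y. fderiv S f y v) x w \<bullet> b)) (at x within S)"
      using bounded_linear.has_derivative[OF lin C1_onD(1)[OF C2_onD(2)[OF f] \<open>x \<in> S\<close>, of v]]
      by (rule has_derivative_transform[OF \<open>x \<in> S\<close>, rotated])
         (simp add: fderiv_compose_linear[OF S _ C1_onD(1)[OF C2_onD(1)[OF f]] lin])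
    from fderiv_eqI[OF S \<open>x \<in> S\<close> this] show ?thesis
      by simp
  qed
  show "fderiv S (\<lambda>y. fderiv S f y v) x w \<bullet> b = fderiv S (\<lambda>y. fderiv S f y w) x v \<bullet> b"
    unfolding * by (rule second_fderiv_symmetric_real[OF S C2_on_compose_linear[OF S f lin] \<open>x \<in> S\<close>])
qed

text \<open>The Lie bracket [X, Z] in coordinates. Derivatives are taken within \<open>S\<close>, so
  boundary points are included; for C1 fields it is in general only continuous.\<close>

definition bracket :: "(real^'n) set \<Rightarrow> (real^'n \<Rightarrow> real^'n) \<Rightarrow> (real^'n \<Rightarrow> real^'n) \<Rightarrow> real^'n \<Rightarrow> real^'n" where
  "bracket S X Z x = fderiv S Z x (X x) - fderiv S X x (Z x)"

lemma continuous_on_bracket: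
  assumes "C1_on S X" "C1_on S Z"
  shows "continuous_on S (bracket S X Z)"
  unfolding bracket_def[abs_def]
  by (intro continuous_on_diff continuous_on_fderiv_apply assms C1_onD(4)[OF assms(1)] C1_onD(4)[OF assms(2)])

section \<open>Metrics, Killing fields and their brackets in a single coordinate domain\<close>

locale metric_domain =
  fixes S :: "(real^'n) set" and g :: "real^'n \<Rightarrow> real^'n^'n"
  assumes S: "chart_domain S"
    and g_C2: "C2_on S g"
    and g_sym: "x \<in> S \<Longrightarrow> v \<bullet> (g x *v w) = w \<bullet> (g x *v v)"
    and g_pos: "x \<in> S \<Longrightarrow> v \<noteq> 0 \<Longrightarrow> 0 < v \<bullet> (g x *v v)"
begin

abbreviation g' :: "real^'n \<Rightarrow> real^'n \<Rightarrow> real^'n^'n" where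
  "g' \<equiv> fderiv S g"

text \<open>The expression is the Lie derivative of \<open>g\<close> along \<open>X\<close>, as a
  bilinear form in \<open>v\<close>, \<open>w\<close> instead of by components.\<close>

definition killing :: "(real^'n \<Rightarrow> real^'n) \<Rightarrow> bool" where
  "killing X \<longleftrightarrow> C1_on S X \<and>
     (\<forall>x\<in>S. \<forall>v w. v \<bullet> (g' x (X x) *v w) + fderiv S X x v \<bullet> (g x *v w) + v \<bullet> (g x *v fderiv S X x w) = 0)"

lemma killingD:
  assumes "killing X"
  shows "C1_on S X"
    and "x \<in> S \<Longrightarrow> v \<bullet> (g' x (X x) *v w) + fderiv S X x v \<bullet> (g x *v w) + v \<bullet> (g x *v fderiv S X x w) = 0"
  using assms by (auto simp: killing_def)

lemma metric_nonsingular: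
  assumes "x \<in> S" "g x *v v = 0"
  shows "v = 0"
  using g_pos[OF assms(1), of v] assms(2) by fastforce

text \<open>The derivative contains the bracket itself but none of its derivatives, and it is
  quadratic in \<open>a\<close>. Its two terms contribute the factors 1 and 1/2, for which 2 is a
  generous bound.\<close>

lemma bracket_line_equation:
  assumes X: "killing X" and Z: "killing Z" and x: "x \<in> interior S"
  obtains D where
    "((\<lambda>t. (g (x + t *\<^sub>R a) *v bracket S X Z (x + t *\<^sub>R a)) \<bullet> a) has_real_derivative D) (at 0)"
    "\<bar>D\<bar> \<le> 2 * (\<Sum>i\<in>UNIV. norm (g' x (axis i 1))) * (norm a)\<^sup>2 * norm (bracket S X Z x)"
proof -
  let ?Y = "bracket S X Z" and ?N = "\<Sum>i\<in>UNIV. norm (g' x (axis i 1))"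
  have xS: "x \<in> S"
    using x interior_subset by blast
  have "((\<lambda>t. (g (x + t *\<^sub>R a) *v ?Y (x + t *\<^sub>R a)) \<bullet> a) has_real_derivative
      a \<bullet> (g' x a *v ?Y x) - (a \<bullet> (g' x (?Y x) *v a)) / 2) (at 0)"
    unfolding bracket_def
  proof (rule killing_bracket_line_equation[OF open_interior x,
        where X' = "fderiv S X" and Z' = "fderiv S Z" and g'' = "\<lambda>y v w. fderiv S (\<lambda>z. g' z v) y w"])
    fix y assume y: "y \<in> interior S"
    then have yS: "y \<in> S"
      using interior_subset by blast
    show "(g has_derivative g' y) (at y)"
      by (rule C1_on_has_derivative_interior[OF C2_onD(1)[OF g_C2] y])
    show "((\<lambda>z. g' z v) has_derivative (\<lambda>w. fderiv S (\<lambda>z. g' z v) y w)) (at y)" for v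
      by (rule C1_on_has_derivative_interior[OF C2_onD(2)[OF g_C2] y])
    show "fderiv S (\<lambda>z. g' z v) y w = fderiv S (\<lambda>z. g' z w) y v" for v w
      by (rule second_fderiv_symmetric[OF S g_C2 yS])
    show "v \<bullet> (g y *v w) = w \<bullet> (g y *v v)" for v w
      by (rule g_sym[OF yS])
    show "(X has_derivative fderiv S X y) (at y)" "(Z has_derivative fderiv S Z y) (at y)"
      using C1_on_has_derivative_interior[OF killingD(1) y] X Z by auto
    show "v \<bullet> (g' y (X y) *v w) + fderiv S X y v \<bullet> (g y *v w) + v \<bullet> (g y *v fderiv S X y w) = 0"
      "v \<bullet> (g' y (Z y) *v w) + fderiv S Z y v \<bullet> (g y *v w) + v \<bullet> (g y *v fderiv S Z y w) = 0" for v w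
      using killingD(2)[OF X yS] killingD(2)[OF Z yS] by auto
  next
    show "continuous_on (interior S) (\<lambda>y. fderiv S (\<lambda>z. g' z v) y w)" for v w
      using C1_onD(2)[OF C2_onD(2)[OF g_C2]] interior_subset by (rule continuous_on_subset)
    show "continuous_on (interior S) (\<lambda>y. fderiv S X y w)" "continuous_on (interior S) (\<lambda>y. fderiv S Z y w)" for w
      using C1_onD(2)[OF killingD(1)[OF X]] C1_onD(2)[OF killingD(1)[OF Z]] interior_subset
      by (blast intro: continuous_on_subset)+
  qed
  moreover have "\<bar>a \<bullet> (g' x a *v ?Y x) - (a \<bullet> (g' x (?Y x) *v a)) / 2\<bar> \<le> 2 * ?N * (norm a)\<^sup>2 * norm (?Y x)"
  proof -
    have bound: "\<bar>a \<bullet> (g' x v *v w)\<bar> \<le> ?N * norm a * (norm v * norm w)" for v w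
    proof -
      have "\<bar>a \<bullet> (g' x v *v w)\<bar> \<le> norm a * norm (g' x v *v w)"
        by (rule Cauchy_Schwarz_ineq2)
      also have "\<dots> \<le> norm a * (norm (g' x v) * norm w)"
        by (intro mult_left_mono norm_matrix_vector_mult_le) auto
      also have "\<dots> \<le> norm a * ((?N * norm v) * norm w)"
        by (intro mult_left_mono mult_right_mono norm_linear_le_axis C1_onD(3)[OF C2_onD(1)[OF g_C2] xS]) auto
      finally show ?thesis
        by (simp add: mult_ac)
    qed
    have "\<bar>a \<bullet> (g' x a *v ?Y x)\<bar> \<le> ?N * (norm a)\<^sup>2 * norm (?Y x)"
      "\<bar>a \<bullet> (g' x (?Y x) *v a)\<bar> \<le> ?N * (norm a)\<^sup>2 * norm (?Y x)"
      using bound[of a "?Y x"] bound[of "?Y x" a] by (simp_all add: power2_eq_square mult_ac)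
    moreover have "0 \<le> ?N * (norm a)\<^sup>2 * norm (?Y x)"
      by (intro mult_nonneg_nonneg sum_nonneg) auto
    ultimately show ?thesis
      by linarith
  qed
  ultimately show thesis
    by (rule that)
qed

text \<open>\<open>m\<close> is the minimum of \<open>norm (g x *v v)\<close> over \<open>K\<close>
  times the unit sphere, positive because the metric is nonsingular; homogeneity extends the bound
  to all \<open>v\<close>. It allows \<open>Y\<close> to be estimated by the one-form
  \<open>g Y\<close>.\<close>

lemma metric_lower_bound_compact:
  assumes "compact K" "K \<subseteq> S"
  obtains m where "0 < m" "\<And>x v. x \<in> K \<Longrightarrow> m * norm v \<le> norm (g x *v v)"
proof (cases "K = {}")
  case True
  then show ?thesis
    using that[of 1] by simp
next
  case False
  let ?f = "\<lambda>p. norm (g (fst p) *v snd p)" and ?C = "K \<times> sphere (0 :: real^'n) 1"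
  have ne: "?C \<noteq> {}"
    using False by (metis SOME_Basis empty_iff ex_in_conv mem_sphere_0 norm_Basis Times_empty)
  have "continuous_on ?C ?f"
  proof (intro continuous_on_norm continuous_on_matrix_vector_mult)
    have "continuous_on K g"
      using C1_onD(4)[OF C2_onD(1)[OF g_C2]] assms(2) by (rule continuous_on_subset)
    then show "continuous_on ?C (\<lambda>p. g (fst p))"
      by (rule continuous_on_compose2[where g = g]) (auto intro: continuous_intros)
  qed (intro continuous_intros)
  from continuous_attains_inf[OF compact_Times[OF assms(1) compact_sphere] ne this]
  obtain p where p: "p \<in> ?C" "\<And>q. q \<in> ?C \<Longrightarrow> ?f p \<le> ?f q"
    by blast
  have "?f p > 0"
    using p(1) assms(2) metric_nonsingular[of "fst p" "snd p"] by auto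
  moreover have "?f p * norm v \<le> norm (g x *v v)" if "x \<in> K" for x v
  proof (cases "v = 0")
    case False
    then have "?f p \<le> ?f (x, (1 / norm v) *\<^sub>R v)"
      using that by (intro p(2)) auto
    also have "\<dots> = norm (g x *v v) / norm v"
      by (simp add: matrix_vector_mult_scaleR)
    finally show ?thesis
      using False by (simp add: pos_le_divide_eq)
  qed simp
  ultimately show ?thesis
    by (rule that)
qed

text \<open>The line equation controls the one-form \<open>g Y\<close>, so
  \<open>line_equation_unique_continuation\<close> is applied to that. Its constant
  \<open>2 * B / m\<close> combines the bound \<open>B\<close> on the derivatives of the metric with
  the passage from \<open>Y\<close> to \<open>g Y\<close>.\<close>

lemma bracket_unique_continuation:
  assumes X: "killing X" and Z: "killing Z"
    and K: "compact K" "convex K" "K \<subseteq> S"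
    and q: "0 < \<rho>" "cball q \<rho> \<subseteq> K" "\<And>x. x \<in> cball q \<rho> \<Longrightarrow> bracket S X Z x = 0"
    and x: "x \<in> K"
  shows "bracket S X Z x = 0"
proof -
  let ?Y = "bracket S X Z"
  let ?N = "\<lambda>x. \<Sum>i\<in>UNIV. norm (g' x (axis i 1))"
  obtain m where m: "0 < m" "\<And>x v. x \<in> K \<Longrightarrow> m * norm v \<le> norm (g x *v v)"
    using metric_lower_bound_compact[OF K(1,3)] by blast
  have "continuous_on K ?N"
    by (intro continuous_on_sum continuous_on_norm continuous_on_subset[OF C1_onD(2)[OF C2_onD(1)[OF g_C2]] K(3)])
  from compact_imp_bounded[OF compact_continuous_image[OF this K(1)]]
  obtain B where B0: "\<And>x. x \<in> K \<Longrightarrow> norm (?N x) \<le> B"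
    unfolding bounded_iff by blast
  have B: "?N x \<le> B" if "x \<in> K" for x
    using B0[OF that] unfolding real_norm_def by (rule abs_le_D1)
  have Y_cont: "continuous_on K ?Y"
    using continuous_on_bracket[OF killingD(1)[OF X] killingD(1)[OF Z]] K(3) by (rule continuous_on_subset)
  have g_cont: "continuous_on K g"
    using C1_onD(4)[OF C2_onD(1)[OF g_C2]] K(3) by (rule continuous_on_subset)
  have "g x *v ?Y x = 0"
  proof (rule line_equation_unique_continuation[OF K(1,2) _ _ q(1,2) _ x, where C = "2 * B / m"])
    show "continuous_on K (\<lambda>x. g x *v ?Y x)"
      by (intro continuous_on_matrix_vector_mult g_cont Y_cont)
    show "g y *v ?Y y = 0" if "y \<in> cball q \<rho>" for y
      using q(3)[OF that] by simp
  next
    fix y a assume y: "y \<in> interior K"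
    then have yK: "y \<in> K" and yS: "y \<in> interior S"
      using interior_subset interior_mono[OF K(3)] by blast+
    obtain D where D: "((\<lambda>t. (g (y + t *\<^sub>R a) *v ?Y (y + t *\<^sub>R a)) \<bullet> a) has_real_derivative D) (at 0)"
      "\<bar>D\<bar> \<le> 2 * ?N y * (norm a)\<^sup>2 * norm (?Y y)"
      using bracket_line_equation[OF X Z yS] by blast
    have "0 \<le> ?N y"
      by (intro sum_nonneg) auto
    have "\<bar>D\<bar> \<le> 2 * ?N y * (norm a)\<^sup>2 * norm (?Y y)"
      by (rule D(2))
    also have "\<dots> \<le> 2 * B * (norm a)\<^sup>2 * (norm (g y *v ?Y y) / m)"
      using m(2)[OF yK, of "?Y y"] m(1) B[OF yK] \<open>0 \<le> ?N y\<close>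
      by (intro mult_mono) (auto simp: field_simps)
    finally show "\<exists>D. ((\<lambda>t. (g (y + t *\<^sub>R a) *v ?Y (y + t *\<^sub>R a)) \<bullet> a) has_real_derivative D) (at 0) \<and>
        \<bar>D\<bar> \<le> 2 * B / m * (norm a)\<^sup>2 * norm (g y *v ?Y y)"
      using D(1) by (auto simp: mult_ac)
  qed
  then show ?thesis
    using metric_nonsingular x K(3) by blast
qed

end

lemma tendsto_matrix_vector_mult:
  fixes A :: "'a \<Rightarrow> real^'n^'m"
  assumes "(A \<longlongrightarrow> B) F" "(v \<longlongrightarrow> w) F"
  shows "((\<lambda>x. A x *v v x) \<longlongrightarrow> B *v w) F"
  using bounded_bilinear.tendsto[OF bounded_bilinear_matrix_vector_mult assms] .

text \<open>Each ray is treated separately, since the exterior of a ball is disconnected in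
  dimension one; the limit at infinity identifies the constants of all rays.\<close>

lemma constant_radial:
  fixes f :: "real^'n \<Rightarrow> real"
  assumes d: "\<And>x. norm x > R \<Longrightarrow> (f has_derivative (\<lambda>_. 0)) (at x)"
    and lim: "(f \<longlongrightarrow> l) at_infinity" and "0 \<le> R" "norm x > R"
  shows "f x = l"
proof -
  have x0: "norm x > 0"
    using assms(3,4) by linarith
  have "((\<lambda>t. f (t *\<^sub>R x)) has_derivative (\<lambda>_. 0)) (at t within {1..})" if "t \<in> {1..}" for t
  proof -
    have "1 * norm x \<le> t * norm x"
      using that by (intro mult_right_mono) auto
    then have R: "norm (t *\<^sub>R x) > R"
      using that assms(4) by simp
    show ?thesis
      by (rule has_derivative_compose[where f = "\<lambda>t. t *\<^sub>R x" and g = f and g' = "\<lambda>_. 0", OF _ d])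
         (use R in \<open>auto intro!: derivative_eq_intros\<close>)
  qed
  then obtain c where c: "\<And>t. t \<in> {1..} \<Longrightarrow> f (t *\<^sub>R x) = c"
    using has_derivative_zero_constant[of "{1..}" "\<lambda>t. f (t *\<^sub>R x)"] by auto
  have "filterlim (\<lambda>t. norm (t *\<^sub>R x)) at_top at_top"
  proof (rule filterlim_at_top_mono)
    show "filterlim (\<lambda>t. t * norm x) at_top at_top"
      using x0 by real_asymp
    show "\<forall>\<^sub>F t in at_top. t * norm x \<le> norm (t *\<^sub>R x)"
      by (intro always_eventually) (auto intro: mult_right_mono)
  qed
  then have "filterlim (\<lambda>t. t *\<^sub>R x) at_infinity at_top"
    by (rule filterlim_norm_at_top_imp_at_infinity)
  then have "((\<lambda>t. f (t *\<^sub>R x)) \<longlongrightarrow> l) at_top"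
    using lim filterlim_compose by blast
  moreover have "\<forall>\<^sub>F t in at_top. f (t *\<^sub>R x) = c"
    using eventually_ge_at_top[of 1] by eventually_elim (simp add: c)
  ultimately have "((\<lambda>_::real. c) \<longlongrightarrow> l) at_top"
    by (rule Lim_transform_eventually)
  then have "l = c"
    using tendsto_const_iff trivial_limit_at_top_linorder by metis
  then show ?thesis
    using c[of 1] by simp
qed

lemma span_rows_det_nonzero:
  fixes F :: "'n \<Rightarrow> real^'n"
  assumes "det (\<chi> i. F i) \<noteq> 0"
  shows "span (range F) = UNIV"
proof -
  have "invertible (\<chi> i. F i)"
    using assms by (simp add: invertible_det_nz)
  then have "\<exists>B. B ** (\<chi> i. F i) = mat 1"
    by (auto simp: invertible_def)
  then have "span (rows (\<chi> i. F i)) = UNIV"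
    by (simp add: matrix_left_invertible_span_rows)
  moreover have "rows (\<chi> i. F i) = range F"
    by (auto simp: rows_def row_def)
  ultimately show ?thesis
    by simp
qed

text \<open>With \<open>?M\<close> the matrix of rows \<open>F i\<close>, the hypothesis says that
  \<open>?M\<close>, \<open>A\<close> and the transpose of \<open>?M\<close> multiply to the
  identity, so the product of their determinants is 1.\<close>

lemma det_nonzero_orthonormal:
  fixes F :: "'n \<Rightarrow> real^'n" and A :: "real^'n^'n"
  assumes "\<And>i j. F i \<bullet> (A *v F j) = (if i = j then 1 else 0)"
  shows "det (\<chi> i. F i) \<noteq> 0"
proof -
  let ?M = "\<chi> i. F i"
  have "(?M ** (A ** transpose ?M)) $ i $ j = F i \<bullet> (A *v F j)" for i j
    by (simp add: matrix_matrix_mult_def transpose_def matrix_vector_mult_def inner_vec_def)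
  then have "?M ** (A ** transpose ?M) = mat 1"
    using assms by (simp add: vec_eq_iff mat_def)
  then have "det ?M * (det A * det (transpose ?M)) = 1"
    by (metis det_mul det_I)
  then show ?thesis
    by auto
qed

lemma tendsto_det:
  fixes A :: "'a \<Rightarrow> real^'n^'n"
  assumes "(A \<longlongrightarrow> B) F"
  shows "((\<lambda>x. det (A x)) \<longlongrightarrow> det B) F"
  unfolding det_def by (intro tendsto_intros assms)

lemma continuous_on_det:
  fixes A :: "'a::topological_space \<Rightarrow> real^'n^'n"
  assumes "continuous_on S A"
  shows "continuous_on S (\<lambda>x. det (A x))"
  unfolding det_def by (intro continuous_intros assms)

section \<open>Commuting Killing fields, and the vanishing of brackets near infinity\<close>

context metric_domain
begin

lemma g_has_derivative: "x \<in> S \<Longrightarrow> (g has_derivative g' x) (at x within S)"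
  by (rule C1_onD(1)[OF C2_onD(1)[OF g_C2]])

lemma g'_linear: "x \<in> S \<Longrightarrow> linear (g' x)"
  by (rule C1_onD(3)[OF C2_onD(1)[OF g_C2]])

lemma g'_sym:
  assumes "x \<in> S"
  shows "v \<bullet> (g' x u *v w) = w \<bullet> (g' x u *v v)"
proof -
  have d: "((\<lambda>y. v \<bullet> (g y *v w)) has_derivative (\<lambda>u. v \<bullet> (g' x u *v w))) (at x within S)" for v w
    by (auto intro!: derivative_eq_intros g_has_derivative assms)
  have "((\<lambda>y. v \<bullet> (g y *v w)) has_derivative (\<lambda>u. w \<bullet> (g' x u *v v))) (at x within S)"
    using d[of w v] by (rule has_derivative_transform[OF assms, rotated]) (rule g_sym)
  from fderiv_eqI[OF S assms this] fderiv_eqI[OF S assms d[of v w]]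
  show ?thesis
    by metis
qed

text \<open>
  Along \<open>W\<close> the product rule turns the derivative of \<open>g(X, Z)\<close> into Killing's equation for \<open>W\<close>,
  since \<open>D\<^sub>W X = D\<^sub>X W\<close> and \<open>D\<^sub>W Z = D\<^sub>Z W\<close>.
\<close>

lemma inner_derivative_along_commuting_killing:
  assumes W: "killing W" and X: "C1_on S X" and Z: "C1_on S Z" and "x \<in> S"
    and "bracket S W X x = 0" "bracket S W Z x = 0"
  shows "fderiv S (\<lambda>y. X y \<bullet> (g y *v Z y)) x (W x) = 0"
proof -
  have "((\<lambda>y. X y \<bullet> (g y *v Z y)) has_derivative
      (\<lambda>w. X x \<bullet> (g' x w *v Z x + g x *v fderiv S Z x w) + fderiv S X x w \<bullet> (g x *v Z x))) (at x within S)"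
    by (auto intro!: derivative_eq_intros g_has_derivative C1_onD(1)[OF X] C1_onD(1)[OF Z] assms(4)
        simp: add.commute)
  from fderiv_eqI[OF S \<open>x \<in> S\<close> this]
  show ?thesis
    using killingD(2)[OF W \<open>x \<in> S\<close>, of "X x" "Z x"] assms(5,6)
    by (simp add: bracket_def inner_add_right)
qed

text \<open>
  The left-hand side is \<open>g(\<nabla>\<^sub>u X\<^sub>k, v)\<close>. For \<open>u = X\<^sub>j\<close>, \<open>v = X\<^sub>l\<close> it is antisymmetric in \<open>j, l\<close>, as
  \<open>X\<^sub>k\<close> is Killing, and symmetric in \<open>j, k\<close>, as the fields commute; so it vanishes.
\<close>

lemma commuting_killing_frame_parallel:
  fixes X :: "'i \<Rightarrow> real^'n \<Rightarrow> real^'n"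
  assumes X: "\<And>i. killing (X i)" and x: "x \<in> S"
    and comm: "\<And>i j. bracket S (X i) (X j) x = 0"
    and frame: "span (range (\<lambda>i. X i x)) = UNIV"
  shows "v \<bullet> (g x *v fderiv S (X k) x u)
    + (v \<bullet> (g' x u *v X k x) + v \<bullet> (g' x (X k x) *v u) - u \<bullet> (g' x v *v X k x)) / 2 = 0"
proof -
  define N where "N k u v = v \<bullet> (g x *v fderiv S (X k) x u)
    + (v \<bullet> (g' x u *v X k x) + v \<bullet> (g' x (X k x) *v u) - u \<bullet> (g' x v *v X k x)) / 2" for k u v
  have antisym: "N k u v = - N k v u" for k u v
    using killingD(2)[OF X x, of v k u] g_sym[OF x, of "fderiv S (X k) x v" u]
      g'_sym[OF x, of v "X k x" u]
    by (simp add: N_def field_simps)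
  have sym: "N k (X j x) v = N j (X k x) v" for j k v
    using comm[of j k] g'_sym[OF x, of "X j x" v "X k x"]
    by (simp add: N_def bracket_def)
  \<comment> \<open>Writing \<open>N\<^sub>k(j, l)\<close> for the left-hand side, the two
    symmetries alternate: \<open>N\<^sub>k(j, l) = N\<^sub>j(k, l) = - N\<^sub>j(l, k) = -
    N\<^sub>l(j, k) = N\<^sub>l(k, j) = N\<^sub>k(l, j) = - N\<^sub>k(j, l)\<close>.\<close>
  have zero: "N k (X j x) (X l x) = 0" for j k l
    using sym[of k j "X l x"] sym[of k l "X j x"] sym[of j l "X k x"]
      antisym[of k "X j x" "X l x"] antisym[of l "X k x" "X j x"] antisym[of j "X l x" "X k x"]
    by linarith
  have L: "linear (fderiv S (X k) x)" for k
    by (rule C1_onD(3)[OF killingD(1)[OF X] x])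
  have expand: "g' x (u + w) = g' x u + g' x w" "g' x (c *\<^sub>R u) = c *\<^sub>R g' x u"
    "fderiv S (X k) x (u + w) = fderiv S (X k) x u + fderiv S (X k) x w"
    "fderiv S (X k) x (c *\<^sub>R u) = c *\<^sub>R fderiv S (X k) x u" for k u w c
    by (rule linear_add[OF g'_linear[OF x]] linear_scale[OF g'_linear[OF x]]
        linear_add[OF L] linear_scale[OF L])+
  have lin1: "linear (\<lambda>u. N k u v)" for k v
    by (rule linearI; simp add: N_def expand matrix_vector_right_distrib matrix_vector_mult_add_rdistrib
        inner_add_right inner_add_left scaleR_matrix_vector_assoc[symmetric] matrix_vector_mult_scaleR)
       (simp_all add: field_simps)
  have lin2: "linear (N k u)" for k u
  proof -
    have "N k u = (\<lambda>v. - N k v u)"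
      by (rule ext) (rule antisym)
    then show ?thesis
      using linear_compose_neg[OF lin1[of k u]] by simp
  qed
  have zero': "N k (X j x) v = 0" for j v
  proof (rule linear_eq_0_on_span[OF lin2, where b = "range (\<lambda>i. X i x)"])
    show "N k (X j x) w = 0" if "w \<in> range (\<lambda>i. X i x)" for w
      using that zero by blast
  qed (simp add: frame)
  have "N k u v = 0"
  proof (rule linear_eq_0_on_span[OF lin1, where b = "range (\<lambda>i. X i x)"])
    show "N k w v = 0" if "w \<in> range (\<lambda>i. X i x)" for w
      using that zero' by blast
  qed (simp add: frame)
  then show ?thesis
    by (simp add: N_def)
qed

text \<open>The bracket tends to zero because each of its terms applies derivatives tending to zero
  to a convergent field. \<open>line_equation_decay\<close> then makes the one-form
  \<open>g Y\<close> vanish, and \<open>lower\<close> passes to \<open>Y\<close>. The constant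
  \<open>4 * C\<close> collects the 2 of \<open>bracket_line_equation\<close> and the 2 of
  \<open>lower\<close>.\<close>

lemma bracket_vanishes_near_infinity:
  assumes X: "killing X" and Z: "killing Z" and "0 < \<beta>" and end_S: "\<And>x. norm x > R0 \<Longrightarrow> x \<in> S"
    and g_lim: "(g \<longlongrightarrow> mat 1) at_infinity"
    and g'_bound: "\<And>x. norm x > R0 \<Longrightarrow> (\<Sum>i\<in>UNIV. norm (g' x (axis i 1))) \<le> C * norm x powr (- \<beta> - 1)"
    and X_lim: "(X \<longlongrightarrow> a) at_infinity" "\<And>i. ((\<lambda>x. fderiv S X x (axis i 1)) \<longlongrightarrow> 0) at_infinity"
    and Z_lim: "(Z \<longlongrightarrow> b) at_infinity" "\<And>i. ((\<lambda>x. fderiv S Z x (axis i 1)) \<longlongrightarrow> 0) at_infinity"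
  obtains R where "R \<ge> R0" "\<And>x. norm x > R \<Longrightarrow> bracket S X Z x = 0"
proof -
  let ?Y = "bracket S X Z"
  have C0: "0 \<le> C * norm x powr (- \<beta> - 1)" if "norm x > R0" for x :: "real^'n"
    using g'_bound[OF that] sum_nonneg[of UNIV "\<lambda>i. norm (g' x (axis i 1))"] by simp
  have ev_S: "\<forall>\<^sub>F x in at_infinity. x \<in> S"
    unfolding eventually_at_infinity using end_S by (intro exI[of _ "R0 + 1"]) auto
  have fderiv_lim: "((\<lambda>x. fderiv S V x (W x)) \<longlongrightarrow> 0) at_infinity"
    if "C1_on S V" "(W \<longlongrightarrow> c) at_infinity" "\<And>i. ((\<lambda>x. fderiv S V x (axis i 1)) \<longlongrightarrow> 0) at_infinity" for V W c
  proof -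
    have "((\<lambda>x. \<Sum>i\<in>UNIV. W x $ i *\<^sub>R fderiv S V x (axis i 1)) \<longlongrightarrow> (\<Sum>i\<in>UNIV. c $ i *\<^sub>R 0)) at_infinity"
      by (intro tendsto_sum tendsto_scaleR tendsto_vec_nth that)
    moreover have "\<forall>\<^sub>F x in at_infinity. (\<Sum>i\<in>UNIV. W x $ i *\<^sub>R fderiv S V x (axis i 1)) = fderiv S V x (W x)"
      using ev_S
    proof eventually_elim
      case (elim x)
      show ?case
        by (rule linear_axis_expansion[OF C1_onD(3)[OF that(1) elim], symmetric])
    qed
    ultimately show ?thesis
      using Lim_transform_eventually by fastforce
  qed
  have "(?Y \<longlongrightarrow> 0 - 0) at_infinity"
    unfolding bracket_def[abs_def]
    using fderiv_lim[OF killingD(1)[OF Z] X_lim(1) Z_lim(2)] fderiv_lim[OF killingD(1)[OF X] Z_lim(1) X_lim(2)]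
    by (rule tendsto_diff)
  then have y_lim: "((\<lambda>x. g x *v ?Y x) \<longlongrightarrow> 0) at_infinity"
    using tendsto_matrix_vector_mult[OF g_lim, of ?Y 0] by simp
  have "\<forall>\<^sub>F x in at_infinity. dist (g x) (mat 1) < 1 / 2"
    using g_lim by (rule tendstoD) simp
  then obtain R1 where R1: "\<And>x. norm x \<ge> R1 \<Longrightarrow> norm (g x - mat 1) < 1 / 2"
    by (auto simp: eventually_at_infinity dist_norm)
  \<comment> \<open>Here \<open>g x\<close> is within \<open>1 / 2\<close> of the identity, so the
    perturbation term can be absorbed into the left-hand side.\<close>
  have lower: "norm v \<le> 2 * norm (g x *v v)" if "norm x \<ge> R1" for x v
  proof -
    have "norm v = norm (g x *v v - (g x - mat 1) *v v)"
      by (simp add: matrix_vector_mult_diff_rdistrib)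
    also have "\<dots> \<le> norm (g x *v v) + norm ((g x - mat 1) *v v)"
      by (rule norm_triangle_ineq4)
    also have "norm ((g x - mat 1) *v v) \<le> norm (g x - mat 1) * norm v"
      by (rule norm_matrix_vector_mult_le)
    also have "\<dots> \<le> 1 / 2 * norm v"
      using R1[OF that] by (intro mult_right_mono) auto
    finally show ?thesis
      by simp
  qed
  define R2 where "R2 = max 1 (max R0 R1)"
  have line: "\<exists>D. ((\<lambda>t. (g (x + t *\<^sub>R a) *v ?Y (x + t *\<^sub>R a)) \<bullet> a) has_real_derivative D) (at 0) \<and>
      \<bar>D\<bar> \<le> 4 * C * (norm a)\<^sup>2 * norm x powr (- \<beta> - 1) * norm (g x *v ?Y x)" if x: "norm x > R2" for x a
  proof -
    have R: "norm x > R0" "norm x \<ge> R1"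
      using x by (auto simp: R2_def)
    have "x \<in> interior S"
    proof (rule interiorI[of "- cball 0 R0"])
      show "open (- cball (0 :: real^'n) R0)"
        by (simp add: open_Compl)
      show "x \<in> - cball 0 R0" "- cball 0 R0 \<subseteq> S"
        using R(1) end_S by auto
    qed
    from bracket_line_equation[OF X Z this]
    obtain D where D: "((\<lambda>t. (g (x + t *\<^sub>R a) *v ?Y (x + t *\<^sub>R a)) \<bullet> a) has_real_derivative D) (at 0)"
      "\<bar>D\<bar> \<le> 2 * (\<Sum>i\<in>UNIV. norm (g' x (axis i 1))) * (norm a)\<^sup>2 * norm (?Y x)"
      by blast
    note D(2)
    also have "2 * (\<Sum>i\<in>UNIV. norm (g' x (axis i 1))) * (norm a)\<^sup>2 * norm (?Y x)
        \<le> 2 * (C * norm x powr (- \<beta> - 1)) * (norm a)\<^sup>2 * (2 * norm (g x *v ?Y x))"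
      using C0[OF R(1)] by (intro mult_mono g'_bound[OF R(1)] lower[OF R(2)]) (auto intro!: mult_nonneg_nonneg sum_nonneg)
    finally show ?thesis
      using D(1) by (auto simp: mult_ac)
  qed
  have "0 < R2"
    by (simp add: R2_def)
  from line_equation_decay[OF \<open>0 < \<beta>\<close> this line y_lim]
  obtain R where R: "R \<ge> R2" "\<And>x. norm x > R \<Longrightarrow> g x *v ?Y x = 0"
    by blast
  show thesis
  proof (rule that[of R])
    show "R \<ge> R0"
      using R(1) by (simp add: R2_def)
    show "?Y x = 0" if "norm x > R" for x
      using lower[of x "?Y x"] R that by (simp add: R2_def)
  qed
qed

end

section \<open>Tensor fields in charts\<close>

lemma partial_component:
  fixes F :: "real^'n \<Rightarrow> real^'m"
  assumes "chart_domain S" "x \<in> S" "C1_on S F"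
  shows "partial S i (\<lambda>y. F y $ k) x = fderiv S F x (axis i 1) $ k"
  unfolding partial_def by (rule fderiv_component[OF assms(1,2) C1_onD(1)[OF assms(3,2)]])

lemma partial_matrix_component:
  fixes F :: "real^'n \<Rightarrow> real^'m^'k"
  assumes "chart_domain S" "x \<in> S" "C1_on S F"
  shows "partial S i (\<lambda>y. F y $ k $ l) x = fderiv S F x (axis i 1) $ k $ l"
proof -
  have "(F has_derivative fderiv S F x) (at x within S)"
    by (rule C1_onD(1)[OF assms(3,2)])
  from bounded_linear.has_derivative[OF bounded_linear_vec_nth this]
  have "((\<lambda>y. F y $ k) has_derivative (\<lambda>v. fderiv S F x v $ k)) (at x within S)" .
  from fderiv_component[OF assms(1,2) this] show ?thesis
    by (simp add: partial_def)
qed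

lemma linear_matrix_component_sum:
  fixes F :: "real^'n \<Rightarrow> real^'m^'k"
  assumes "linear F"
  shows "F v $ k $ l = (\<Sum>i\<in>UNIV. v $ i * F (axis i 1) $ k $ l)"
  by (subst linear_axis_expansion[OF assms]) simp

lemma matrix_vector_mult_axis: "(B *v axis j 1) $ i = B $ i $ j"
  for B :: "real^'n^'m"
  by (simp add: matrix_vector_mult_def axis_def if_distrib cong: if_cong)

lemma chart_domain_coord_image:
  assumes "is_chart M c"
  shows "chart_domain (coord_image c)"
  using assms by (simp add: is_chart_def chart_domain_def)

locale riemannian_manifold =
  fixes M :: "'a topology" and A :: "('a, 'n::finite) chart set" and g :: "('a, 'n) metric"
  assumes manifold: "manifold_with_boundary M A" and metric: "C2_riemannian_metric A g"
begin

lemma chart: "c \<in> A \<Longrightarrow> is_chart M c"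
  using manifold by (simp add: manifold_with_boundary_def)

lemma chart_openin: "c \<in> A \<Longrightarrow> openin M (fst c)"
  using chart by (simp add: is_chart_def)

lemma coord_domain: "c \<in> A \<Longrightarrow> chart_domain (coord_image c)"
  by (rule chart_domain_coord_image[OF chart])

lemma topspace_chart: "c \<in> A \<Longrightarrow> topspace (subtopology M (fst c)) = fst c"
  using openin_subset[OF chart_openin[of c]] by auto

lemma chart_homeomorphic:
  "c \<in> A \<Longrightarrow> homeomorphic_map (subtopology M (fst c)) (top_of_set (coord_image c)) (snd c)"
  using chart by (simp add: is_chart_def)

lemma chart_inj: "c \<in> A \<Longrightarrow> inj_on (snd c) (fst c)"
  using homeomorphic_imp_injective_map[OF chart_homeomorphic] topspace_chart by metis

lemma chart_image_openin:
  assumes "c \<in> A" "openin M V" "V \<subseteq> fst c"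
  shows "openin (top_of_set (coord_image c)) (snd c ` V)"
proof -
  have "openin (subtopology M (fst c)) V"
    using assms by (simp add: openin_subset_topspace_eq openin_open_subtopology chart_openin)
  then show ?thesis
    using homeomorphic_imp_open_map[OF chart_homeomorphic[OF assms(1)]] by (simp add: open_map_def)
qed

lemma chart_preimage_openin:
  assumes "c \<in> A" "openin (top_of_set (coord_image c)) N"
  shows "openin M {p \<in> fst c. snd c p \<in> N}"
proof -
  have "continuous_map (subtopology M (fst c)) (top_of_set (coord_image c)) (snd c)"
    by (rule homeomorphic_imp_continuous_map[OF chart_homeomorphic[OF assms(1)]])
  from openin_continuous_map_preimage[OF this assms(2)] show ?thesis
    unfolding topspace_chart[OF assms(1)] openin_open_subtopology[OF chart_openin[OF assms(1)]] by simp
qed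

lemma overlap_openin:
  assumes "c \<in> A" "d \<in> A"
  shows "openin (top_of_set (coord_image c)) (overlap c d)"
  unfolding overlap_def
  by (rule chart_image_openin[OF assms(1)]) (auto intro: chart_openin assms)

lemma overlap_domain: "c \<in> A \<Longrightarrow> d \<in> A \<Longrightarrow> chart_domain (overlap c d)"
  by (rule chart_domain_openin[OF coord_domain overlap_openin])

lemma overlap_subset: "overlap c d \<subseteq> coord_image c"
  by (auto simp: overlap_def coord_image_def)

lemma transition_apply:
  assumes "c \<in> A" "p \<in> fst c"
  shows "transition c d (snd c p) = snd d p"
  using inv_into_f_f[OF chart_inj[OF assms(1)] assms(2)] by (simp add: transition_def)

lemma transition_in_coord_image:
  assumes "c \<in> A" "x \<in> overlap c d"
  shows "transition c d x \<in> coord_image d"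
proof -
  obtain p where "p \<in> fst c" "p \<in> fst d" "x = snd c p"
    using assms(2) by (auto simp: overlap_def)
  then show ?thesis
    using transition_apply[OF assms(1), of p d] by (simp add: coord_image_def)
qed

lemma transition_C2:
  assumes "c \<in> A" "d \<in> A"
  shows "C2_on (overlap c d) (transition c d)"
proof (rule C2_on_vec[OF overlap_domain[OF assms]])
  fix k
  have "Ck_on (Suc (Suc 1)) (overlap c d) (\<lambda>x. transition c d x $ k)"
    using manifold assms unfolding manifold_with_boundary_def by (simp add: numeral_3_eq_3)
  then show "C2_on (overlap c d) (\<lambda>x. transition c d x $ k)"
    by (rule Ck_on_2[OF overlap_domain[OF assms]])
qed

lemma jacobian_fderiv:
  assumes "c \<in> A" "d \<in> A" "x \<in> overlap c d"
  shows "jacobian c d x *v v = fderiv (overlap c d) (transition c d) x v"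
proof -
  note C1 = C2_onD(1)[OF transition_C2[OF assms(1,2)]]
  have "(jacobian c d x *v v) $ k = fderiv (overlap c d) (transition c d) x v $ k" for k
    unfolding linear_axis_expansion[OF C1_onD(3)[OF C1 assms(3)], of v]
    by (simp add: jacobian_def matrix_vector_mult_def
        partial_component[OF overlap_domain[OF assms(1,2)] assms(3) C1] mult.commute)
  then show ?thesis
    by (simp add: vec_eq_iff)
qed

lemma metric_C2:
  assumes "c \<in> A"
  shows "C2_on (coord_image c) (g c)"
proof (intro C2_on_vec coord_domain assms)
  fix i j
  have "Ck_on (Suc (Suc 0)) (coord_image c) (\<lambda>x. g c x $ i $ j)"
    using metric assms unfolding C2_riemannian_metric_def by (simp add: numeral_2_eq_2)
  then show "C2_on (coord_image c) (\<lambda>x. g c x $ i $ j)"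
    by (rule Ck_on_2[OF coord_domain[OF assms]])
qed

lemma metric_domain:
  assumes "c \<in> A"
  shows "metric_domain (coord_image c) (g c)"
proof
  show "chart_domain (coord_image c)"
    by (rule coord_domain[OF assms])
  show "C2_on (coord_image c) (g c)"
    by (rule metric_C2[OF assms])
  fix x assume x: "x \<in> coord_image c"
  have "transpose (g c x) = g c x"
    using metric assms x by (auto simp: C2_riemannian_metric_def transpose_def vec_eq_iff)
  then show "v \<bullet> (g c x *v w) = w \<bullet> (g c x *v v)" for v w
    by (metis dot_lmul_matrix inner_commute vector_transpose_matrix)
  show "0 < v \<bullet> (g c x *v v)" if "v \<noteq> 0" for v
    using metric assms x that by (auto simp: C2_riemannian_metric_def)
qed

lemma vector_field_C1:
  assumes "C1_vector_field A X" "c \<in> A"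
  shows "C1_on (coord_image c) (X c)"
  using assms by (intro C1_on_vec coord_domain Ck_on_1) (auto simp: C1_vector_field_def)

text \<open>The form \<open>B\<close> is bilinear, so it suffices to test pairs of axis vectors,
  where it is the component \<open>lie_metric g X c i j\<close>.\<close>

lemma killing_field_local:
  assumes X: "killing_field A g X" and c: "c \<in> A"
  shows "metric_domain.killing (coord_image c) (g c) (X c)"
proof -
  let ?S = "coord_image c"
  interpret metric_domain ?S "g c"
    by (rule metric_domain[OF c])
  have X1: "C1_on ?S (X c)"
    using X c by (intro vector_field_C1) (auto simp: killing_field_def)
  have "v \<bullet> (g' x (X c x) *v w) + fderiv ?S (X c) x v \<bullet> (g c x *v w) + v \<bullet> (g c x *v fderiv ?S (X c) x w) = 0"
    if x: "x \<in> ?S" for x v w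
  proof -
    define B where "B v w = v \<bullet> (g' x (X c x) *v w) + fderiv ?S (X c) x v \<bullet> (g c x *v w)
      + v \<bullet> (g c x *v fderiv ?S (X c) x w)" for v w
    have L: "linear (fderiv ?S (X c) x)"
      by (rule C1_onD(3)[OF X1 x])
    have B1: "linear (\<lambda>v. B v w)" and B2: "linear (B v)" for v w
      unfolding B_def
      by (rule linearI; simp add: linear_add[OF L] linear_scale[OF L] inner_add_left inner_add_right
          matrix_vector_right_distrib matrix_vector_mult_scaleR; simp add: algebra_simps)+
    have "B (axis i 1) (axis j 1) = 0" for i j
    proof -
      have "lie_metric g X c i j x = 0"
        using X c x by (simp add: killing_field_def)
      moreover have "axis i 1 \<bullet> (g' x (X c x) *v axis j 1) = (\<Sum>k\<in>UNIV. X c x $ k * g' x (axis k 1) $ i $ j)"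
        by (simp add: inner_axis' matrix_vector_mult_axis linear_matrix_component_sum[OF g'_linear[OF x], of "X c x"])
      moreover have "fderiv ?S (X c) x (axis i 1) \<bullet> (g c x *v axis j 1)
          = (\<Sum>k\<in>UNIV. g c x $ k $ j * fderiv ?S (X c) x (axis i 1) $ k)"
        by (simp add: inner_vec_def matrix_vector_mult_axis mult.commute)
      moreover have "axis i 1 \<bullet> (g c x *v w) = (\<Sum>k\<in>UNIV. g c x $ i $ k * w $ k)" for w
        by (simp add: inner_axis' matrix_vector_mult_def)
      moreover have "lie_metric g X c i j x = (\<Sum>k\<in>UNIV. X c x $ k * g' x (axis k 1) $ i $ j)
          + (\<Sum>k\<in>UNIV. g c x $ k $ j * fderiv ?S (X c) x (axis i 1) $ k)
          + (\<Sum>k\<in>UNIV. g c x $ i $ k * fderiv ?S (X c) x (axis j 1) $ k)"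
        unfolding lie_metric_def Let_def
          partial_component[OF S x X1] partial_matrix_component[OF S x C2_onD(1)[OF g_C2]]
        by (simp add: sum.distrib)
      ultimately show ?thesis
        by (simp add: B_def)
    qed
    then have "B (axis i 1) w = 0" for i w
      using linear_axis_expansion[OF B2[of "axis i 1"], of w] by simp
    then have "B v w = 0"
      using linear_axis_expansion[OF B1[of w], of v] by simp
    then show ?thesis
      by (simp add: B_def)
  qed
  with X1 show ?thesis
    by (simp add: killing_def)
qed

text \<open>
  The Hessian of the transition map enters the transformed derivatives of both fields and cancels
  in the bracket by symmetry.
\<close>

lemma bracket_transition:
  assumes c: "c \<in> A" and d: "d \<in> A" and x: "x \<in> overlap c d"
    and X: "C1_vector_field A X" and Z: "C1_vector_field A Z"
  shows "bracket (coord_image d) (X d) (Z d) (transition c d x)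
    = jacobian c d x *v bracket (coord_image c) (X c) (Z c) x"
proof -
  let ?O = "overlap c d" and ?\<tau> = "transition c d"
  define T where "T = fderiv ?O ?\<tau>"
  define H where "H w = fderiv ?O (\<lambda>y. T y w) x" for w
  note dom = overlap_domain[OF c d]
  note \<tau>2 = transition_C2[OF c d]
  have xc: "x \<in> coord_image c"
    using x overlap_subset by blast
  have T_apply: "fderiv ?O ?\<tau> y = T y" for y
    by (simp add: T_def)
  have H_lin: "linear (H w)" for w
    unfolding H_def T_def by (rule C1_onD(3)[OF C2_onD(2)[OF \<tau>2] x])
  have H_sym: "H v w = H w v" for v w
    unfolding H_def T_def by (rule second_fderiv_symmetric[OF dom \<tau>2 x])
  have T_lin: "linear (T y)" if "y \<in> ?O" for y
    unfolding T_def by (rule C1_onD(3)[OF C2_onD(1)[OF \<tau>2] that])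
  have law: "V d (?\<tau> y) = T y (V c y)" if "C1_vector_field A V" "y \<in> ?O" for V y
    using that c d jacobian_fderiv[OF c d that(2)] by (simp add: C1_vector_field_def T_def)
  \<comment> \<open>The transformation law \<open>V d (?\<tau> y) = T y (V c y)\<close> is
    differentiated at \<open>x\<close> in two ways, by the chain rule and by the product rule;
    \<open>H\<close> is the Hessian of the transition map.\<close>
  have deriv: "fderiv (coord_image d) (V d) (?\<tau> x) (T x w) = H w (V c x) + T x (fderiv (coord_image c) (V c) x w)"
    if V: "C1_vector_field A V" for V w
  proof -
    have "(V d has_derivative fderiv (coord_image d) (V d) (?\<tau> x)) (at (?\<tau> x) within ?\<tau> ` ?O)"
      using C1_onD(1)[OF vector_field_C1[OF V d] transition_in_coord_image[OF c x]]
      by (rule has_derivative_subset) (intro image_subsetI transition_in_coord_image[OF c])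
    moreover have "(?\<tau> has_derivative T x) (at x within ?O)"
      unfolding T_def by (rule C1_onD(1)[OF C2_onD(1)[OF \<tau>2] x])
    ultimately have 1: "((\<lambda>y. V d (?\<tau> y)) has_derivative
        (\<lambda>w. fderiv (coord_image d) (V d) (?\<tau> x) (T x w))) (at x within ?O)"
      using has_derivative_in_compose by blast
    have Vc: "(V c has_derivative fderiv (coord_image c) (V c) x) (at x within ?O)"
      using C1_onD(1)[OF vector_field_C1[OF V c] xc] at_within_openin[OF overlap_openin[OF c d] x] by simp
    have "((\<lambda>y. T y v) has_derivative H v) (at x within ?O)" for v
      unfolding H_def T_def by (rule C1_onD(1)[OF C2_onD(2)[OF \<tau>2] x])
    from has_derivative_linear_family_within[OF x T_lin this Vc]
    have "((\<lambda>y. T y (V c y)) has_derivative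
        (\<lambda>w. (\<Sum>i\<in>Basis. (V c x \<bullet> i) *\<^sub>R H i w) + T x (fderiv (coord_image c) (V c) x w))) (at x within ?O)" .
    moreover have "(\<Sum>i\<in>Basis. (V c x \<bullet> i) *\<^sub>R H i w) = H w (V c x)" for w
    proof -
      have "H w (\<Sum>i\<in>Basis. (V c x \<bullet> i) *\<^sub>R i) = (\<Sum>i\<in>Basis. (V c x \<bullet> i) *\<^sub>R H w i)"
        using H_lin by (simp add: linear_sum linear_scale)
      then show ?thesis
        by (simp add: euclidean_representation H_sym[of _ w])
    qed
    ultimately have "((\<lambda>y. T y (V c y)) has_derivative
        (\<lambda>w. H w (V c x) + T x (fderiv (coord_image c) (V c) x w))) (at x within ?O)"
      by simp
    then have 2: "((\<lambda>y. V d (?\<tau> y)) has_derivative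
        (\<lambda>w. H w (V c x) + T x (fderiv (coord_image c) (V c) x w))) (at x within ?O)"
      by (rule has_derivative_transform[OF x, rotated]) (rule law[OF V])
    show ?thesis
      using fun_cong[OF trans[OF fderiv_eqI[OF dom x 1, symmetric] fderiv_eqI[OF dom x 2]]] .
  qed
  show ?thesis
    unfolding jacobian_fderiv[OF c d x] T_apply bracket_def law[OF X x] law[OF Z x] deriv[OF X] deriv[OF Z]
    using H_sym[of "X c x" "Z c x"] by (simp add: linear_diff[OF T_lin[OF x]])
qed

text \<open>In matrix form the law for the metric is
  \<open>g c x = transpose ?J ** ?h ** ?J\<close>; the outer factors are absorbed by the Jacobians
  that transform the two fields.\<close>

lemma metric_transition:
  assumes c: "c \<in> A" and d: "d \<in> A" and x: "x \<in> overlap c d"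
    and X: "C1_vector_field A X" and Z: "C1_vector_field A Z"
  shows "X d (transition c d x) \<bullet> (g d (transition c d x) *v Z d (transition c d x)) = X c x \<bullet> (g c x *v Z c x)"
proof -
  let ?J = "jacobian c d x" and ?h = "g d (transition c d x)"
  have "g c x = transpose ?J ** ?h ** ?J"
  proof -
    have "g c x $ i $ j = (transpose ?J ** (?h ** ?J)) $ i $ j" for i j
    proof -
      have "g c x $ i $ j = (\<Sum>k\<in>UNIV. \<Sum>l\<in>UNIV. ?J $ k $ i * ?J $ l $ j * ?h $ k $ l)"
        using metric c d x unfolding C2_riemannian_metric_def by blast
      then show ?thesis
        by (simp add: matrix_matrix_mult_def transpose_def sum_distrib_left mult_ac)
    qed
    then show ?thesis
      by (simp add: vec_eq_iff matrix_mul_assoc)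
  qed
  moreover have adjoint: "(?J *v v) \<bullet> w = v \<bullet> (transpose ?J *v w)" for v w
    by (metis dot_lmul_matrix vector_transpose_matrix)
  moreover have "X d (transition c d x) = ?J *v X c x" "Z d (transition c d x) = ?J *v Z c x"
    using X Z c d x by (simp_all add: C1_vector_field_def)
  ultimately show ?thesis
    by (simp add: adjoint matrix_vector_mul_assoc[symmetric] del: vector_transpose_matrix)
qed

text \<open>A continuation principle on a connected manifold. The points near which \<open>Q\<close>
  holds in every chart form an open set by construction; \<open>local\<close> lets \<open>Q\<close>
  spread from any nonempty relatively open part of a suitable neighbourhood to all of it, which
  makes the complement open as well.\<close>

lemma chart_propagation:
  assumes conn: "connected_space M"
    and inv: "\<And>c d x. c \<in> A \<Longrightarrow> d \<in> A \<Longrightarrow> x \<in> overlap c d \<Longrightarrow> Q c x \<Longrightarrow> Q d (transition c d x)"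
    and local: "\<And>c x. c \<in> A \<Longrightarrow> x \<in> coord_image c \<Longrightarrow>
      \<exists>N. openin (top_of_set (coord_image c)) N \<and> x \<in> N \<and>
        (\<forall>U. openin (top_of_set (coord_image c)) U \<longrightarrow> U \<noteq> {} \<longrightarrow> U \<subseteq> N \<longrightarrow> (\<forall>y\<in>U. Q c y) \<longrightarrow> (\<forall>y\<in>N. Q c y))"
    and start: "e \<in> A" "openin (top_of_set (coord_image e)) W" "W \<noteq> {}" "\<And>y. y \<in> W \<Longrightarrow> Q e y"
    and c: "c \<in> A" and x: "x \<in> coord_image c"
  shows "Q c x"
proof -
  \<comment> \<open>Demanding \<open>Q\<close> in all charts at once makes goodness a property of
    subsets of \<open>M\<close>; \<open>inv\<close> supplies the other charts once \<open>Q\<close>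
    is known in one.\<close>
  define good where "good V \<longleftrightarrow> openin M V \<and> (\<forall>c\<in>A. \<forall>q\<in>V \<inter> fst c. Q c (snd c q))" for V
  define Z where "Z = {p. \<exists>V. good V \<and> p \<in> V}"
  have good_preimage: "good {p \<in> fst c. snd c p \<in> N}"
    if c: "c \<in> A" and N: "openin (top_of_set (coord_image c)) N" "\<And>y. y \<in> N \<Longrightarrow> Q c y" for c N
    unfolding good_def
  proof (intro conjI ballI)
    show "openin M {p \<in> fst c. snd c p \<in> N}"
      by (rule chart_preimage_openin[OF c N(1)])
    fix d q assume d: "d \<in> A" and q: "q \<in> {p \<in> fst c. snd c p \<in> N} \<inter> fst d"
    then have "snd c q \<in> overlap c d" "Q c (snd c q)"
      using N(2) by (auto simp: overlap_def)
    from inv[OF c d this] show "Q d (snd d q)"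
      using transition_apply[OF c] q by auto
  qed
  have Z_sub: "Z \<subseteq> topspace M"
    unfolding Z_def good_def using openin_subset by blast
  have Z_open: "openin M Z"
    by (subst openin_subopen) (auto simp: Z_def good_def)
  have "openin M (topspace M - Z)"
  proof (subst openin_subopen, intro ballI)
    fix p assume p: "p \<in> topspace M - Z"
    then obtain c where c: "c \<in> A" "p \<in> fst c"
      using manifold unfolding manifold_with_boundary_def by blast
    then obtain N where N: "openin (top_of_set (coord_image c)) N" "snd c p \<in> N"
      and spread: "\<And>U. openin (top_of_set (coord_image c)) U \<Longrightarrow> U \<noteq> {} \<Longrightarrow> U \<subseteq> N \<Longrightarrow>
        (\<forall>y\<in>U. Q c y) \<Longrightarrow> (\<forall>y\<in>N. Q c y)"
      using local[of c "snd c p"] by (auto simp: coord_image_def)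
    define V where "V = {p \<in> fst c. snd c p \<in> N}"
    have V: "openin M V" "p \<in> V"
      using chart_preimage_openin[OF c(1) N(1)] c N by (auto simp: V_def)
    \<comment> \<open>If \<open>V\<close> met a good set \<open>V'\<close>, then
      \<open>V \<inter> V'\<close> would be a seed from which \<open>Q\<close> spreads over
      \<open>N\<close>, making \<open>V\<close> good and placing \<open>p\<close> in
      \<open>Z\<close>.\<close>
    have "V \<inter> Z = {}"
    proof (rule ccontr)
      assume "V \<inter> Z \<noteq> {}"
      then obtain r V' where r: "r \<in> V" "r \<in> V'" "good V'"
        by (auto simp: Z_def)
      have "\<forall>y\<in>N. Q c y"
      proof (rule spread)
        show "openin (top_of_set (coord_image c)) (snd c ` (V \<inter> V'))"
          using V r by (intro chart_image_openin c openin_Int) (auto simp: V_def good_def)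
        show "snd c ` (V \<inter> V') \<noteq> {}" "snd c ` (V \<inter> V') \<subseteq> N"
          using r by (auto simp: V_def)
        show "\<forall>y\<in>snd c ` (V \<inter> V'). Q c y"
          using r c by (auto simp: V_def good_def)
      qed
      then have "good V"
        unfolding V_def using good_preimage[OF c(1) N(1)] by blast
      then show False
        using p V by (auto simp: Z_def)
    qed
    moreover have "V \<subseteq> topspace M"
      using V openin_subset by blast
    ultimately show "\<exists>T. openin M T \<and> p \<in> T \<and> T \<subseteq> topspace M - Z"
      using V by blast
  qed
  then have "closedin M Z"
    using Z_sub by (simp add: closedin_def)
  moreover have "Z \<noteq> {}"
  proof -
    obtain y where "y \<in> W"
      using start(3) by blast
    moreover have "W \<subseteq> coord_image e"
      using start(2) openin_subset by fastforce
    ultimately obtain p where "p \<in> fst e" "snd e p \<in> W"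
      by (auto simp: coord_image_def)
    then show ?thesis
      using good_preimage[OF start(1,2,4)] by (auto simp: Z_def)
  qed
  ultimately have "Z = topspace M"
    using conn Z_open unfolding connected_space_clopen_in by blast
  moreover obtain p where p: "p \<in> fst c" "x = snd c p"
    using x by (auto simp: coord_image_def)
  moreover have "fst c \<subseteq> topspace M"
    using chart_openin[OF c] openin_subset by blast
  ultimately obtain V where "good V" "p \<in> V"
    by (auto simp: Z_def)
  then show ?thesis
    using p c by (auto simp: good_def)
qed

end

section \<open>Killing fields asymptotic to translations\<close>

lemma O2_bounds:
  fixes u :: "real^'n \<Rightarrow> real"
  assumes "O2 \<beta> u"
  shows "\<exists>C. \<forall>x. norm x > 1 \<longrightarrow> \<bar>u x\<bar> \<le> C * norm x powr (- \<beta>) \<and>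
    (\<forall>i. \<bar>partial (- cball 0 1) i u x\<bar> \<le> C * norm x powr (- \<beta> - 1))"
proof -
  let ?S = "- cball 0 1 :: (real^'n) set"
  obtain C where C: "\<And>x. x \<in> ?S \<Longrightarrow> \<bar>norm x powr \<beta> * u x\<bar>
         + (\<Sum>i\<in>UNIV. \<bar>norm x powr (\<beta> + 1) * partial ?S i u x\<bar>)
         + (\<Sum>i\<in>UNIV. \<Sum>j\<in>UNIV. \<bar>norm x powr (\<beta> + 2) * partial ?S i (partial ?S j u) x\<bar>) \<le> C"
    using assms unfolding O2_def Let_def by blast
  have scale: "\<bar>b\<bar> \<le> C * r powr (- s)" if "r > 1" "\<bar>r powr s * b\<bar> \<le> C" for b r s :: real
    using that by (simp add: powr_minus abs_mult field_simps)
  show ?thesis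
  proof (intro exI[of _ C] allI impI conjI)
    fix x :: "real^'n" assume x: "norm x > 1"
    then have xS: "x \<in> ?S"
      by simp
    have nonneg: "0 \<le> (\<Sum>i\<in>UNIV. \<bar>norm x powr (\<beta> + 1) * partial ?S i u x\<bar>)"
      "0 \<le> (\<Sum>i\<in>UNIV. \<Sum>j\<in>UNIV. \<bar>norm x powr (\<beta> + 2) * partial ?S i (partial ?S j u) x\<bar>)"
      by (intro sum_nonneg abs_ge_zero)+
    have "\<bar>norm x powr \<beta> * u x\<bar> \<le> C"
      using C[OF xS] nonneg by linarith
    then show "\<bar>u x\<bar> \<le> C * norm x powr (- \<beta>)"
      by (rule scale[OF x])
    fix i
    have "\<bar>norm x powr (\<beta> + 1) * partial ?S i u x\<bar> \<le> (\<Sum>i\<in>UNIV. \<bar>norm x powr (\<beta> + 1) * partial ?S i u x\<bar>)"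
      by (rule member_le_sum) auto
    then have "\<bar>norm x powr (\<beta> + 1) * partial ?S i u x\<bar> \<le> C"
      using C[OF xS] nonneg abs_ge_zero[of "norm x powr \<beta> * u x"] by linarith
    from scale[OF x this] show "\<bar>partial ?S i u x\<bar> \<le> C * norm x powr (- \<beta> - 1)"
      by simp
  qed
qed

lemma tendsto_zero_powr_bound:
  fixes f :: "real^'n \<Rightarrow> real"
  assumes "s > 0" "\<And>x. norm x > 1 \<Longrightarrow> \<bar>f x\<bar> \<le> C * norm x powr (- s)"
  shows "(f \<longlongrightarrow> 0) at_infinity"
proof (rule Lim_null_comparison)
  show "\<forall>\<^sub>F x in at_infinity. norm (f x) \<le> C * norm x powr (- s)"
    unfolding eventually_at_infinity using assms(2) by (intro exI[of _ 2]) auto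
  have "((\<lambda>x::real^'n. norm x powr (- s)) \<longlongrightarrow> 0) at_infinity"
    using assms(1) by (intro tendsto_neg_powr filterlim_norm_at_top) auto
  then show "((\<lambda>x::real^'n. C * norm x powr (- s)) \<longlongrightarrow> 0) at_infinity"
    by (rule tendsto_mult_right_zero)
qed

lemma O2_tendsto:
  fixes u :: "real^'n \<Rightarrow> real"
  assumes "O2 \<beta> u" "\<beta> > 0"
  shows "(u \<longlongrightarrow> 0) at_infinity" "(partial (- cball 0 1) i u \<longlongrightarrow> 0) at_infinity"
proof -
  obtain C where C: "\<And>x. norm x > 1 \<Longrightarrow> \<bar>u x\<bar> \<le> C * norm x powr (- \<beta>)"
    "\<And>x i. norm x > 1 \<Longrightarrow> \<bar>partial (- cball 0 1) i u x\<bar> \<le> C * norm x powr (- \<beta> - 1)"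
    using O2_bounds[OF assms(1)] by blast
  show "(u \<longlongrightarrow> 0) at_infinity"
    using tendsto_zero_powr_bound[OF assms(2) C(1)] .
  show "(partial (- cball 0 1) i u \<longlongrightarrow> 0) at_infinity"
    by (rule tendsto_zero_powr_bound[of "\<beta> + 1"]) (use C(2) assms(2) in auto)
qed

lemma norm_le_sum_norm_components:
  fixes v :: "('b::real_normed_vector)^'n"
  shows "norm v \<le> (\<Sum>i\<in>UNIV. norm (v $ i))"
  by (simp add: norm_vec_def L2_set_le_sum)

lemma norm_matrix_le_sum:
  fixes B :: "real^'n^'m"
  shows "norm B \<le> (\<Sum>i\<in>UNIV. \<Sum>j\<in>UNIV. \<bar>B $ i $ j\<bar>)"
  using order_trans[OF norm_le_sum_norm_components sum_mono[OF norm_le_sum_norm_components], of B]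
  by simp

text \<open>Serves to strip the Kronecker delta that is subtracted from the fields and the metric in
  the asymptotic conditions.\<close>

lemma partial_diff_const:
  assumes "chart_domain S" "x \<in> S" "f differentiable (at x within S)"
  shows "partial S i (\<lambda>y. f y - c) x = partial S i f x"
proof -
  have "((\<lambda>y. f y - c) has_derivative fderiv S f x) (at x within S)"
    using has_derivative_diff[OF iffD1[OF frechet_derivative_works assms(3)] has_derivative_const[of c]]
    by simp
  from fderiv_eqI[OF assms(1,2) this] show ?thesis
    by (simp add: partial_def)
qed

locale killing_translations = riemannian_manifold M A g
  for M :: "'a topology" and A :: "('a, 'n::finite) chart set" and g :: "('a, 'n) metric" +
  fixes X :: "'n \<Rightarrow> ('a, 'n) vector_field" and e :: "('a, 'n) chart" and \<beta> :: real
  assumes conn: "connected_space M"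
    and flat_end: "asymptotically_flat_chart A g e \<beta>"
    and X_killing: "\<And>i. killing_field A g (X i)"
    and X_end: "\<And>i. asymptotic_to_translation (X i) e \<beta> i"
begin

lemma e_chart: "e \<in> A" and e_image: "coord_image e = - cball 0 1" and \<beta>_pos: "0 < \<beta>"
  using flat_end by (auto simp: asymptotically_flat_chart_def)

lemma X_C1: "C1_vector_field A (X i)"
  using X_killing by (simp add: killing_field_def)

lemma X_C1_on: "c \<in> A \<Longrightarrow> C1_on (coord_image c) (X i c)"
  by (rule vector_field_C1[OF X_C1])

lemma eventually_end: "\<forall>\<^sub>F x in at_infinity. x \<in> coord_image e"
  unfolding eventually_at_infinity e_image by (intro exI[of _ 2]) auto

lemma metric_end_O2:
  shows "O2 \<beta> (\<lambda>x. g e x $ i $ j - (if i = j then 1 else 0))"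
    and "x \<in> coord_image e \<Longrightarrow> partial (coord_image e) k (\<lambda>x. g e x $ i $ j - (if i = j then 1 else 0)) x
      = fderiv (coord_image e) (g e) x (axis k 1) $ i $ j"
proof -
  show "O2 \<beta> (\<lambda>x. g e x $ i $ j - (if i = j then 1 else 0))"
    using flat_end by (simp add: asymptotically_flat_chart_def)
  assume x: "x \<in> coord_image e"
  note g1 = C2_onD(1)[OF metric_C2[OF e_chart]] and dom = coord_domain[OF e_chart]
  have "(\<lambda>x. g e x $ i $ j) differentiable (at x within coord_image e)"
    using C1_onD(1)[OF C1_on_component[OF dom C1_on_component[OF dom g1]] x] differentiableI by blast
  from partial_diff_const[OF dom x this]
  show "partial (coord_image e) k (\<lambda>x. g e x $ i $ j - (if i = j then 1 else 0)) x
      = fderiv (coord_image e) (g e) x (axis k 1) $ i $ j"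
    by (simp add: partial_matrix_component[OF dom x g1])
qed

lemma metric_end_tendsto: "(g e \<longlongrightarrow> mat 1) at_infinity"
proof (intro vec_tendstoI)
  fix i j
  have "((\<lambda>x. g e x $ i $ j - (if i = j then 1 else 0)) \<longlongrightarrow> 0) at_infinity"
    by (rule O2_tendsto(1)[OF metric_end_O2(1) \<beta>_pos])
  then show "((\<lambda>x. g e x $ i $ j) \<longlongrightarrow> mat 1 $ i $ j) at_infinity"
    by (simp add: mat_def LIM_zero_iff)
qed

lemma metric_end_deriv_bound:
  obtains C where "\<And>x. norm x > 1 \<Longrightarrow>
    (\<Sum>k\<in>UNIV. norm (fderiv (coord_image e) (g e) x (axis k 1))) \<le> C * norm x powr (- \<beta> - 1)"
proof -
  have "\<exists>C. \<forall>x k. norm x > 1 \<longrightarrow>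
    \<bar>fderiv (coord_image e) (g e) x (axis k 1) $ i $ j\<bar> \<le> C * norm x powr (- \<beta> - 1)" for i j
  proof -
    obtain C where C: "\<And>x k. norm x > 1 \<Longrightarrow>
        \<bar>partial (- cball 0 1) k (\<lambda>x. g e x $ i $ j - (if i = j then 1 else 0)) x\<bar> \<le> C * norm x powr (- \<beta> - 1)"
      using O2_bounds[OF metric_end_O2(1)[of i j]] by blast
    show ?thesis
    proof (intro exI[of _ C] allI impI)
      fix x :: "real^'n" and k assume x: "norm x > 1"
      then have "x \<in> coord_image e"
        by (simp add: e_image)
      from metric_end_O2(2)[OF this, of k i j] C[OF x, of k]
      show "\<bar>fderiv (coord_image e) (g e) x (axis k 1) $ i $ j\<bar> \<le> C * norm x powr (- \<beta> - 1)"
        by (simp add: e_image)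
    qed
  qed
  then obtain C where C: "\<And>i j x k. norm x > 1 \<Longrightarrow>
    \<bar>fderiv (coord_image e) (g e) x (axis k 1) $ i $ j\<bar> \<le> C i j * norm x powr (- \<beta> - 1)"
    by metis
  show ?thesis
  proof (rule that)
    fix x :: "real^'n" assume x: "norm x > 1"
    have "(\<Sum>k\<in>UNIV. norm (fderiv (coord_image e) (g e) x (axis k 1)))
        \<le> (\<Sum>k\<in>(UNIV::'n set). \<Sum>i\<in>UNIV. \<Sum>j\<in>UNIV. C i j * norm x powr (- \<beta> - 1))"
      by (rule sum_mono, rule order_trans[OF norm_matrix_le_sum]) (intro sum_mono C[OF x])
    then show "(\<Sum>k\<in>UNIV. norm (fderiv (coord_image e) (g e) x (axis k 1)))
        \<le> (\<Sum>k\<in>(UNIV::'n set). \<Sum>i\<in>UNIV. \<Sum>j\<in>UNIV. C i j) * norm x powr (- \<beta> - 1)"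
      by (simp only: sum_distrib_right)
  qed
qed

lemma X_end_tendsto:
  shows "(X i e \<longlongrightarrow> axis i 1) at_infinity"
    and "((\<lambda>x. fderiv (coord_image e) (X i e) x (axis j 1)) \<longlongrightarrow> 0) at_infinity"
proof -
  note dom = coord_domain[OF e_chart] and X1 = X_C1_on[OF e_chart, of i]
  have O2: "O2 \<beta> (\<lambda>x. X i e x $ k - axis i 1 $ k)" for k
    using X_end by (simp add: asymptotic_to_translation_def)
  show "(X i e \<longlongrightarrow> axis i 1) at_infinity"
    using O2_tendsto(1)[OF O2 \<beta>_pos] by (intro vec_tendstoI) (simp add: LIM_zero_iff)
  show "((\<lambda>x. fderiv (coord_image e) (X i e) x (axis j 1)) \<longlongrightarrow> 0) at_infinity"
  proof (rule vec_tendstoI)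
    fix k
    have "\<forall>\<^sub>F x in at_infinity. partial (coord_image e) j (\<lambda>x. X i e x $ k - axis i 1 $ k) x
        = fderiv (coord_image e) (X i e) x (axis j 1) $ k"
      using eventually_end
    proof eventually_elim
      case (elim x)
      have "(\<lambda>x. X i e x $ k) differentiable (at x within coord_image e)"
        using C1_onD(1)[OF C1_on_component[OF dom X1] elim] differentiableI by blast
      from partial_diff_const[OF dom elim this] show ?case
        by (simp add: partial_component[OF dom elim X1])
    qed
    with O2_tendsto(2)[OF O2 \<beta>_pos, of j k, folded e_image]
    show "((\<lambda>x. fderiv (coord_image e) (X i e) x (axis j 1) $ k) \<longlongrightarrow> 0 $ k) at_infinity"
      by (auto intro: Lim_transform_eventually)
  qed
qed

text \<open>The exterior of a large ball is the open set that starts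
  \<open>chart_propagation\<close>; a radius of at least 1 keeps it inside the image of the end
  chart.\<close>

lemma propagate_from_infinity:
  assumes inv: "\<And>c d x. c \<in> A \<Longrightarrow> d \<in> A \<Longrightarrow> x \<in> overlap c d \<Longrightarrow> Q c x \<Longrightarrow> Q d (transition c d x)"
    and local: "\<And>c x. c \<in> A \<Longrightarrow> x \<in> coord_image c \<Longrightarrow>
      \<exists>N. openin (top_of_set (coord_image c)) N \<and> x \<in> N \<and>
        (\<forall>U. openin (top_of_set (coord_image c)) U \<longrightarrow> U \<noteq> {} \<longrightarrow> U \<subseteq> N \<longrightarrow> (\<forall>y\<in>U. Q c y) \<longrightarrow> (\<forall>y\<in>N. Q c y))"
    and start: "\<forall>\<^sub>F x in at_infinity. Q e x"
    and c: "c \<in> A" and x: "x \<in> coord_image c"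
  shows "Q c x"
proof -
  obtain R where R: "\<And>x. norm x \<ge> R \<Longrightarrow> Q e x"
    using start by (auto simp: eventually_at_infinity)
  define r where "r = max 1 R"
  show ?thesis
  proof (rule chart_propagation[OF conn inv local e_chart _ _ _ c x])
    show "openin (top_of_set (coord_image e)) (- cball 0 r)"
      by (auto simp: openin_open e_image r_def open_Compl intro!: exI[of _ "- cball 0 r"])
    \<comment> \<open>Any axis vector scaled to length \<open>r + 1\<close> shows that the exterior
      is nonempty; \<open>undefined\<close> merely names some index.\<close>
    have "(r + 1) *\<^sub>R axis undefined 1 \<in> - cball (0::real^'n) r"
      by (simp add: r_def)
    then show "- cball (0::real^'n) r \<noteq> {}"
      by blast
    show "Q e y" if "y \<in> - cball 0 r" for y
      using that by (intro R) (simp add: r_def)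
  qed
qed

text \<open>A change of chart multiplies brackets by the Jacobian, unique continuation on the
  compact convex sets of \<open>chart_domain_nbhd\<close> supplies the local spreading, and the
  decay at the end provides the start.\<close>

lemma brackets_vanish:
  assumes "c \<in> A" "x \<in> coord_image c"
  shows "bracket (coord_image c) (X i c) (X j c) x = 0"
proof -
  have "\<forall>i j. bracket (coord_image c) (X i c) (X j c) x = 0"
  proof (rule propagate_from_infinity[where Q = "\<lambda>c x. \<forall>i j. bracket (coord_image c) (X i c) (X j c) x = 0", OF _ _ _ assms])
    show "\<forall>i j. bracket (coord_image d) (X i d) (X j d) (transition c d x) = 0"
      if "c \<in> A" "d \<in> A" "x \<in> overlap c d" "\<forall>i j. bracket (coord_image c) (X i c) (X j c) x = 0" for c d x
      using bracket_transition[OF that(1-3) X_C1 X_C1] that(4) by simp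
  next
    fix c x assume c: "c \<in> A" and x: "x \<in> coord_image c"
    let ?S = "coord_image c"
    interpret metric_domain ?S "g c"
      by (rule metric_domain[OF c])
    obtain K r where K: "compact K" "convex K" "K \<subseteq> ?S" "0 < r" "r \<le> 1" "?S \<inter> ball x r \<subseteq> K"
        "K \<subseteq> cball x 1"
      by (rule chart_domain_nbhd[OF S x zero_less_one])
    have "\<forall>y\<in>?S \<inter> ball x r. \<forall>i j. bracket ?S (X i c) (X j c) y = 0"
      if U: "openin (top_of_set ?S) U" "U \<noteq> {}" "U \<subseteq> ?S \<inter> ball x r"
        "\<forall>y\<in>U. \<forall>i j. bracket ?S (X i c) (X j c) y = 0" for U
    proof (intro ballI allI)
      fix y i j assume y: "y \<in> ?S \<inter> ball x r"
      obtain V where V: "open V" "U = ?S \<inter> V"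
        using U(1) by (auto simp: openin_open)
      \<comment> \<open>\<open>U\<close> is only relatively open and may contain boundary points.
        Density of the interior provides a full closed ball inside \<open>U\<close>, as unique
        continuation demands.\<close>
      then have "V \<inter> closure (interior ?S) \<noteq> {}"
        using U(2) chart_domain_subset_closure_interior[OF S] by blast
      then have "V \<inter> interior ?S \<noteq> {}"
        using open_Int_closure_eq_empty[OF V(1)] by blast
      then obtain q where "q \<in> V \<inter> interior ?S"
        by blast
      then obtain \<rho> where \<rho>: "0 < \<rho>" "cball q \<rho> \<subseteq> V \<inter> interior ?S"
        using open_contains_cball[of "V \<inter> interior ?S"] V(1) by blast
      then have \<rho>U: "cball q \<rho> \<subseteq> U"
        using V(2) interior_subset by blast
      show "bracket ?S (X i c) (X j c) y = 0"
      proof (rule bracket_unique_continuation[OF killing_field_local killing_field_local K(1-3) \<rho>(1)])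
        show "cball q \<rho> \<subseteq> K" "y \<in> K"
          using \<rho>U U(3) K(6) y by blast+
        show "bracket ?S (X i c) (X j c) z = 0" if "z \<in> cball q \<rho>" for z
          using that \<rho>U U(4) by blast
      qed (rule X_killing c)+
    qed
    then show "\<exists>N. openin (top_of_set ?S) N \<and> x \<in> N \<and>
        (\<forall>U. openin (top_of_set ?S) U \<longrightarrow> U \<noteq> {} \<longrightarrow> U \<subseteq> N \<longrightarrow>
          (\<forall>y\<in>U. \<forall>i j. bracket ?S (X i c) (X j c) y = 0) \<longrightarrow>
          (\<forall>y\<in>N. \<forall>i j. bracket ?S (X i c) (X j c) y = 0))"
      using K(4) x by (intro exI[of _ "?S \<inter> ball x r"]) (auto simp: openin_open_Int)
  next
    let ?S = "coord_image e"
    interpret metric_domain ?S "g e"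
      by (rule metric_domain[OF e_chart])
    have "\<forall>\<^sub>F x in at_infinity. bracket ?S (X i e) (X j e) x = 0" for i j
    proof -
      obtain C where C: "\<And>x. norm x > 1 \<Longrightarrow>
          (\<Sum>k\<in>UNIV. norm (fderiv ?S (g e) x (axis k 1))) \<le> C * norm x powr (- \<beta> - 1)"
        using metric_end_deriv_bound by blast
      have end_S: "norm x > 1 \<Longrightarrow> x \<in> ?S" for x
        by (simp add: e_image)
      obtain R where "\<And>x. norm x > R \<Longrightarrow> bracket ?S (X i e) (X j e) x = 0"
        using bracket_vanishes_near_infinity[OF killing_field_local[OF X_killing e_chart]
            killing_field_local[OF X_killing e_chart] \<beta>_pos end_S metric_end_tendsto C
            X_end_tendsto(1) X_end_tendsto(2) X_end_tendsto(1) X_end_tendsto(2)] by blast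
      then show ?thesis
        unfolding eventually_at_infinity by (intro exI[of _ "R + 1"]) auto
    qed
    then show "\<forall>\<^sub>F x in at_infinity. \<forall>i j. bracket ?S (X i e) (X j e) x = 0"
      by (intro eventually_all_finite)
  qed
  then show ?thesis
    by blast
qed

section \<open>Constancy of the Gram matrix and orthonormality of the frame\<close>

definition gram :: "('a, 'n) chart \<Rightarrow> 'n \<Rightarrow> 'n \<Rightarrow> real^'n \<Rightarrow> real" where
  "gram c i j x = X i c x \<bullet> (g c x *v X j c x)"

lemma continuous_on_gram: "c \<in> A \<Longrightarrow> continuous_on (coord_image c) (gram c i j)"
  unfolding gram_def[abs_def]
  by (intro continuous_intros continuous_on_matrix_vector_mult C1_onD(4)[OF X_C1_on]
      C1_onD(4)[OF C2_onD(1)[OF metric_C2]])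

text \<open>The differential of \<open>g(X\<^sub>i, X\<^sub>j)\<close> vanishes on every
  \<open>X\<^sub>k\<close> because the brackets do. The determinant condition says that these
  vectors span, so the whole differential vanishes.\<close>

lemma gram_has_derivative_zero:
  assumes c: "c \<in> A" and x: "x \<in> coord_image c" and det: "det (\<chi> k. X k c x) \<noteq> 0"
  shows "(gram c i j has_derivative (\<lambda>_. 0)) (at x within coord_image c)"
proof -
  let ?S = "coord_image c"
  interpret metric_domain ?S "g c"
    by (rule metric_domain[OF c])
  have "(gram c i j) differentiable (at x within ?S)"
    unfolding gram_def[abs_def]
    by (rule differentiableI)
       (auto intro!: derivative_eq_intros g_has_derivative x C1_onD(1)[OF X_C1_on[OF c] x])
  then have d: "(gram c i j has_derivative fderiv ?S (gram c i j) x) (at x within ?S)"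
    by (rule iffD1[OF frechet_derivative_works])
  have "fderiv ?S (gram c i j) x (X k c x) = 0" for k
    unfolding gram_def[abs_def]
    by (rule inner_derivative_along_commuting_killing[OF killing_field_local[OF X_killing c]
        X_C1_on[OF c] X_C1_on[OF c] x brackets_vanish[OF c x] brackets_vanish[OF c x]])
  have "fderiv ?S (gram c i j) x v = 0" for v
  proof (rule linear_eq_0_on_span[OF has_derivative_linear[OF d], where b = "range (\<lambda>k. X k c x)"])
    show "fderiv ?S (gram c i j) x w = 0" if "w \<in> range (\<lambda>k. X k c x)" for w
      using that \<open>\<And>k. fderiv ?S (gram c i j) x (X k c x) = 0\<close> by blast
  qed (simp add: span_rows_det_nonzero[OF det])
  then have "fderiv ?S (gram c i j) x = (\<lambda>_. 0)"
    by (rule ext)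
  with d show ?thesis
    by simp
qed

text \<open>Far out the fields are close to the coordinate directions, so their determinant is close
  to 1 and the Gram entries have zero derivative; along each ray they equal their limit.\<close>

lemma gram_end: "\<forall>\<^sub>F x in at_infinity. gram e i j x = (if i = j then 1 else 0)"
proof -
  have "((\<lambda>x. det (\<chi> k. X k e x)) \<longlongrightarrow> det ((\<chi> k. axis k 1) :: real^'n^'n)) at_infinity"
    by (intro tendsto_det tendsto_vec_lambda X_end_tendsto)
  moreover have "((\<chi> k. axis k 1) :: real^'n^'n) = mat 1"
    by (simp add: vec_eq_iff axis_def mat_def eq_commute)
  ultimately have "\<forall>\<^sub>F x in at_infinity. det (\<chi> k. X k e x) \<noteq> 0"
    by (intro tendsto_imp_eventually_ne[of _ 1]) simp_all
  then obtain R0 where R0: "\<And>x. norm x \<ge> R0 \<Longrightarrow> det (\<chi> k. X k e x) \<noteq> 0"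
    by (auto simp: eventually_at_infinity)
  define R where "R = max 1 R0"
  have "gram e i j x = (if i = j then 1 else 0)" if "norm x > R" for x
  proof (rule constant_radial[OF _ _ _ that])
    show "(gram e i j has_derivative (\<lambda>_. 0)) (at y)" if "norm y > R" for y
    proof -
      have y: "y \<in> coord_image e" "open (coord_image e)"
        using that by (auto simp: e_image R_def open_Compl)
      show ?thesis
        using gram_has_derivative_zero[OF e_chart y(1) R0] that
        unfolding at_within_open[OF y] by (simp add: R_def)
    qed
    have "(gram e i j \<longlongrightarrow> (axis i 1 :: real^'n) \<bullet> ((mat 1 :: real^'n^'n) *v axis j 1)) at_infinity"
      unfolding gram_def[abs_def]
      by (intro tendsto_inner tendsto_matrix_vector_mult X_end_tendsto metric_end_tendsto)
    then show "(gram e i j \<longlongrightarrow> (if i = j then 1 else 0)) at_infinity"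
      by (cases "i = j") (simp_all add: inner_axis_axis)
  qed (simp add: R_def)
  then show ?thesis
    unfolding eventually_at_infinity by (intro exI[of _ "R + 1"]) auto
qed

text \<open>Constancy of the Gram entries depends on linear independence, which in turn is derived
  from orthonormality. Continuation breaks the circle: orthonormality at one point gives a nonzero
  determinant nearby, hence constant entries on a convex neighbourhood.\<close>

lemma gram_orthonormal:
  assumes "c \<in> A" "x \<in> coord_image c"
  shows "gram c i j x = (if i = j then 1 else 0)"
proof -
  let ?Q = "\<lambda>c x. \<forall>i j. gram c i j x = (if i = j then 1 else 0)"
  have det: "det (\<chi> k. X k c x) \<noteq> 0" if "?Q c x" for c x
    using that det_nonzero_orthonormal[of "\<lambda>k. X k c x" "g c x"] by (simp add: gram_def)
  have "?Q c x"
  proof (rule propagate_from_infinity[where Q = ?Q, OF _ _ _ assms])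
    show "?Q d (transition c d x)" if "c \<in> A" "d \<in> A" "x \<in> overlap c d" "?Q c x" for c d x
      using metric_transition[OF that(1-3) X_C1 X_C1] that(4) by (simp add: gram_def)
    show "\<forall>\<^sub>F x in at_infinity. ?Q e x"
      by (intro eventually_all_finite gram_end)
  next
    fix c x assume c: "c \<in> A" and x: "x \<in> coord_image c"
    let ?S = "coord_image c"
    show "\<exists>N. openin (top_of_set ?S) N \<and> x \<in> N \<and>
        (\<forall>U. openin (top_of_set ?S) U \<longrightarrow> U \<noteq> {} \<longrightarrow> U \<subseteq> N \<longrightarrow> (\<forall>y\<in>U. ?Q c y) \<longrightarrow> (\<forall>y\<in>N. ?Q c y))"
    proof (cases "?Q c x")
      case False
      \<comment> \<open>Some entry misses its target at \<open>x\<close>, hence by continuity on a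
        whole relative neighbourhood. No nonempty \<open>U\<close> with the required property fits
        into it, so spreading holds vacuously.\<close>
      then obtain i j where ij: "gram c i j x \<noteq> (if i = j then 1 else 0)"
        by blast
      have "openin (top_of_set ?S) (?S \<inter> gram c i j -` (- {if i = j then 1 else 0}))"
        by (rule continuous_openin_preimage_gen[OF continuous_on_gram[OF c]]) auto
      with ij x show ?thesis
        by (intro exI[of _ "?S \<inter> gram c i j -` (- {if i = j then 1 else 0})"]) blast
    next
      case True
      have "continuous_on ?S (\<lambda>x. det (\<chi> k. X k c x))"
        by (intro continuous_on_det continuous_on_vec_lambda C1_onD(4)[OF X_C1_on[OF c]])
      then have "openin (top_of_set ?S) (?S \<inter> (\<lambda>x. det (\<chi> k. X k c x)) -` (- {0}))"
        by (rule continuous_openin_preimage_gen) auto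
      then obtain \<epsilon> where \<epsilon>: "\<epsilon> > 0" "\<And>y. y \<in> ?S \<Longrightarrow> dist y x < \<epsilon> \<Longrightarrow> det (\<chi> k. X k c y) \<noteq> 0"
        using det[OF True] x unfolding openin_euclidean_subtopology_iff by force
      \<comment> \<open>Half of \<open>\<epsilon>\<close> keeps the closed set \<open>K\<close>
        strictly within distance \<open>\<epsilon>\<close> of \<open>x\<close>, so the determinant
        is nonzero on all of \<open>K\<close>.\<close>
      obtain K r where K: "compact K" "convex K" "K \<subseteq> ?S" "0 < r" "r \<le> \<epsilon> / 2" "?S \<inter> ball x r \<subseteq> K"
          "K \<subseteq> cball x (\<epsilon> / 2)"
        by (rule chart_domain_nbhd[OF coord_domain[OF c] x half_gt_zero[OF \<epsilon>(1)]])
      have "?Q c y" if u: "u \<in> ?S \<inter> ball x r" "?Q c u" and y: "y \<in> ?S \<inter> ball x r" for u y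
      proof (intro allI)
        fix i j
        have "(gram c i j has_derivative (\<lambda>_. 0)) (at z within K)" if "z \<in> K" for z
        proof -
          have "det (\<chi> k. X k c z) \<noteq> 0"
            using that K(3,7) \<epsilon> by (intro \<epsilon>(2)) (auto simp: dist_commute subset_iff)
          from gram_has_derivative_zero[OF c _ this] show ?thesis
            using that K(3) by (blast intro: has_derivative_subset)
        qed
        then obtain l where "\<And>z. z \<in> K \<Longrightarrow> gram c i j z = l"
          using has_derivative_zero_constant[OF K(2), of "gram c i j"] by blast
        then have "gram c i j y = gram c i j u"
          using K(6) u y by (metis subsetD)
        then show "gram c i j y = (if i = j then 1 else 0)"
          using u by simp
      qed
      then have spread: "\<forall>y\<in>?S \<inter> ball x r. ?Q c y" if "U \<noteq> {}" "U \<subseteq> ?S \<inter> ball x r" "\<forall>y\<in>U. ?Q c y" for U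
        using that by blast
      show ?thesis
      proof (intro exI[of _ "?S \<inter> ball x r"] conjI allI impI)
        show "openin (top_of_set ?S) (?S \<inter> ball x r)" "x \<in> ?S \<inter> ball x r"
          using K(4) x by (simp_all add: openin_open_Int)
      qed (rule spread)
    qed
  qed
  then show ?thesis
    by blast
qed

lemma frame_det: "c \<in> A \<Longrightarrow> x \<in> coord_image c \<Longrightarrow> det (\<chi> k. X k c x) \<noteq> 0"
  using gram_orthonormal by (intro det_nonzero_orthonormal[where A = "g c x"]) (simp add: gram_def)

lemma frame_span: "c \<in> A \<Longrightarrow> x \<in> coord_image c \<Longrightarrow> span (range (\<lambda>k. X k c x)) = UNIV"
  by (rule span_rows_det_nonzero[OF frame_det])

end

section \<open>Christoffel symbols, parallelism and flatness\<close>

context killing_translations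
begin

text \<open>With \<open>?E\<close> the matrix of rows \<open>X m c x\<close>, orthonormality makes
  \<open>transpose ?E ** ?E\<close> the inverse metric. This polynomial formula yields the
  regularity of the inverse from that of the fields.\<close>

lemma metric_inverse:
  assumes c: "c \<in> A" and x: "x \<in> coord_image c"
  shows "g c x ** matrix_inv (g c x) = mat 1"
    and "matrix_inv (g c x) $ k $ l = (\<Sum>m\<in>UNIV. X m c x $ k * X m c x $ l)"
proof -
  let ?E = "\<chi> m. X m c x" and ?g = "g c x"
  have "(?E ** (?g ** transpose ?E)) $ i $ j = gram c i j x" for i j
    by (simp add: gram_def matrix_matrix_mult_def transpose_def matrix_vector_mult_def inner_vec_def)
  then have "?E ** (?g ** transpose ?E) = mat 1"
    using gram_orthonormal[OF c x] by (simp add: vec_eq_iff mat_def)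
  then have right: "?g ** (transpose ?E ** ?E) = mat 1"
    using matrix_left_right_inverse[of ?E "?g ** transpose ?E"] by (simp add: matrix_mul_assoc)
  then have left: "(transpose ?E ** ?E) ** ?g = mat 1"
    by (rule matrix_left_right_inverse1)
  have "\<exists>B. ?g ** B = mat 1 \<and> B ** ?g = mat 1"
    by (intro exI[of _ "transpose ?E ** ?E"] conjI right left)
  then have inv: "?g ** matrix_inv ?g = mat 1 \<and> matrix_inv ?g ** ?g = mat 1"
    unfolding matrix_inv_def by (rule someI_ex)
  then show "?g ** matrix_inv ?g = mat 1"
    by blast
  have "matrix_inv ?g = matrix_inv ?g ** (?g ** (transpose ?E ** ?E))"
    using right by simp
  also have "\<dots> = transpose ?E ** ?E"
    using inv by (simp add: matrix_mul_assoc)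
  finally show "matrix_inv ?g $ k $ l = (\<Sum>m\<in>UNIV. X m c x $ k * X m c x $ l)"
    by (simp add: matrix_matrix_mult_def transpose_def)
qed

text \<open>Lowering the upper index cancels the inverse metric and leaves the Christoffel symbols
  of the first kind, the form in which \<open>commuting_killing_frame_parallel\<close> expresses the
  connection.\<close>

lemma christoffel_lower:
  assumes c: "c \<in> A" and x: "x \<in> coord_image c"
  shows "(\<Sum>k\<in>UNIV. g c x $ m $ k * christoffel g c k i j x) =
    (fderiv (coord_image c) (g c) x (axis i 1) $ j $ m + fderiv (coord_image c) (g c) x (axis j 1) $ i $ m
     - fderiv (coord_image c) (g c) x (axis m 1) $ i $ j) / 2"
proof -
  note dom = coord_domain[OF c] and g1 = C2_onD(1)[OF metric_C2[OF c]]
  define b where "b = (\<chi> l. (fderiv (coord_image c) (g c) x (axis i 1) $ j $ l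
    + fderiv (coord_image c) (g c) x (axis j 1) $ i $ l - fderiv (coord_image c) (g c) x (axis l 1) $ i $ j) / 2)"
  have "christoffel g c k i j x = (matrix_inv (g c x) *v b) $ k" for k
    unfolding christoffel_def Let_def partial_matrix_component[OF dom x g1]
    by (simp add: matrix_vector_mult_def b_def sum_divide_distrib)
  then have "(\<Sum>k\<in>UNIV. g c x $ m $ k * christoffel g c k i j x) = (g c x *v (matrix_inv (g c x) *v b)) $ m"
    by (simp add: matrix_vector_mult_def[of "g c x"])
  also have "\<dots> = b $ m"
    by (simp add: matrix_vector_mul_assoc metric_inverse(1)[OF c x])
  finally show ?thesis
    by (simp add: b_def)
qed

text \<open>After multiplication by the metric, the component with index \<open>m\<close> is the
  expression of \<open>commuting_killing_frame_parallel\<close> at \<open>u = axis i 1\<close> and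
  \<open>v = axis m 1\<close>; nonsingularity of the metric then removes the factor.\<close>

lemma cov_deriv_zero:
  assumes c: "c \<in> A" and x: "x \<in> coord_image c"
  shows "cov_deriv g (X p) c i k x = 0"
proof -
  let ?S = "coord_image c"
  interpret metric_domain ?S "g c"
    by (rule metric_domain[OF c])
  have g'_entry_sym: "g' x u $ a $ b = g' x u $ b $ a" for u a b
    using g'_sym[OF x, of "axis a 1" u "axis b 1"] by (simp add: inner_axis' matrix_vector_mult_axis)
  have "(g c x *v (\<chi> k. cov_deriv g (X p) c i k x)) $ m = 0" for m
  proof -
    let ?X = "X p c x"
    have "(g c x *v (\<chi> k. cov_deriv g (X p) c i k x)) $ m
        = (\<Sum>k\<in>UNIV. g c x $ m $ k * fderiv ?S (X p c) x (axis i 1) $ k)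
          + (\<Sum>k\<in>UNIV. \<Sum>j\<in>UNIV. g c x $ m $ k * christoffel g c k i j x * ?X $ j)"
      by (simp add: matrix_vector_mult_def cov_deriv_def partial_component[OF S x X_C1_on[OF c]]
          distrib_left sum.distrib sum_distrib_left mult.assoc)
    also have "(\<Sum>k\<in>UNIV. \<Sum>j\<in>UNIV. g c x $ m $ k * christoffel g c k i j x * ?X $ j)
        = (\<Sum>j\<in>UNIV. (g' x (axis i 1) $ j $ m + g' x (axis j 1) $ i $ m - g' x (axis m 1) $ i $ j) / 2 * ?X $ j)"
      unfolding christoffel_lower[OF c x, symmetric] sum_distrib_right by (rule sum.swap)
    also have "\<dots> = (axis m 1 \<bullet> (g' x (axis i 1) *v ?X) + axis m 1 \<bullet> (g' x ?X *v axis i 1)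
        - axis i 1 \<bullet> (g' x (axis m 1) *v ?X)) / 2"
      by (simp add: inner_axis' matrix_vector_mult_axis linear_matrix_component_sum[OF g'_linear[OF x], of ?X]
          matrix_vector_mult_def[of _ ?X] sum.distrib sum_subtractf sum_divide_distrib[symmetric]
          add_divide_distrib diff_divide_distrib ring_distribs g'_entry_sym[of _ m] mult.commute)
    also have "(\<Sum>k\<in>UNIV. g c x $ m $ k * fderiv ?S (X p c) x (axis i 1) $ k)
        = axis m 1 \<bullet> (g c x *v fderiv ?S (X p c) x (axis i 1))"
      by (simp add: inner_axis' matrix_vector_mult_def)
    finally show ?thesis
      using commuting_killing_frame_parallel[OF killing_field_local[OF X_killing c] x brackets_vanish[OF c x]
          frame_span[OF c x], of "axis m 1" p "axis i 1"] by simp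
  qed
  then have "g c x *v (\<chi> k. cov_deriv g (X p) c i k x) = 0"
    by (simp add: vec_eq_iff)
  from metric_nonsingular[OF x this] show ?thesis
    by (simp add: vec_eq_iff)
qed

text \<open>The metric is C2, so its first derivatives are C1, and by \<open>metric_inverse\<close>
  the inverse metric is a polynomial in the C1 components of the fields.\<close>

lemma christoffel_C1:
  assumes c: "c \<in> A"
  shows "C1_on (coord_image c) (christoffel g c k i j)"
proof -
  let ?S = "coord_image c"
  note dom = coord_domain[OF c]
  have g1: "C1_on ?S (\<lambda>x. partial ?S i (\<lambda>y. g c y $ j $ l) x)" for i j l
    using C1_on_component[OF dom C1_on_component[OF dom C2_onD(2)[OF metric_C2[OF c]]]]
    by (rule C1_on_cong) (simp add: partial_matrix_component[OF dom _ C2_onD(1)[OF metric_C2[OF c]]])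
  have X1: "C1_on ?S (\<lambda>x. X m c x $ k)" for m k
    by (rule C1_on_component[OF dom X_C1_on[OF c]])
  have "C1_on ?S (\<lambda>x. (1 / 2) *\<^sub>R (\<Sum>l\<in>UNIV. (\<Sum>m\<in>UNIV. X m c x $ k * X m c x $ l) *
      (partial ?S i (\<lambda>y. g c y $ j $ l) x + partial ?S j (\<lambda>y. g c y $ i $ l) x
       - partial ?S l (\<lambda>y. g c y $ i $ j) x)))"
    by (intro C1_on_scaleR C1_on_sum C1_on_mult C1_on_add C1_on_diff dom g1 X1)
  then show ?thesis
    by (rule C1_on_cong) (simp add: christoffel_def Let_def metric_inverse(2)[OF c])
qed

text \<open>
  \<open>\<nabla>X = 0\<close> expresses the first derivatives of \<open>X\<close> through \<open>X\<close> and the Christoffel symbols, so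
  \<open>X\<close> is \<open>C\<^sup>2\<close> and the symmetry of its second derivatives gives \<open>R(\<partial>\<^sub>i, \<partial>\<^sub>j)X = 0\<close>.
\<close>

lemma riemann_zero:
  assumes c: "c \<in> A" and x: "x \<in> coord_image c"
  shows "riemann g c l k i j x = 0"
proof -
  let ?S = "coord_image c" and ?\<Gamma> = "christoffel g c"
  note dom = coord_domain[OF c]
  have X1: "C1_on ?S (\<lambda>y. X p c y $ m)" for p m
    by (rule C1_on_component[OF dom X_C1_on[OF c]])
  have dX: "fderiv ?S (X p c) y (axis i 1) $ l = - (\<Sum>m\<in>UNIV. ?\<Gamma> l i m y * X p c y $ m)"
    if "y \<in> ?S" for y p i l
    using cov_deriv_zero[OF c that, of p i l] partial_component[OF dom that X_C1_on[OF c], of i p l]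
    by (simp add: cov_deriv_def)
  have F1: "C1_on ?S (\<lambda>y. \<Sum>m\<in>UNIV. ?\<Gamma> l i m y * X p c y $ m)" for p i l
    by (intro C1_on_sum C1_on_mult dom christoffel_C1[OF c] X1)
  have X2: "C2_on ?S (X p c)" for p
  proof (rule C2_onI_axis[OF dom X_C1_on[OF c]], rule C1_on_vec[OF dom])
    fix i l
    have "C1_on ?S (\<lambda>y. (-1) *\<^sub>R (\<Sum>m\<in>UNIV. ?\<Gamma> l i m y * X p c y $ m))"
      by (intro C1_on_scaleR dom F1)
    then show "C1_on ?S (\<lambda>y. fderiv ?S (X p c) y (axis i 1) $ l)"
      by (rule C1_on_cong) (simp add: dX)
  qed
  \<comment> \<open>\<open>dX\<close> is differentiated by the product rule and then substituted for
    the first derivatives that appear. Antisymmetrising the result in \<open>i\<close> and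
    \<open>j\<close> produces the curvature components.\<close>
  have second: "fderiv ?S (\<lambda>y. fderiv ?S (X p c) y (axis j 1)) x (axis i 1) $ l
      = (\<Sum>k\<in>UNIV. (- partial ?S i (?\<Gamma> l j k) x + (\<Sum>m\<in>UNIV. ?\<Gamma> l j m x * ?\<Gamma> m i k x)) * X p c x $ k)"
    for p i j l
  proof -
    let ?d = "\<lambda>v. - (\<Sum>m\<in>UNIV. ?\<Gamma> l j m x * fderiv ?S (X p c) x v $ m + fderiv ?S (?\<Gamma> l j m) x v * X p c x $ m)"
    have Xm: "((\<lambda>y. X p c y $ m) has_derivative (\<lambda>v. fderiv ?S (X p c) x v $ m)) (at x within ?S)" for m
      by (rule bounded_linear.has_derivative[OF bounded_linear_vec_nth C1_onD(1)[OF X_C1_on[OF c] x]])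
    have "((\<lambda>y. - (\<Sum>m\<in>UNIV. ?\<Gamma> l j m y * X p c y $ m)) has_derivative ?d) (at x within ?S)"
      by (intro has_derivative_minus has_derivative_sum has_derivative_mult Xm C1_onD(1)[OF christoffel_C1[OF c] x])
    then have "((\<lambda>y. fderiv ?S (X p c) y (axis j 1) $ l) has_derivative ?d) (at x within ?S)"
      by (rule has_derivative_transform[OF x, rotated]) (rule dX)
    from fun_cong[OF fderiv_eqI[OF dom x this], of "axis i 1"]
      fderiv_component[OF dom x C1_onD(1)[OF C2_onD(2)[OF X2, of p "axis j 1"] x], of l "axis i 1"]
    have "fderiv ?S (\<lambda>y. fderiv ?S (X p c) y (axis j 1)) x (axis i 1) $ l = ?d (axis i 1)"
      by simp
    also have "\<dots> = (\<Sum>m\<in>UNIV. \<Sum>k\<in>UNIV. ?\<Gamma> l j m x * ?\<Gamma> m i k x * X p c x $ k)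
        - (\<Sum>k\<in>UNIV. partial ?S i (?\<Gamma> l j k) x * X p c x $ k)"
      by (simp add: dX[OF x] partial_def sum.distrib sum_subtractf sum_distrib_left sum_negf mult.assoc)
    also have "(\<Sum>m\<in>UNIV. \<Sum>k\<in>UNIV. ?\<Gamma> l j m x * ?\<Gamma> m i k x * X p c x $ k)
        = (\<Sum>k\<in>UNIV. (\<Sum>m\<in>UNIV. ?\<Gamma> l j m x * ?\<Gamma> m i k x) * X p c x $ k)"
      unfolding sum_distrib_right by (rule sum.swap)
    finally show ?thesis
      by (simp add: left_diff_distrib sum_subtractf)
  qed
  \<comment> \<open>\<open>X p c x \<bullet> r\<close> is the component with index \<open>l\<close>
    of the curvature operator for \<open>i\<close>, \<open>j\<close> applied to \<open>X p\<close>.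
    Since the fields span, vanishing of all these products gives
    \<open>r \<bullet> r = 0\<close>.\<close>
  define r where "r = (\<chi> k. riemann g c l k i j x)"
  have "X p c x \<bullet> r = 0" for p
  proof -
    have "X p c x \<bullet> r = (\<Sum>k\<in>UNIV. riemann g c l k i j x * X p c x $ k)"
      by (simp add: inner_vec_def r_def mult.commute)
    also have "\<dots> = (\<Sum>k\<in>UNIV. (- partial ?S j (?\<Gamma> l i k) x + (\<Sum>m\<in>UNIV. ?\<Gamma> l i m x * ?\<Gamma> m j k x)) * X p c x $ k)
        - (\<Sum>k\<in>UNIV. (- partial ?S i (?\<Gamma> l j k) x + (\<Sum>m\<in>UNIV. ?\<Gamma> l j m x * ?\<Gamma> m i k x)) * X p c x $ k)"
      unfolding sum_subtractf[symmetric]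
      by (intro sum.cong refl) (simp add: riemann_def Let_def sum_subtractf algebra_simps)
    also have "\<dots> = 0"
      using second[of p j i l] second[of p i j l] second_fderiv_symmetric[OF dom X2[of p] x, of "axis i 1" "axis j 1"]
      by simp
    finally show ?thesis .
  qed
  then have "v \<bullet> r = 0" if "v \<in> range (\<lambda>p. X p c x)" for v
    using that by blast
  then have "r \<bullet> r = 0"
    using linear_eq_0_on_span[of "\<lambda>v. v \<bullet> r" "range (\<lambda>p. X p c x)" r] frame_span[OF c x]
    by (simp add: bounded_linear.linear[OF bounded_linear_inner_left])
  then show ?thesis
    by (simp add: r_def vec_eq_iff)
qed

end

theorem corollary3p2:
  fixes M :: "'a topology"
    and A :: "('a, 'n::finite) chart set"
    and g :: "('a, 'n) metric"
    and X :: "'n \<Rightarrow> ('a, 'n) vector_field"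
    and e :: "('a, 'n) chart"
    and \<beta> :: real
  assumes "manifold_with_boundary M A"
    and "connected_space M"
    and "C2_riemannian_metric A g"
    and "asymptotically_flat_chart A g e \<beta>"
    and "\<And>i. killing_field A g (X i)"
    and "\<And>i. asymptotic_to_translation (X i) e \<beta> i"
  shows "global_orthonormal_frame A g X \<and>
         (\<forall>i. covariant_constant A g (X i)) \<and>
         flat_metric A g"
proof -
  interpret killing_translations M A g X e \<beta>
    using assms by unfold_locales
  show ?thesis
    unfolding global_orthonormal_frame_def covariant_constant_def flat_metric_def
    using gram_orthonormal frame_span cov_deriv_zero riemann_zero by (simp add: gram_def)
qed

end
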